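(* Let $\iota: R\to A$ be a Frobenius extension, and let $T$ be a tilting left $R$-module of finite projective dimension. Then the induced $A$-module $U=A\otimes_R T$ is tilting if and only if $\operatorname{Ext}_R^i(T,U)=0$ for every $i>0$ (where $U$ is regarded as an $R$-module by restriction along $\iota$).
   Context: All rings are associative with unit; modules are left modules unless otherwise specified. A ring extension $\iota:R\to A$ is a unital ring homomorphism, and $A$-modules are viewed as $R$-modules by restriction along $\iota$. It is a Frobenius extension if $A$ is finitely generated projective as a left $R$-module and $A\cong\operatorname{Hom}_R(A,R)$ as $A$-$R$-bimodules, where $(af)(x)=f(xa)$ and $(fr)(x)=f(x)r$. For an $R$-module $M$, $\operatorname{add}_R(M)$ is the class of direct summands of finite direct sums of copies of $M$. An $R$-module $T$ is tilting (of finite projective dimension, in the sense of Miyashita) if: (1) there is an exact sequence $0\to P_m\to\cdots\to P_0\to T\to 0$ with each $P_j$ a finitely generated projective $R$-module; (2) $\operatorname{Ext}_R^i(T,T)=0$ for all $i>0$; (3) there is an exact sequence $0\to R\to T_0\to\cdots\to T_n\to 0$ with each $T_j\in\operatorname{add}_R(T)$. *)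

theory Defs
  imports "HOL-Algebra.Free_Abelian_Groups" "HOL-Algebra.AbelCoset" "HOL-Algebra.Module"
begin

section \<open>Left modules over a not necessarily commutative ring\<close>

text \<open>
  The locale \<open>module\<close> of the library is restricted to commutative rings.  Left modules over an
  arbitrary ring reuse its record type; the fields \<open>mult\<close> and \<open>one\<close> of a module carry no meaning.
\<close>

locale left_module = R?: ring R + M?: abelian_group M
  for R :: "'r ring" (structure) and M :: "('r, 'm) module" (structure) +
  assumes smult_closed [simp, intro]:
      "\<lbrakk>a \<in> carrier R; x \<in> carrier M\<rbrakk> \<Longrightarrow> a \<odot>\<^bsub>M\<^esub> x \<in> carrier M"
    and smult_l_distr:
      "\<lbrakk>a \<in> carrier R; b \<in> carrier R; x \<in> carrier M\<rbrakk> \<Longrightarrow>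
        (a \<oplus>\<^bsub>R\<^esub> b) \<odot>\<^bsub>M\<^esub> x = a \<odot>\<^bsub>M\<^esub> x \<oplus>\<^bsub>M\<^esub> b \<odot>\<^bsub>M\<^esub> x"
    and smult_r_distr:
      "\<lbrakk>a \<in> carrier R; x \<in> carrier M; y \<in> carrier M\<rbrakk> \<Longrightarrow>
        a \<odot>\<^bsub>M\<^esub> (x \<oplus>\<^bsub>M\<^esub> y) = a \<odot>\<^bsub>M\<^esub> x \<oplus>\<^bsub>M\<^esub> a \<odot>\<^bsub>M\<^esub> y"
    and smult_assoc1:
      "\<lbrakk>a \<in> carrier R; b \<in> carrier R; x \<in> carrier M\<rbrakk> \<Longrightarrow>
        (a \<otimes>\<^bsub>R\<^esub> b) \<odot>\<^bsub>M\<^esub> x = a \<odot>\<^bsub>M\<^esub> (b \<odot>\<^bsub>M\<^esub> x)"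
    and smult_one [simp]:
      "x \<in> carrier M \<Longrightarrow> \<one>\<^bsub>R\<^esub> \<odot>\<^bsub>M\<^esub> x = x"

definition lmod_hom :: "'r ring \<Rightarrow> ('r, 'm) module \<Rightarrow> ('r, 'n) module \<Rightarrow> ('m \<Rightarrow> 'n) set" where
  "lmod_hom R M N = {f \<in> carrier M \<rightarrow> carrier N.
     (\<forall>x \<in> carrier M. \<forall>y \<in> carrier M. f (x \<oplus>\<^bsub>M\<^esub> y) = f x \<oplus>\<^bsub>N\<^esub> f y) \<and>
     (\<forall>r \<in> carrier R. \<forall>x \<in> carrier M. f (r \<odot>\<^bsub>M\<^esub> x) = r \<odot>\<^bsub>N\<^esub> f x)}"

definition lmod_iso :: "'r ring \<Rightarrow> ('r, 'm) module \<Rightarrow> ('r, 'n) module \<Rightarrow> ('m \<Rightarrow> 'n) set" where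
  "lmod_iso R M N = {f \<in> lmod_hom R M N. bij_betw f (carrier M) (carrier N)}"

definition regular_module :: "'r ring \<Rightarrow> ('r, 'r) module" where
  "regular_module R =
     \<lparr>carrier = carrier R, mult = monoid.mult R, one = one R,
      zero = zero R, add = add R, smult = monoid.mult R\<rparr>"

definition restrict_scalars :: "('r \<Rightarrow> 'a) \<Rightarrow> ('a, 'm) module \<Rightarrow> ('r, 'm) module" where
  "restrict_scalars \<iota> M =
     \<lparr>carrier = carrier M, mult = monoid.mult M, one = one M, zero = zero M, add = add M,
      smult = (\<lambda>r x. \<iota> r \<odot>\<^bsub>M\<^esub> x)\<rparr>"

definition lmod_dsum :: "('r, 'm) module \<Rightarrow> ('r, 'n) module \<Rightarrow> ('r, 'm \<times> 'n) module" where
  "lmod_dsum M N =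
     \<lparr>carrier = carrier M \<times> carrier N, mult = undefined, one = undefined,
      zero = (\<zero>\<^bsub>M\<^esub>, \<zero>\<^bsub>N\<^esub>),
      add = (\<lambda>(x, y) (x', y'). (x \<oplus>\<^bsub>M\<^esub> x', y \<oplus>\<^bsub>N\<^esub> y')),
      smult = (\<lambda>r (x, y). (r \<odot>\<^bsub>M\<^esub> x, r \<odot>\<^bsub>N\<^esub> y))\<rparr>"

text \<open>The direct sum of copies of \<open>M\<close> indexed by a (possibly infinite) set \<open>X\<close>.\<close>

definition lmod_copies :: "'x set \<Rightarrow> ('r, 'm) module \<Rightarrow> ('r, 'x \<Rightarrow> 'm) module" where
  "lmod_copies X M =
     \<lparr>carrier = {f. (\<forall>i. f i \<in> carrier M) \<and> (\<forall>i. i \<notin> X \<longrightarrow> f i = \<zero>\<^bsub>M\<^esub>) \<and>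
                    finite {i. f i \<noteq> \<zero>\<^bsub>M\<^esub>}},
      mult = undefined, one = undefined,
      zero = (\<lambda>i. \<zero>\<^bsub>M\<^esub>),
      add = (\<lambda>f g i. f i \<oplus>\<^bsub>M\<^esub> g i),
      smult = (\<lambda>r f i. r \<odot>\<^bsub>M\<^esub> f i)\<rparr>"

abbreviation free_lmod :: "'x set \<Rightarrow> 'r ring \<Rightarrow> ('r, 'x \<Rightarrow> 'r) module" where
  "free_lmod X R \<equiv> lmod_copies X (regular_module R)"

text \<open>
  Direct summands are understood up to isomorphism.  A complement embeds into \<open>N\<close>, so
  nothing is lost by looking for it on the type of \<open>N\<close>.
\<close>

definition direct_summand :: "'r ring \<Rightarrow> ('r, 'm) module \<Rightarrow> ('r, 'n) module \<Rightarrow> bool" where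
  "direct_summand R M N \<longleftrightarrow>
     (\<exists>K :: ('r, 'n) module. left_module R K \<and> lmod_iso R (lmod_dsum M K) N \<noteq> {})"

definition add_class :: "'r ring \<Rightarrow> ('r, 't) module \<Rightarrow> ('r, 'm) module \<Rightarrow> bool" where
  "add_class R T M \<longleftrightarrow>
     left_module R M \<and> (\<exists>n :: nat. direct_summand R M (lmod_copies {..<n} T))"

text \<open>
  Projective means direct summand of a free module.  A projective module is a summand of the free
  module on its own carrier, so index sets on the type of \<open>P\<close> suffice.
\<close>

definition projective_lmod :: "'r ring \<Rightarrow> ('r, 'p) module \<Rightarrow> bool" where
  "projective_lmod R P \<longleftrightarrow>
     left_module R P \<and> (\<exists>X :: 'p set. direct_summand R P (free_lmod X R))"

definition fin_gen_lmod :: "'r ring \<Rightarrow> ('r, 'm) module \<Rightarrow> bool" where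
  "fin_gen_lmod R M \<longleftrightarrow>
     (\<exists>S. finite S \<and> S \<subseteq> carrier M \<and>
        (\<forall>x \<in> carrier M. \<exists>c \<in> S \<rightarrow> carrier R. x = (\<Oplus>\<^bsub>M\<^esub>s\<in>S. c s \<odot>\<^bsub>M\<^esub> s)))"


section \<open>Resolutions and Ext\<close>

text \<open>Exactness of \<open>\<dots> \<rightarrow> P 1 \<rightarrow> P 0 \<rightarrow> M \<rightarrow> 0\<close> with maps \<open>d j : P (j + 1) \<rightarrow> P j\<close> and \<open>\<epsilon> : P 0 \<rightarrow> M\<close>.\<close>

definition resolution ::
  "'r ring \<Rightarrow> (nat \<Rightarrow> ('r, 'p) module) \<Rightarrow> (nat \<Rightarrow> 'p \<Rightarrow> 'p) \<Rightarrow> ('p \<Rightarrow> 'm) \<Rightarrow> ('r, 'm) module \<Rightarrow> bool"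
  where
  "resolution R P d \<epsilon> M \<longleftrightarrow>
     (\<forall>j. left_module R (P j)) \<and>
     \<epsilon> \<in> lmod_hom R (P 0) M \<and>
     (\<forall>j. d j \<in> lmod_hom R (P (Suc j)) (P j)) \<and>
     \<epsilon> ` carrier (P 0) = carrier M \<and>
     d 0 ` carrier (P 1) = a_kernel (P 0) M \<epsilon> \<and>
     (\<forall>j. d (Suc j) ` carrier (P (Suc (Suc j))) = a_kernel (P (Suc j)) (P j) (d j))"

text \<open>Exactness of \<open>0 \<rightarrow> M \<rightarrow> Q 0 \<rightarrow> Q 1 \<rightarrow> \<dots>\<close> with maps \<open>\<eta> : M \<rightarrow> Q 0\<close> and \<open>d j : Q j \<rightarrow> Q (j + 1)\<close>.\<close>

definition coresolution ::
  "'r ring \<Rightarrow> ('r, 'm) module \<Rightarrow> ('m \<Rightarrow> 'q) \<Rightarrow> (nat \<Rightarrow> ('r, 'q) module) \<Rightarrow> (nat \<Rightarrow> 'q \<Rightarrow> 'q) \<Rightarrow> bool"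
  where
  "coresolution R M \<eta> Q d \<longleftrightarrow>
     (\<forall>j. left_module R (Q j)) \<and>
     \<eta> \<in> lmod_hom R M (Q 0) \<and>
     (\<forall>j. d j \<in> lmod_hom R (Q j) (Q (Suc j))) \<and>
     inj_on \<eta> (carrier M) \<and>
     \<eta> ` carrier M = a_kernel (Q 0) (Q 1) (d 0) \<and>
     (\<forall>j. d j ` carrier (Q j) = a_kernel (Q (Suc j)) (Q (Suc (Suc j))) (d (Suc j)))"

definition projective_resolution ::
  "'r ring \<Rightarrow> (nat \<Rightarrow> ('r, 'p) module) \<Rightarrow> (nat \<Rightarrow> 'p \<Rightarrow> 'p) \<Rightarrow> ('p \<Rightarrow> 'm) \<Rightarrow> ('r, 'm) module \<Rightarrow> bool"
  where
  "projective_resolution R P d \<epsilon> M \<longleftrightarrow>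
     resolution R P d \<epsilon> M \<and> (\<forall>j. projective_lmod R (P j))"

text \<open>
  The abelian group \<open>Hom\<^sub>R(M, N)\<close>, written multiplicatively as is usual for monoid records.  Its
  elements are \<open>undefined\<close> outside the carrier of \<open>M\<close>, so that equality of homomorphisms is equality.
\<close>

definition Hom_group :: "'r ring \<Rightarrow> ('r, 'm) module \<Rightarrow> ('r, 'n) module \<Rightarrow> ('m \<Rightarrow> 'n) monoid" where
  "Hom_group R M N =
     \<lparr>carrier = lmod_hom R M N \<inter> extensional (carrier M),
      mult = (\<lambda>f g. \<lambda>x\<in>carrier M. f x \<oplus>\<^bsub>N\<^esub> g x),
      one = (\<lambda>x\<in>carrier M. \<zero>\<^bsub>N\<^esub>)\<rparr>"

definition cocycles ::
  "'r ring \<Rightarrow> (nat \<Rightarrow> ('r, 'p) module) \<Rightarrow> (nat \<Rightarrow> 'p \<Rightarrow> 'p) \<Rightarrow> ('r, 'n) module \<Rightarrow> nat \<Rightarrow> ('p \<Rightarrow> 'n) set"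
  where
  "cocycles R P d N i =
     {f \<in> carrier (Hom_group R (P i) N). \<forall>x \<in> carrier (P (Suc i)). f (d i x) = \<zero>\<^bsub>N\<^esub>}"

fun coboundaries ::
  "'r ring \<Rightarrow> (nat \<Rightarrow> ('r, 'p) module) \<Rightarrow> (nat \<Rightarrow> 'p \<Rightarrow> 'p) \<Rightarrow> ('r, 'n) module \<Rightarrow> nat \<Rightarrow> ('p \<Rightarrow> 'n) set"
  where
  "coboundaries R P d N 0 = {\<one>\<^bsub>Hom_group R (P 0) N\<^esub>}"
| "coboundaries R P d N (Suc i) =
     (\<lambda>f. \<lambda>x\<in>carrier (P (Suc i)). f (d i x)) ` carrier (Hom_group R (P i) N)"

definition Hom_cohomology ::
  "'r ring \<Rightarrow> (nat \<Rightarrow> ('r, 'p) module) \<Rightarrow> (nat \<Rightarrow> 'p \<Rightarrow> 'p) \<Rightarrow> ('r, 'n) module \<Rightarrow> nat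
     \<Rightarrow> ('p \<Rightarrow> 'n) set monoid"
  where
  "Hom_cohomology R P d N i =
     (Hom_group R (P i) N)\<lparr>carrier := cocycles R P d N i\<rparr> Mod coboundaries R P d N i"

text \<open>
  \<open>Ext\<close> is computed from a chosen projective resolution.  The type \<open>('r + 'm) list \<Rightarrow> 'r\<close> has room
  for one: the free module on the set \<open>V\<close> of lists over \<open>'r + 'm\<close> has at most as many
  elements as \<open>V\<close>, so each syzygy of \<open>M\<close> is again a quotient of it.  The theorem
  \<open>projective_resolution_exists\<close> shows that the choice is always possible.
\<close>

definition chosen_resolution ::
  "'r ring \<Rightarrow> ('r, 'm) module \<Rightarrow>
     (nat \<Rightarrow> ('r, ('r + 'm) list \<Rightarrow> 'r) module) \<times>
     (nat \<Rightarrow> (('r + 'm) list \<Rightarrow> 'r) \<Rightarrow> (('r + 'm) list \<Rightarrow> 'r))"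
  where
  "chosen_resolution R M = (SOME (P, d). \<exists>\<epsilon>. projective_resolution R P d \<epsilon> M)"

definition Ext ::
  "'r ring \<Rightarrow> nat \<Rightarrow> ('r, 'm) module \<Rightarrow> ('r, 'n) module \<Rightarrow>
     ((('r + 'm) list \<Rightarrow> 'r) \<Rightarrow> 'n) set monoid"
  where
  "Ext R i M N = (case chosen_resolution R M of (P, d) \<Rightarrow> Hom_cohomology R P d N i)"


section \<open>Existence of the chosen resolution\<close>

lemma left_module_regular: "ring R \<Longrightarrow> left_module R (regular_module R)"
proof -
  assume "ring R"
  then interpret ring R .
  have "abelian_group (regular_module R)"
  proof (rule abelian_groupI, goal_cases)
    case (6 x)
    then show ?case
      by (intro bexI[of _ "\<ominus>\<^bsub>R\<^esub> x"]) (auto simp: regular_module_def l_neg)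
  qed (auto simp: regular_module_def a_ac)
  then show ?thesis
    by (intro left_module.intro left_module_axioms.intro \<open>ring R\<close>)
      (auto simp: regular_module_def l_distr r_distr m_assoc)
qed

lemma (in left_module) smult_r_null: "a \<in> carrier R \<Longrightarrow> a \<odot>\<^bsub>M\<^esub> \<zero>\<^bsub>M\<^esub> = \<zero>\<^bsub>M\<^esub>"
  by (metis M.add.l_cancel_one' M.zero_closed M.l_zero smult_closed smult_r_distr)

lemma (in left_module) smult_l_null: "x \<in> carrier M \<Longrightarrow> \<zero>\<^bsub>R\<^esub> \<odot>\<^bsub>M\<^esub> x = \<zero>\<^bsub>M\<^esub>"
  by (metis M.add.l_cancel_one' R.zero_closed R.l_zero smult_closed smult_l_distr)

lemma left_module_copies:
  assumes "left_module R M" shows "left_module R (lmod_copies X M)"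
proof -
  interpret left_module R M by fact
  have fin: "finite {i. f i \<oplus>\<^bsub>M\<^esub> g i \<noteq> \<zero>\<^bsub>M\<^esub>}"
    if "finite {i. f i \<noteq> \<zero>\<^bsub>M\<^esub>}" "finite {i. g i \<noteq> \<zero>\<^bsub>M\<^esub>}" for f g :: "'c \<Rightarrow> 'b"
    by (rule finite_subset[OF _ finite_UnI[OF that]]) auto
  have fin': "finite {i. \<ominus>\<^bsub>M\<^esub> f i \<noteq> \<zero>\<^bsub>M\<^esub>}"
    if "finite {i. f i \<noteq> \<zero>\<^bsub>M\<^esub>}" for f :: "'c \<Rightarrow> 'b"
    by (rule finite_subset[OF _ that]) auto
  have fins: "finite {i. r \<odot>\<^bsub>M\<^esub> f i \<noteq> \<zero>\<^bsub>M\<^esub>}"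
    if "finite {i. f i \<noteq> \<zero>\<^bsub>M\<^esub>}" "r \<in> carrier R" for f :: "'c \<Rightarrow> 'b" and r
    by (rule finite_subset[OF _ that(1)]) (auto simp: smult_r_null that(2))
  have "abelian_group (lmod_copies X M)"
  proof (rule abelian_groupI, goal_cases)
    case (6 x)
    then show ?case
      by (intro bexI[of _ "\<lambda>i. \<ominus>\<^bsub>M\<^esub> x i"]) (auto simp: lmod_copies_def M.l_neg intro: fin')
  qed (auto simp: lmod_copies_def M.a_ac intro: fin)
  then show ?thesis
    by (intro left_module.intro left_module_axioms.intro R.ring_axioms)
      (auto simp: lmod_copies_def smult_l_distr smult_r_distr smult_assoc1 smult_r_null intro: fins)
qed

lemma lmod_hom_add:
  "\<lbrakk>f \<in> lmod_hom R M N; x \<in> carrier M; y \<in> carrier M\<rbrakk> \<Longrightarrow> f (x \<oplus>\<^bsub>M\<^esub> y) = f x \<oplus>\<^bsub>N\<^esub> f y"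
  by (auto simp: lmod_hom_def)

lemma lmod_hom_smult:
  "\<lbrakk>f \<in> lmod_hom R M N; r \<in> carrier R; x \<in> carrier M\<rbrakk> \<Longrightarrow> f (r \<odot>\<^bsub>M\<^esub> x) = r \<odot>\<^bsub>N\<^esub> f x"
  by (auto simp: lmod_hom_def)

lemma lmod_hom_closed: "\<lbrakk>f \<in> lmod_hom R M N; x \<in> carrier M\<rbrakk> \<Longrightarrow> f x \<in> carrier N"
  by (auto simp: lmod_hom_def)

lemma left_module_kernel:
  assumes "left_module R M" "left_module R N" "f \<in> lmod_hom R M N"
  shows "left_module R (M\<lparr>carrier := a_kernel M N f\<rparr>)"
proof -
  interpret M: left_module R M by fact
  interpret N: left_module R N by fact
  note [simp] = lmod_hom_add[OF assms(3)] lmod_hom_smult[OF assms(3)]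
  have K: "a_kernel M N f = {x \<in> carrier M. f x = \<zero>\<^bsub>N\<^esub>}"
    by (auto simp: a_kernel_def kernel_def)
  have f0: "f \<zero>\<^bsub>M\<^esub> = \<zero>\<^bsub>N\<^esub>"
    by (metis M.M.zero_closed M.M.l_zero N.M.add.l_cancel_one' lmod_hom_add[OF assms(3)] lmod_hom_closed[OF assms(3)])
  have inv: "f (\<ominus>\<^bsub>M\<^esub> x) = \<zero>\<^bsub>N\<^esub>" if "x \<in> carrier M" "f x = \<zero>\<^bsub>N\<^esub>" for x
    using lmod_hom_add[OF assms(3), of "\<ominus>\<^bsub>M\<^esub> x" x] that f0 lmod_hom_closed[OF assms(3)]
    by (simp add: M.M.l_neg)
  have "abelian_group (M\<lparr>carrier := a_kernel M N f\<rparr>)"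
  proof (rule abelian_groupI, goal_cases)
    case (6 x)
    then show ?case
      by (intro bexI[of _ "\<ominus>\<^bsub>M\<^esub> x"]) (auto simp: K M.M.l_neg inv)
  qed (auto simp: K M.M.a_ac f0)
  then show ?thesis
    by (intro left_module.intro left_module_axioms.intro M.R.ring_axioms)
      (auto simp: K M.smult_l_distr M.smult_r_distr M.smult_assoc1 N.smult_r_null)
qed

lemma free_lmod_onto:
  fixes g :: "'x \<Rightarrow> 'n"
  assumes N: "left_module R N" and g: "range g = carrier N"
  shows "\<exists>e \<in> lmod_hom R (free_lmod (UNIV :: 'x set) R) N.
    e ` carrier (free_lmod UNIV R) = carrier N"
proof -
  interpret N: left_module R N by fact
  let ?F = "free_lmod (UNIV :: 'x set) R"
  define e where "e f = (\<Oplus>\<^bsub>N\<^esub>v\<in>{v. f v \<noteq> \<zero>\<^bsub>R\<^esub>}. f v \<odot>\<^bsub>N\<^esub> g v)" for f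
  have gc [simp]: "g v \<in> carrier N" for v
    using g by auto
  have F: "f v \<in> carrier R" "finite {v. f v \<noteq> \<zero>\<^bsub>R\<^esub>}" if "f \<in> carrier ?F" for f v
    using that by (auto simp: lmod_copies_def regular_module_def)
  have e: "e f = (\<Oplus>\<^bsub>N\<^esub>v\<in>B. f v \<odot>\<^bsub>N\<^esub> g v)"
    if "finite B" "{v. f v \<noteq> \<zero>\<^bsub>R\<^esub>} \<subseteq> B" "\<And>v. f v \<in> carrier R" for f B
    unfolding e_def using that
    by (intro N.M.add.finprod_mono_neutral_cong_left) (auto simp: N.smult_l_null)
  have hom: "e \<in> lmod_hom R ?F N"
    unfolding lmod_hom_def
  proof (intro CollectI conjI ballI Pi_I)
    fix f assume "f \<in> carrier ?F"
    then show "e f \<in> carrier N"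
      unfolding e_def by (intro N.M.finsum_closed) (auto simp: F)
  next
    fix f h assume fh: "f \<in> carrier ?F" "h \<in> carrier ?F"
    define B where "B = {v. f v \<noteq> \<zero>\<^bsub>R\<^esub>} \<union> {v. h v \<noteq> \<zero>\<^bsub>R\<^esub>}"
    have B: "finite B" using F(2) fh by (auto simp: B_def)
    have "f \<oplus>\<^bsub>?F\<^esub> h = (\<lambda>v. f v \<oplus>\<^bsub>R\<^esub> h v)"
      by (simp add: lmod_copies_def regular_module_def)
    then have "e (f \<oplus>\<^bsub>?F\<^esub> h) = (\<Oplus>\<^bsub>N\<^esub>v\<in>B. (f v \<oplus>\<^bsub>R\<^esub> h v) \<odot>\<^bsub>N\<^esub> g v)"
      by (simp, intro e[OF B]) (auto simp: B_def F fh)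
    also have "\<dots> = (\<Oplus>\<^bsub>N\<^esub>v\<in>B. f v \<odot>\<^bsub>N\<^esub> g v \<oplus>\<^bsub>N\<^esub> h v \<odot>\<^bsub>N\<^esub> g v)"
      by (intro N.M.finsum_cong') (auto simp: N.smult_l_distr F fh)
    also have "\<dots> = (\<Oplus>\<^bsub>N\<^esub>v\<in>B. f v \<odot>\<^bsub>N\<^esub> g v) \<oplus>\<^bsub>N\<^esub> (\<Oplus>\<^bsub>N\<^esub>v\<in>B. h v \<odot>\<^bsub>N\<^esub> g v)"
      by (intro N.M.finsum_addf) (auto simp: F fh)
    also have "\<dots> = e f \<oplus>\<^bsub>N\<^esub> e h"
      using e[OF B, of f] e[OF B, of h] F fh by (auto simp: B_def)
    finally show "e (f \<oplus>\<^bsub>?F\<^esub> h) = e f \<oplus>\<^bsub>N\<^esub> e h" .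
  next
    fix r f assume rf: "r \<in> carrier R" "f \<in> carrier ?F"
    define B where "B = {v. f v \<noteq> \<zero>\<^bsub>R\<^esub>}"
    have B: "finite B" using F(2) rf by (auto simp: B_def)
    have fin: "r \<odot>\<^bsub>N\<^esub> (\<Oplus>\<^bsub>N\<^esub>v\<in>C. k v) = (\<Oplus>\<^bsub>N\<^esub>v\<in>C. r \<odot>\<^bsub>N\<^esub> k v)"
      if "finite C" "k \<in> C \<rightarrow> carrier N" for C and k :: "'x \<Rightarrow> 'n"
      using that
      by (induction C) (auto simp: N.smult_r_null N.smult_r_distr rf Pi_def)
    have "r \<odot>\<^bsub>?F\<^esub> f = (\<lambda>v. r \<otimes>\<^bsub>R\<^esub> f v)"
      by (simp add: lmod_copies_def regular_module_def)
    then have "e (r \<odot>\<^bsub>?F\<^esub> f) = (\<Oplus>\<^bsub>N\<^esub>v\<in>B. (r \<otimes>\<^bsub>R\<^esub> f v) \<odot>\<^bsub>N\<^esub> g v)"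
      by (simp, intro e[OF B]) (auto simp: B_def F rf)
    also have "\<dots> = (\<Oplus>\<^bsub>N\<^esub>v\<in>B. r \<odot>\<^bsub>N\<^esub> (f v \<odot>\<^bsub>N\<^esub> g v))"
      by (intro N.M.finsum_cong') (auto simp: N.smult_assoc1 F rf)
    also have "\<dots> = r \<odot>\<^bsub>N\<^esub> e f"
      unfolding e_def B_def[symmetric] by (rule fin[symmetric, OF B]) (auto simp: F rf)
    finally show "e (r \<odot>\<^bsub>?F\<^esub> f) = r \<odot>\<^bsub>N\<^esub> e f" .
  qed
  have "g v \<in> e ` carrier ?F" for v
  proof
    let ?\<delta> = "\<lambda>w. if w = v then \<one>\<^bsub>R\<^esub> else \<zero>\<^bsub>R\<^esub>"
    show "?\<delta> \<in> carrier ?F"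
      by (auto simp: lmod_copies_def regular_module_def)
    have "e ?\<delta> = (\<Oplus>\<^bsub>N\<^esub>w\<in>{v}. ?\<delta> w \<odot>\<^bsub>N\<^esub> g w)"
      by (intro e) auto
    then show "g v = e ?\<delta>"
      by simp
  qed
  then have "e ` carrier ?F = carrier N"
    using g lmod_hom_closed[OF hom] by (auto simp: set_eq_iff image_iff) (metis UNIV_I image_iff)
  then show ?thesis
    by (rule bexI[of _ e, OF _ hom])
qed

text \<open>
  Every subset of the free module on the lists over \<open>'r + 'm\<close> is an image of its index set:
  a finitely supported function is coded by the list of its arguments and values.
\<close>

fun code_support :: "(('r + 'm) list \<times> 'r) list \<Rightarrow> ('r + 'm) list" where
  "code_support [] = []"
| "code_support ((v, r) # xs) =
     concat (map (\<lambda>x. [Inl undefined, x]) v) @ [Inr undefined, Inl r] @ code_support xs"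

lemma code_support_inj: "code_support xs = code_support ys \<Longrightarrow> xs = ys"
proof (induction xs arbitrary: ys rule: code_support.induct)
  case 1
  then show ?case by (cases ys rule: code_support.cases) auto
next
  case (2 v r xs)
  have sep: "v = w \<and> zs = zs'"
    if "concat (map (\<lambda>x. [Inl undefined, x]) v) @ Inr undefined # zs =
        concat (map (\<lambda>x. [Inl undefined, x]) w) @ Inr undefined # zs'"
    for v w zs zs' :: "('r + 'm) list"
    using that
  proof (induction v arbitrary: w)
    case Nil
    then show ?case by (cases w) auto
  next
    case (Cons x v)
    then show ?case by (cases w) auto
  qed
  from 2(2) obtain w s zs where ys: "ys = (w, s) # zs"
    by (cases ys rule: code_support.cases) auto
  have "v = w \<and> Inl r # code_support xs = Inl s # code_support zs"
    by (rule sep) (use 2(2) ys in simp)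
  then show ?case
    using 2(1)[of zs] ys by auto
qed

lemma free_lmod_subset_image:
  fixes K :: "(('r + 'm) list \<Rightarrow> 'r) set"
  assumes "K \<subseteq> carrier (free_lmod UNIV R)" "K \<noteq> {}"
  shows "\<exists>g :: ('r + 'm) list \<Rightarrow> _. range g = K"
proof -
  let ?S = "\<lambda>f. {v. f v \<noteq> \<zero>\<^bsub>R\<^esub>}"
  let ?c = "\<lambda>f :: ('r + 'm) list \<Rightarrow> 'r. code_support (map (\<lambda>v. (v, f v)) (SOME l. set l = ?S f))"
  have S: "set (SOME l. set l = ?S f) = ?S f" if "f \<in> K" for f
  proof (rule someI_ex, rule finite_list)
    show "finite (?S f)"
      using that assms(1) by (auto simp: lmod_copies_def regular_module_def)
  qed
  have inj: "inj_on ?c K"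
  proof (rule inj_onI)
    fix f h assume fh: "f \<in> K" "h \<in> K" and "?c f = ?c h"
    then have "(\<lambda>v. (v, f v)) ` ?S f = (\<lambda>v. (v, h v)) ` ?S h"
      by (metis (no_types, lifting) S[OF fh(1)] S[OF fh(2)] code_support_inj set_map)
    then have *: "(v, y) \<in> (\<lambda>v. (v, f v)) ` ?S f \<longleftrightarrow> (v, y) \<in> (\<lambda>v. (v, h v)) ` ?S h" for v y
      by simp
    show "f = h"
    proof
      fix v show "f v = h v"
        using *[of v "f v"] *[of v "h v"] by (cases "f v = \<zero>\<^bsub>R\<^esub>"; cases "h v = \<zero>\<^bsub>R\<^esub>") auto
    qed
  qed
  obtain k where k: "k \<in> K" using assms(2) by blast
  let ?g = "\<lambda>v. if v \<in> ?c ` K then inv_into K ?c v else k"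
  have "range ?g = K"
  proof (intro equalityI subsetI)
    fix f assume "f \<in> range ?g"
    then obtain v where "f = ?g v" by (elim rangeE)
    then show "f \<in> K"
      using inv_into_into[of v ?c K] k by (cases "v \<in> ?c ` K") simp_all
  next
    fix f assume "f \<in> K"
    then have "?c f \<in> ?c ` K" "f = inv_into K ?c (?c f)"
      using inv_into_f_f[OF inj, of f] by (blast, simp)
    then have "f = ?g (?c f)"
      by (simp only: if_True)
    then show "f \<in> range ?g" by (rule range_eqI)
  qed
  then show ?thesis by (rule exI[of _ ?g])
qed

lemma projective_free_lmod:
  assumes "ring R"
  shows "projective_lmod R (free_lmod (UNIV :: 'v set) R)"
proof -
  interpret ring R by fact
  let ?F = "free_lmod (UNIV :: 'v set) R"
  have F: "left_module R ?F"
    by (intro left_module_copies left_module_regular assms)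
  define \<delta> where "\<delta> v w = (if w = v then \<one>\<^bsub>R\<^esub> else \<zero>\<^bsub>R\<^esub>)" for v w :: 'v
  define X where "X = (if \<one>\<^bsub>R\<^esub> = \<zero>\<^bsub>R\<^esub> then {} else range \<delta>)"
  let ?G = "free_lmod X R"
  define K :: "('a, ('v \<Rightarrow> 'a) \<Rightarrow> 'a) module" where
    "K = lmod_copies {} (regular_module R)"
  have K: "left_module R K" "carrier K = {\<lambda>_. \<zero>\<^bsub>R\<^esub>}"
    unfolding K_def
    by (intro left_module_copies left_module_regular assms)
      (auto simp: lmod_copies_def regular_module_def)
  define \<phi> where
    "\<phi> = (\<lambda>(f :: 'v \<Rightarrow> 'a, k :: ('v \<Rightarrow> 'a) \<Rightarrow> 'a) x. if x \<in> X then f (inv_into UNIV \<delta> x) else \<zero>\<^bsub>R\<^esub>)"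
  have inj: "inj \<delta>" if "\<one>\<^bsub>R\<^esub> \<noteq> \<zero>\<^bsub>R\<^esub>"
    using that by (intro injI) (metis \<delta>_def)
  have triv: "carrier R = {\<zero>\<^bsub>R\<^esub>}" if "\<one>\<^bsub>R\<^esub> = \<zero>\<^bsub>R\<^esub>"
    using that one_zeroD by blast
  have fin: "finite {x. \<phi> (f, k) x \<noteq> \<zero>\<^bsub>R\<^esub>}" if "finite {v. f v \<noteq> \<zero>\<^bsub>R\<^esub>}" for f k
    by (rule finite_subset[OF _ finite_imageI[OF that, of \<delta>]])
      (auto simp: \<phi>_def X_def f_inv_into_f image_iff split: if_splits dest!: inj)
  have "\<phi> \<in> lmod_hom R (lmod_dsum ?F K) ?G"
    using fin
    by (auto simp: lmod_hom_def lmod_dsum_def lmod_copies_def regular_module_def K_def \<phi>_def fun_eq_iff)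
  moreover have "bij_betw \<phi> (carrier (lmod_dsum ?F K)) (carrier ?G)"
  proof (cases "\<one>\<^bsub>R\<^esub> = \<zero>\<^bsub>R\<^esub>")
    case True
    have "carrier ?F = {\<lambda>_. \<zero>\<^bsub>R\<^esub>}" "carrier ?G = {\<lambda>_. \<zero>\<^bsub>R\<^esub>}"
      by (auto simp: lmod_copies_def regular_module_def triv[OF True])
    then show ?thesis
      using True K(2) by (auto simp: lmod_dsum_def \<phi>_def X_def bij_betw_def)
  next
    case False
    note i = inj[OF False]
    have "bij_betw (\<lambda>f x. if x \<in> X then f (inv_into UNIV \<delta> x) else \<zero>\<^bsub>R\<^esub>) (carrier ?F) (carrier ?G)"
    proof (rule bij_betwI[where g = "\<lambda>h v. h (\<delta> v)"])
      show "(\<lambda>f x. if x \<in> X then f (inv_into UNIV \<delta> x) else \<zero>\<^bsub>R\<^esub>) \<in> carrier ?F \<rightarrow> carrier ?G"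
        using fin by (auto simp: lmod_copies_def regular_module_def \<phi>_def)
      have "finite {v. h (\<delta> v) \<noteq> \<zero>\<^bsub>R\<^esub>}" if "finite {x. h x \<noteq> \<zero>\<^bsub>R\<^esub>}" for h
        using finite_vimageI[OF that i] by (simp add: vimage_def)
      then show "(\<lambda>h v. h (\<delta> v)) \<in> carrier ?G \<rightarrow> carrier ?F"
        by (auto simp: lmod_copies_def regular_module_def)
    qed (use False i in \<open>auto simp: X_def lmod_copies_def regular_module_def fun_eq_iff\<close>)
    moreover have "bij_betw fst (carrier (lmod_dsum ?F K)) (carrier ?F)"
      unfolding lmod_dsum_def K(2) by (auto simp: bij_betw_def inj_on_def)
    ultimately have
      "bij_betw ((\<lambda>f x. if x \<in> X then f (inv_into UNIV \<delta> x) else \<zero>\<^bsub>R\<^esub>) \<circ> fst)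
         (carrier (lmod_dsum ?F K)) (carrier ?G)"
      by (rule bij_betw_trans[rotated])
    moreover have "(\<lambda>f x. if x \<in> X then f (inv_into UNIV \<delta> x) else \<zero>\<^bsub>R\<^esub>) \<circ> fst = \<phi>"
      by (simp add: \<phi>_def fun_eq_iff split_beta)
    ultimately show ?thesis
      by (simp only:)
  qed
  ultimately have "direct_summand R ?F ?G"
    unfolding direct_summand_def lmod_iso_def using K(1) by blast
  then show ?thesis
    unfolding projective_lmod_def using F by blast
qed

theorem projective_resolution_exists:
  fixes M :: "('r, 'm) module"
  assumes M: "left_module R M"
  shows "\<exists>(P :: nat \<Rightarrow> ('r, ('r + 'm) list \<Rightarrow> 'r) module) d \<epsilon>. projective_resolution R P d \<epsilon> M"
proof -
  interpret M: left_module R M by fact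
  let ?F = "free_lmod (UNIV :: ('r + 'm) list set) R"
  have F: "left_module R ?F"
    by (intro left_module_copies left_module_regular M.R.ring_axioms)
  let ?g = "\<lambda>v. case v of [Inr m] \<Rightarrow> if m \<in> carrier M then m else \<zero>\<^bsub>M\<^esub> | _ \<Rightarrow> \<zero>\<^bsub>M\<^esub>"
  have "range ?g = carrier M"
  proof (intro equalityI subsetI)
    fix m assume "m \<in> carrier M"
    then have "m = ?g [Inr m]" by simp
    then show "m \<in> range ?g" by blast
  qed (auto split: list.splits sum.splits)
  from free_lmod_onto[OF M this] obtain \<epsilon>
    where \<epsilon>: "\<epsilon> \<in> lmod_hom R ?F M" "\<epsilon> ` carrier ?F = carrier M" by blast
  have step: "\<exists>d \<in> lmod_hom R ?F ?F. d ` carrier ?F = a_kernel ?F N e"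
    if N: "left_module R N" and e: "e \<in> lmod_hom R ?F N" for N :: "('r, 'n) module" and e
  proof -
    have K: "left_module R (?F\<lparr>carrier := a_kernel ?F N e\<rparr>)"
      by (rule left_module_kernel[OF F N e])
    then interpret K: left_module R "?F\<lparr>carrier := a_kernel ?F N e\<rparr>" .
    have sub: "a_kernel ?F N e \<subseteq> carrier ?F"
      by (auto simp: a_kernel_def kernel_def)
    obtain g :: "('r + 'm) list \<Rightarrow> _" where "range g = a_kernel ?F N e"
      using free_lmod_subset_image[OF sub] K.M.zero_closed by auto
    then obtain d where "d \<in> lmod_hom R ?F (?F\<lparr>carrier := a_kernel ?F N e\<rparr>)"
      "d ` carrier ?F = a_kernel ?F N e"
      using free_lmod_onto[OF K, of g] by auto
    then show ?thesis
      using sub by (intro bexI[of _ d]) (auto simp: lmod_hom_def)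
  qed
  obtain d0 where d0: "d0 \<in> lmod_hom R ?F ?F" "d0 ` carrier ?F = a_kernel ?F M \<epsilon>"
    using step[OF M \<epsilon>(1)] by blast
  obtain nx where nxt:
    "\<And>e. e \<in> lmod_hom R ?F ?F \<Longrightarrow> nx e \<in> lmod_hom R ?F ?F \<and> nx e ` carrier ?F = a_kernel ?F ?F e"
    using step[OF F] by metis
  define d where "d j = (nx ^^ j) d0" for j
  have d: "d j \<in> lmod_hom R ?F ?F" for j
    by (induction j) (auto simp: d_def d0 nxt)
  have "projective_resolution R (\<lambda>_. ?F) d \<epsilon> M"
    unfolding projective_resolution_def resolution_def
    using F \<epsilon> d d0 nxt[OF d] projective_free_lmod[OF M.R.ring_axioms]
    by (auto simp: d_def)
  then show ?thesis by blast
qed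

corollary chosen_resolution:
  fixes M :: "('r, 'm) module"
  assumes "left_module R M" "chosen_resolution R M = (P, d)"
  shows "\<exists>\<epsilon>. projective_resolution R P d \<epsilon> M"
proof -
  obtain P' :: "nat \<Rightarrow> ('r, ('r + 'm) list \<Rightarrow> 'r) module" and d'
    where "\<exists>\<epsilon>. projective_resolution R P' d' \<epsilon> M"
    using projective_resolution_exists[OF assms(1)] by blast
  then have "case (P', d') of (P, d) \<Rightarrow> \<exists>\<epsilon>. projective_resolution R P d \<epsilon> M"
    by simp
  then have "case chosen_resolution R M of (P, d) \<Rightarrow> \<exists>\<epsilon>. projective_resolution R P d \<epsilon> M"
    unfolding chosen_resolution_def by (rule someI)
  then show ?thesis
    using assms(2) by simp
qed


section \<open>Tilting modules\<close>

text \<open>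
  A finite exact sequence \<open>0 \<rightarrow> P m \<rightarrow> \<dots> \<rightarrow> P 0 \<rightarrow> T \<rightarrow> 0\<close> is represented by its extension by zero
  modules beyond \<open>P m\<close>, and dually for \<open>0 \<rightarrow> R \<rightarrow> Q 0 \<rightarrow> \<dots> \<rightarrow> Q n \<rightarrow> 0\<close>.  Up to
  isomorphism, a finitely generated projective module is a submodule of some \<open>R^k\<close> and a
  module in \<open>add(T)\<close> is a submodule of some \<open>T^k\<close>, so the types \<open>nat \<Rightarrow> 'r\<close> and \<open>nat \<Rightarrow> 't\<close>
  suffice for the terms of these sequences.
\<close>

definition tilting :: "'r ring \<Rightarrow> ('r, 't) module \<Rightarrow> bool" where
  "tilting R T \<longleftrightarrow>
     left_module R T \<and>
     (\<exists>(m :: nat) (P :: nat \<Rightarrow> ('r, nat \<Rightarrow> 'r) module) d \<epsilon>.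
        resolution R P d \<epsilon> T \<and>
        (\<forall>j \<le> m. fin_gen_lmod R (P j) \<and> projective_lmod R (P j)) \<and>
        (\<forall>j > m. carrier (P j) = {\<zero>\<^bsub>P j\<^esub>})) \<and>
     (\<forall>i > 0. trivial_group (Ext R i T T)) \<and>
     (\<exists>(n :: nat) (Q :: nat \<Rightarrow> ('r, nat \<Rightarrow> 't) module) d \<eta>.
        coresolution R (regular_module R) \<eta> Q d \<and>
        (\<forall>j \<le> n. add_class R T (Q j)) \<and>
        (\<forall>j > n. carrier (Q j) = {\<zero>\<^bsub>Q j\<^esub>}))"


section \<open>Frobenius extensions\<close>

text \<open>
  The last three conditions say that \<open>\<Phi>\<close> is an isomorphism of \<open>A\<close>-\<open>R\<close>-bimodules from \<open>A\<close> to
  \<open>Hom\<^sub>R(A, R)\<close>, the latter with \<open>(a f)(x) = f (x a)\<close> and \<open>(f r)(x) = f x r\<close>.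
\<close>

definition frobenius_extension :: "'r ring \<Rightarrow> 'a ring \<Rightarrow> ('r \<Rightarrow> 'a) \<Rightarrow> bool" where
  "frobenius_extension R A \<iota> \<longleftrightarrow>
     ring R \<and> ring A \<and> \<iota> \<in> ring_hom R A \<and>
     fin_gen_lmod R (restrict_scalars \<iota> (regular_module A)) \<and>
     projective_lmod R (restrict_scalars \<iota> (regular_module A)) \<and>
     (\<exists>\<Phi>. \<Phi> \<in> iso (add_monoid A)
                    (Hom_group R (restrict_scalars \<iota> (regular_module A)) (regular_module R)) \<and>
          (\<forall>a \<in> carrier A. \<forall>b \<in> carrier A.
             \<Phi> (a \<otimes>\<^bsub>A\<^esub> b) = (\<lambda>x\<in>carrier A. \<Phi> b (x \<otimes>\<^bsub>A\<^esub> a))) \<and>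
          (\<forall>b \<in> carrier A. \<forall>r \<in> carrier R.
             \<Phi> (b \<otimes>\<^bsub>A\<^esub> \<iota> r) = (\<lambda>x\<in>carrier A. \<Phi> b x \<otimes>\<^bsub>R\<^esub> r)))"


section \<open>Induced modules\<close>

definition tensor_relators ::
  "'r ring \<Rightarrow> 'a ring \<Rightarrow> ('r \<Rightarrow> 'a) \<Rightarrow> ('r, 't) module \<Rightarrow> (('a \<times> 't) \<Rightarrow>\<^sub>0 int) set" where
  "tensor_relators R A \<iota> T =
     {frag_of (a \<oplus>\<^bsub>A\<^esub> b, t) - frag_of (a, t) - frag_of (b, t) | a b t.
        a \<in> carrier A \<and> b \<in> carrier A \<and> t \<in> carrier T} \<union>
     {frag_of (a, t \<oplus>\<^bsub>T\<^esub> u) - frag_of (a, t) - frag_of (a, u) | a t u.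
        a \<in> carrier A \<and> t \<in> carrier T \<and> u \<in> carrier T} \<union>
     {frag_of (a \<otimes>\<^bsub>A\<^esub> \<iota> r, t) - frag_of (a, r \<odot>\<^bsub>T\<^esub> t) | a r t.
        a \<in> carrier A \<and> r \<in> carrier R \<and> t \<in> carrier T}"

text \<open>
  \<open>A \<otimes>\<^sub>R T\<close> is the quotient of the free abelian group on \<open>A \<times> T\<close> by the subgroup \<open>K\<close> generated by
  the relators.  The product of \<open>a\<close> with a coset \<open>C\<close> is the coset of \<open>K\<close> that contains the image of
  \<open>C\<close> under \<open>(b, t) \<mapsto> (a b, t)\<close>.
\<close>

definition induced_module ::
  "'r ring \<Rightarrow> 'a ring \<Rightarrow> ('r \<Rightarrow> 'a) \<Rightarrow> ('r, 't) module \<Rightarrow> ('a, (('a \<times> 't) \<Rightarrow>\<^sub>0 int) set) module"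
  where
  "induced_module R A \<iota> T =
     (let F = free_Abelian_group (carrier A \<times> carrier T);
          K = generate F (tensor_relators R A \<iota> T)
      in \<lparr>carrier = carrier (F Mod K), mult = undefined, one = undefined,
          zero = \<one>\<^bsub>F Mod K\<^esub>, add = monoid.mult (F Mod K),
          smult = (\<lambda>a C. K <#>\<^bsub>F\<^esub> frag_extend (\<lambda>(b, t). frag_of (a \<otimes>\<^bsub>A\<^esub> b, t)) ` C)\<rparr>)"

end

theory Submission
  imports Defs
begin

text \<open>
  Induction \<open>A \<otimes>\<^sub>R _\<close> is exact: the Frobenius isomorphism turns a dual basis of the left module \<open>A\<close> into
  one of the right module \<open>A\<close>, so that \<open>A \<otimes>\<^sub>R M\<close> is naturally a retract of a finite power of the
  abelian group \<open>M\<close>.  It also preserves finitely generated projectives and sends \<open>add(T)\<close> to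
  \<open>add(U)\<close>, hence \<open>U\<close> always satisfies the conditions (1) and (3) of a tilting module.  Only (2) is at
  stake: for a projective resolution \<open>P\<close> of \<open>T\<close>, \<open>A \<otimes>\<^sub>R P\<close> is one of \<open>U\<close>, and the adjunction
  \<open>Hom\<^sub>A(A \<otimes>\<^sub>R P, U) = Hom\<^sub>R(P, U)\<close> identifies \<open>Ext\<^sub>A(U, U)\<close> with \<open>Ext\<^sub>R(T, U)\<close>.
\<close>

section \<open>Homomorphisms and retracts\<close>

text \<open>The Frobenius hypothesis describes A as a left R-module, while exactness of A \<otimes>
  _ depends on A as a right R-module; the isomorphism with Hom(A, R) carries finite generation and
  projectivity from one side to the other. The shape of the proof is dictated by types.
  \<open>tilting\<close> prescribes the types of the terms of its sequences, and \<open>Ext\<close>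
  is computed from one chosen resolution on a fixed type, whereas induction turns a module on
  \<open>'m\<close> into one on sets of formal sums over \<open>'a \<times> 'm\<close>. Hence three
  devices recur: summands are handled as retracts, which can relate modules on different types;
  vanishing of Ext is restated as \<open>hom_exact\<close>, whose independence of the resolution is
  proved across types; induced sequences are conjugated onto the prescribed types. Only the
  vanishing of the two Ext groups is compared; no isomorphism between them is built.\<close>

lemma lmod_homI:
  assumes "\<And>x. x \<in> carrier M \<Longrightarrow> f x \<in> carrier N"
    and "\<And>x y. \<lbrakk>x \<in> carrier M; y \<in> carrier M\<rbrakk> \<Longrightarrow> f (x \<oplus>\<^bsub>M\<^esub> y) = f x \<oplus>\<^bsub>N\<^esub> f y"
    and "\<And>r x. \<lbrakk>r \<in> carrier R; x \<in> carrier M\<rbrakk> \<Longrightarrow> f (r \<odot>\<^bsub>M\<^esub> x) = r \<odot>\<^bsub>N\<^esub> f x"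
  shows "f \<in> lmod_hom R M N"
  using assms by (auto simp: lmod_hom_def)

text \<open>Many maps below are handled only as additive ones: x \<mapsto> a \<otimes> x,
  multiplication by a scalar before the module axioms are known, and the coordinate maps from an
  induced A-module back to an R-module. Ring schemes cover rings and modules alike, so that A itself
  may be a source.\<close>

definition add_hom :: "('x, 'k) ring_scheme \<Rightarrow> ('y, 'l) ring_scheme \<Rightarrow> ('x \<Rightarrow> 'y) set" where
  "add_hom M N = hom (add_monoid M) (add_monoid N)"

lemma add_homI:
  assumes "\<And>x. x \<in> carrier M \<Longrightarrow> f x \<in> carrier N"
    and "\<And>x y. \<lbrakk>x \<in> carrier M; y \<in> carrier M\<rbrakk> \<Longrightarrow> f (x \<oplus>\<^bsub>M\<^esub> y) = f x \<oplus>\<^bsub>N\<^esub> f y"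
  shows "f \<in> add_hom M N"
  using assms by (auto simp: add_hom_def hom_def)

lemma add_hom_closed: "\<lbrakk>f \<in> add_hom M N; x \<in> carrier M\<rbrakk> \<Longrightarrow> f x \<in> carrier N"
  by (auto simp: add_hom_def hom_def)

lemma add_hom_add:
  "\<lbrakk>f \<in> add_hom M N; x \<in> carrier M; y \<in> carrier M\<rbrakk> \<Longrightarrow> f (x \<oplus>\<^bsub>M\<^esub> y) = f x \<oplus>\<^bsub>N\<^esub> f y"
  by (auto simp: add_hom_def hom_def)

lemma add_hom_compose: "\<lbrakk>f \<in> add_hom M N; g \<in> add_hom N L\<rbrakk> \<Longrightarrow> (\<lambda>x. g (f x)) \<in> add_hom M L"
  by (auto simp: add_hom_def hom_def Pi_def)

lemma add_hom_of_lmod_hom: "f \<in> lmod_hom R M N \<Longrightarrow> f \<in> add_hom M N"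
  by (auto simp: add_hom_def hom_def lmod_hom_def)

lemma add_hom_zero:
  assumes "abelian_group M" "abelian_group N" "f \<in> add_hom M N"
  shows "f \<zero>\<^bsub>M\<^esub> = \<zero>\<^bsub>N\<^esub>"
proof -
  interpret M: abelian_group M by fact
  interpret N: abelian_group N by fact
  show ?thesis
    by (metis M.zero_closed M.l_zero N.add.l_cancel_one' add_hom_add[OF assms(3)] add_hom_closed[OF assms(3)])
qed

lemma add_hom_minus:
  assumes "abelian_group M" "abelian_group N" "f \<in> add_hom M N" "x \<in> carrier M" "y \<in> carrier M"
  shows "f (x \<ominus>\<^bsub>M\<^esub> y) = f x \<ominus>\<^bsub>N\<^esub> f y"
proof -
  interpret M: abelian_group M by fact
  interpret N: abelian_group N by fact
  have "f (x \<ominus>\<^bsub>M\<^esub> y) \<oplus>\<^bsub>N\<^esub> f y = f x"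
    using assms(4,5) by (simp add: add_hom_add[OF assms(3), symmetric] M.minus_eq M.a_assoc M.l_neg)
  then show ?thesis
    using assms(4,5) by (metis M.minus_closed N.add.inv_closed N.a_assoc N.minus_eq N.r_neg N.r_zero add_hom_closed[OF assms(3)])
qed

lemma add_hom_finsum:
  assumes "abelian_group M" "abelian_group N" "f \<in> add_hom M N" "g \<in> S \<rightarrow> carrier M"
  shows "f (\<Oplus>\<^bsub>M\<^esub>i\<in>S. g i) = (\<Oplus>\<^bsub>N\<^esub>i\<in>S. f (g i))"
proof -
  interpret M: abelian_group M by fact
  interpret N: abelian_group N by fact
  show ?thesis using assms(4)
  proof (induction S rule: infinite_finite_induct)
    case (insert i S)
    then show ?case
      by (subst M.finsum_insert N.finsum_insert;
          auto simp: add_hom_add[OF assms(3)] add_hom_closed[OF assms(3)] Pi_def)+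
  qed (simp_all add: add_hom_zero[OF assms(1-3)] M.finsum_infinite N.finsum_infinite)
qed

context
  fixes R :: "'r ring" and M :: "('r, 'm) module" and N :: "('r, 'n) module" and f
  assumes M: "left_module R M" and N: "left_module R N" and f: "f \<in> lmod_hom R M N"
begin

lemmas lmod_hom_zero = add_hom_zero[OF left_module.axioms(2)[OF M] left_module.axioms(2)[OF N] add_hom_of_lmod_hom[OF f]]
lemmas lmod_hom_minus = add_hom_minus[OF left_module.axioms(2)[OF M] left_module.axioms(2)[OF N] add_hom_of_lmod_hom[OF f]]
lemmas lmod_hom_finsum = add_hom_finsum[OF left_module.axioms(2)[OF M] left_module.axioms(2)[OF N] add_hom_of_lmod_hom[OF f]]

end

lemma lmod_hom_compose:
  "\<lbrakk>f \<in> lmod_hom R M N; g \<in> lmod_hom R N L\<rbrakk> \<Longrightarrow> (\<lambda>x. g (f x)) \<in> lmod_hom R M L"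
  by (auto simp: lmod_hom_def Pi_def)

lemma (in left_module) smult_minus:
  "\<lbrakk>a \<in> carrier R; x \<in> carrier M\<rbrakk> \<Longrightarrow> a \<odot>\<^bsub>M\<^esub> (\<ominus>\<^bsub>M\<^esub> x) = \<ominus>\<^bsub>M\<^esub> (a \<odot>\<^bsub>M\<^esub> x)"
  by (metis M.add.inv_closed M.r_neg M.minus_equality M.a_comm smult_closed smult_r_distr smult_r_null)

lemma lmod_hom_plus:
  assumes "left_module R N" "f \<in> lmod_hom R M N" "g \<in> lmod_hom R M N"
  shows "(\<lambda>x. f x \<oplus>\<^bsub>N\<^esub> g x) \<in> lmod_hom R M N"
proof -
  interpret N: left_module R N by fact
  note [simp] = lmod_hom_closed[OF assms(2)] lmod_hom_closed[OF assms(3)]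
  show ?thesis
    by (rule lmod_homI)
      (auto simp: lmod_hom_add[OF assms(2)] lmod_hom_add[OF assms(3)] N.M.a_ac N.smult_r_distr
        lmod_hom_smult[OF assms(2)] lmod_hom_smult[OF assms(3)])
qed

lemma lmod_hom_diff:
  assumes "left_module R N" "f \<in> lmod_hom R M N" "g \<in> lmod_hom R M N"
  shows "(\<lambda>x. f x \<ominus>\<^bsub>N\<^esub> g x) \<in> lmod_hom R M N"
proof -
  interpret N: left_module R N by fact
  note [simp] = lmod_hom_closed[OF assms(2)] lmod_hom_closed[OF assms(3)]
  have "(\<lambda>x. \<ominus>\<^bsub>N\<^esub> g x) \<in> lmod_hom R M N"
    by (rule lmod_homI)
      (auto simp: lmod_hom_add[OF assms(3)] N.M.minus_add N.smult_minus lmod_hom_smult[OF assms(3)])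
  from lmod_hom_plus[OF assms(1,2) this] show ?thesis
    by (simp add: N.M.minus_eq)
qed

lemma lmod_hom_ident: "(\<lambda>x. x) \<in> lmod_hom R M M"
  by (auto simp: lmod_hom_def)

lemma lmod_hom_zero_map:
  assumes "left_module R N" shows "(\<lambda>x. \<zero>\<^bsub>N\<^esub>) \<in> lmod_hom R M N"
proof -
  interpret N: left_module R N by fact
  show ?thesis by (auto simp: lmod_hom_def N.smult_r_null)
qed

lemma (in abelian_group) minus_eq_zero_iff:
  "\<lbrakk>x \<in> carrier G; y \<in> carrier G\<rbrakk> \<Longrightarrow> x \<ominus> y = \<zero> \<longleftrightarrow> x = y"
  by (metis add.inv_closed minus_equality minus_eq minus_minus r_neg)

lemma a_kernel_iff: "x \<in> a_kernel M N f \<longleftrightarrow> x \<in> carrier M \<and> f x = \<zero>\<^bsub>N\<^esub>"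
  by (auto simp: a_kernel_def kernel_def)

text \<open>A direct summand without its complement. Split pairs compose by composing the maps, are
  preserved by functors and may relate modules on unrelated types, so they are easier to carry
  through induction than \<open>direct_summand\<close>.\<close>

definition retract :: "'r ring \<Rightarrow> ('r, 'm) module \<Rightarrow> ('r, 'n) module \<Rightarrow> bool" where
  "retract R M N \<longleftrightarrow>
     (\<exists>s \<in> lmod_hom R M N. \<exists>e \<in> lmod_hom R N M. \<forall>x \<in> carrier M. e (s x) = x)"

lemma retractI:
  "\<lbrakk>s \<in> lmod_hom R M N; e \<in> lmod_hom R N M; \<And>x. x \<in> carrier M \<Longrightarrow> e (s x) = x\<rbrakk> \<Longrightarrow> retract R M N"
  by (auto simp: retract_def)

lemma retract_trans:
  assumes "retract R M N" "retract R N L" shows "retract R M L"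
proof -
  from assms(1) obtain s e where 1: "s \<in> lmod_hom R M N" "e \<in> lmod_hom R N M"
    "\<And>x. x \<in> carrier M \<Longrightarrow> e (s x) = x" unfolding retract_def by blast
  from assms(2) obtain s' e' where 2: "s' \<in> lmod_hom R N L" "e' \<in> lmod_hom R L N"
    "\<And>x. x \<in> carrier N \<Longrightarrow> e' (s' x) = x" unfolding retract_def by blast
  show ?thesis
    by (rule retractI[OF lmod_hom_compose[OF 1(1) 2(1)] lmod_hom_compose[OF 2(2) 1(2)]])
      (simp add: 1 2 lmod_hom_closed[OF 1(1)])
qed

lemma retract_zero:
  assumes M: "left_module R M" and N: "left_module R N" and "carrier M = {\<zero>\<^bsub>M\<^esub>}"
  shows "retract R M N"
  using assms(3) by (intro retractI[OF lmod_hom_zero_map[OF N] lmod_hom_zero_map[OF M]]) auto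

text \<open>The inverse is kept as data so that differentials can be conjugated explicitly. The
  equations hold on carriers only; elsewhere the maps are arbitrary.\<close>

definition lmod_inverses ::
  "'r ring \<Rightarrow> ('r, 'm) module \<Rightarrow> ('r, 'n) module \<Rightarrow> ('m \<Rightarrow> 'n) \<Rightarrow> ('n \<Rightarrow> 'm) \<Rightarrow> bool" where
  "lmod_inverses R M N h k \<longleftrightarrow> h \<in> lmod_hom R M N \<and> k \<in> lmod_hom R N M \<and>
     (\<forall>x \<in> carrier M. k (h x) = x) \<and> (\<forall>y \<in> carrier N. h (k y) = y)"

lemma lmod_inverses_retract: "lmod_inverses R M N h k \<Longrightarrow> retract R N M"
  by (auto simp: lmod_inverses_def retract_def)

lemma lmod_iso_inverse:
  assumes "f \<in> lmod_iso R M N" "left_module R M"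
  shows "lmod_inverses R M N f (inv_into (carrier M) f)"
proof -
  interpret M: left_module R M by fact
  have f: "f \<in> lmod_hom R M N" and b: "bij_betw f (carrier M) (carrier N)"
    using assms by (auto simp: lmod_iso_def)
  let ?g = "inv_into (carrier M) f"
  have [simp]: "?g y \<in> carrier M" "f (?g y) = y" if "y \<in> carrier N" for y
    using that b by (auto simp: bij_betw_def intro: inv_into_into f_inv_into_f)
  have [simp]: "?g (f x) = x" if "x \<in> carrier M" for x
    using that b by (auto simp: bij_betw_def)
  have "?g \<in> lmod_hom R N M"
  proof (rule lmod_homI)
    fix x y assume xy: "x \<in> carrier N" "y \<in> carrier N"
    then have "?g (f (?g x \<oplus>\<^bsub>M\<^esub> ?g y)) = ?g x \<oplus>\<^bsub>M\<^esub> ?g y" by (subst \<open>_ \<Longrightarrow> ?g (f _) = _\<close>) auto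
    then show "?g (x \<oplus>\<^bsub>N\<^esub> y) = ?g x \<oplus>\<^bsub>M\<^esub> ?g y"
      using xy by (simp add: lmod_hom_add[OF f])
  next
    fix r y assume ry: "r \<in> carrier R" "y \<in> carrier N"
    then have "?g (f (r \<odot>\<^bsub>M\<^esub> ?g y)) = r \<odot>\<^bsub>M\<^esub> ?g y" by (subst \<open>_ \<Longrightarrow> ?g (f _) = _\<close>) auto
    then show "?g (r \<odot>\<^bsub>N\<^esub> y) = r \<odot>\<^bsub>M\<^esub> ?g y"
      using ry by (simp add: lmod_hom_smult[OF f])
  qed simp
  then show ?thesis
    using f by (auto simp: lmod_inverses_def)
qed

lemma left_module_dsum:
  assumes "left_module R M" "left_module R N" shows "left_module R (lmod_dsum M N)"
proof -
  interpret M: left_module R M by fact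
  interpret N: left_module R N by fact
  have "abelian_group (lmod_dsum M N)"
  proof (rule abelian_groupI, goal_cases)
    case (6 x)
    then show ?case
      by (intro bexI[of _ "(\<ominus>\<^bsub>M\<^esub> fst x, \<ominus>\<^bsub>N\<^esub> snd x)"])
        (auto simp: lmod_dsum_def M.M.l_neg N.M.l_neg)
  qed (auto simp: lmod_dsum_def M.M.a_ac N.M.a_ac)
  then show ?thesis
    by (intro left_module.intro left_module_axioms.intro M.R.ring_axioms)
      (auto simp: lmod_dsum_def M.smult_l_distr M.smult_r_distr M.smult_assoc1
         N.smult_l_distr N.smult_r_distr N.smult_assoc1)
qed

text \<open>The complement of a split injection s with retraction e is the kernel of e: y decomposes
  into s (e y) and y - s (e y). Conversely, inclusion and projection of the first summand form a
  split pair.\<close>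

lemma direct_summand_iff_retract:
  fixes M :: "('r, 'm) module" and N :: "('r, 'n) module"
  assumes M: "left_module R M" and N: "left_module R N"
  shows "direct_summand R M N \<longleftrightarrow> retract R M N"
proof
  assume "direct_summand R M N"
  then obtain K :: "('r, 'n) module" and f where K: "left_module R K" and f: "f \<in> lmod_iso R (lmod_dsum M K) N"
    unfolding direct_summand_def by blast
  interpret M: left_module R M by fact
  interpret K: left_module R K by fact
  from lmod_iso_inverse[OF f left_module_dsum[OF M K]] obtain g where
    g: "lmod_inverses R (lmod_dsum M K) N f g" by blast
  have "(\<lambda>x. (x, \<zero>\<^bsub>K\<^esub>)) \<in> lmod_hom R M (lmod_dsum M K)"
    by (auto simp: lmod_hom_def lmod_dsum_def K.smult_r_null)
  moreover have "fst \<in> lmod_hom R (lmod_dsum M K) M"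
    by (auto simp: lmod_hom_def lmod_dsum_def)
  ultimately have "retract R M (lmod_dsum M K)"
    by (rule retractI) simp
  moreover have "retract R (lmod_dsum M K) N"
    using g by (auto simp: lmod_inverses_def retract_def)
  ultimately show "retract R M N"
    by (rule retract_trans)
next
  assume "retract R M N"
  then obtain s e where s: "s \<in> lmod_hom R M N" and e: "e \<in> lmod_hom R N M"
    and es [simp]: "\<And>x. x \<in> carrier M \<Longrightarrow> e (s x) = x" unfolding retract_def by blast
  interpret M: left_module R M by fact
  interpret N: left_module R N by fact
  define K where "K = N\<lparr>carrier := a_kernel N M e\<rparr>"
  have K: "left_module R K"
    unfolding K_def by (rule left_module_kernel[OF N M e])
  note [simp] = lmod_hom_closed[OF s] lmod_hom_closed[OF e]
  let ?f = "\<lambda>(x, k). s x \<oplus>\<^bsub>N\<^esub> k"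
  have "?f \<in> lmod_hom R (lmod_dsum M K) N"
    by (rule lmod_homI) (auto simp: lmod_dsum_def K_def a_kernel_iff lmod_hom_add[OF s]
        lmod_hom_smult[OF s] N.M.a_ac N.smult_r_distr)
  moreover have "bij_betw ?f (carrier (lmod_dsum M K)) (carrier N)"
  proof (rule bij_betwI[where g = "\<lambda>y. (e y, y \<ominus>\<^bsub>N\<^esub> s (e y))"])
    show "?f \<in> carrier (lmod_dsum M K) \<rightarrow> carrier N"
      by (auto simp: lmod_dsum_def K_def a_kernel_iff)
    show "(\<lambda>y. (e y, y \<ominus>\<^bsub>N\<^esub> s (e y))) \<in> carrier N \<rightarrow> carrier (lmod_dsum M K)"
      by (auto simp: lmod_dsum_def K_def a_kernel_iff lmod_hom_minus[OF N M e] M.M.r_neg M.M.minus_eq)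
  next
    fix z assume "z \<in> carrier (lmod_dsum M K)"
    then obtain x k where z: "z = (x, k)" and xk: "x \<in> carrier M" "k \<in> carrier N" "e k = \<zero>\<^bsub>M\<^esub>"
      by (auto simp: lmod_dsum_def K_def a_kernel_iff)
    have "e (s x \<oplus>\<^bsub>N\<^esub> k) = x"
      using xk by (simp add: lmod_hom_add[OF e])
    moreover have "s x \<oplus>\<^bsub>N\<^esub> k \<ominus>\<^bsub>N\<^esub> s x = k"
      using xk by (simp add: N.M.minus_eq N.M.a_ac N.M.r_neg)
    ultimately show "(e (?f z), ?f z \<ominus>\<^bsub>N\<^esub> s (e (?f z))) = z"
      by (simp add: z)
  next
    fix y assume "y \<in> carrier N"
    then show "?f (e y, y \<ominus>\<^bsub>N\<^esub> s (e y)) = y"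
      by (simp add: N.M.minus_eq N.M.a_ac N.M.r_neg)
  qed
  ultimately show "direct_summand R M N"
    unfolding direct_summand_def lmod_iso_def using K by blast
qed

text \<open>
  Replaces \<open>M\<close> by an isomorphic module on the type of \<open>N\<close>: the terms of the sequences in \<open>tilting\<close> must
  live on prescribed types, which the induced modules do not.
\<close>

lemma retract_image:
  fixes M :: "('r, 'm) module" and N :: "('r, 'n) module"
  assumes M: "left_module R M" and N: "left_module R N" and "retract R M N"
  shows "\<exists>(M' :: ('r, 'n) module) h k. left_module R M' \<and> lmod_inverses R M M' h k"
proof -
  obtain s e where s: "s \<in> lmod_hom R M N" and e: "e \<in> lmod_hom R N M"
    and es [simp]: "\<And>x. x \<in> carrier M \<Longrightarrow> e (s x) = x" using assms(3) unfolding retract_def by blast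
  interpret M: left_module R M by fact
  interpret N: left_module R N by fact
  note [simp] = lmod_hom_closed[OF s] lmod_hom_closed[OF e]
  \<comment> \<open>The kernel of 1 - s e is the image of s, so \<open>left_module_kernel\<close>
    provides the module structure on the image.\<close>
  define c where "c = (\<lambda>y. y \<ominus>\<^bsub>N\<^esub> s (e y))"
  have "c \<in> lmod_hom R N N"
    unfolding c_def by (rule lmod_hom_diff[OF N lmod_hom_ident lmod_hom_compose[OF e s]])
  then have L: "left_module R (N\<lparr>carrier := a_kernel N N c\<rparr>)"
    by (rule left_module_kernel[OF N N])
  have ker: "y \<in> a_kernel N N c \<longleftrightarrow> y \<in> carrier N \<and> s (e y) = y" for y
    by (auto simp: a_kernel_iff c_def N.M.minus_eq_zero_iff)
  have "lmod_inverses R M (N\<lparr>carrier := a_kernel N N c\<rparr>) s e"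
    using s e by (auto simp: lmod_inverses_def lmod_hom_def ker Pi_def)
  with L show ?thesis by blast
qed

section \<open>Direct sums of copies\<close>

definition copies_in :: "('r, 'm) module \<Rightarrow> 'x \<Rightarrow> 'm \<Rightarrow> 'x \<Rightarrow> 'm" where
  "copies_in M v x = (\<lambda>w. if w = v then x else \<zero>\<^bsub>M\<^esub>)"

text \<open>The map out of the direct sum with components \<open>g v\<close>. Summing over the
  support of z instead of the index set keeps the sum finite when the index set is infinite.\<close>

definition copies_out ::
  "('r, 'm) module \<Rightarrow> ('r, 'n) module \<Rightarrow> ('x \<Rightarrow> 'm \<Rightarrow> 'n) \<Rightarrow> ('x \<Rightarrow> 'm) \<Rightarrow> 'n" where
  "copies_out M N g z = (\<Oplus>\<^bsub>N\<^esub>v\<in>{v. z v \<noteq> \<zero>\<^bsub>M\<^esub>}. g v (z v))"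

lemma copies_in_hom:
  assumes "left_module R M" "v \<in> X"
  shows "copies_in M v \<in> lmod_hom R M (lmod_copies X M)"
proof -
  interpret left_module R M by fact
  have "finite {w. copies_in M v x w \<noteq> \<zero>\<^bsub>M\<^esub>}" for x
    by (rule finite_subset[of _ "{v}"]) (auto simp: copies_in_def)
  then show ?thesis
    using assms(2)
    by (auto simp: lmod_hom_def lmod_copies_def copies_in_def fun_eq_iff smult_r_null)
qed

text \<open>Supports are finite, so induction on a finite set containing the support peels off one
  coordinate at a time. The maps are merely additive because \<open>Ind_copies\<close> compares maps
  from an R-module to an A-module.\<close>

lemma copies_hom_eq:
  fixes N :: "('n, 'k) ring_scheme"
  assumes M: "left_module R M" and N: "abelian_group N"
    and f: "f \<in> add_hom (lmod_copies X M) N" and g: "g \<in> add_hom (lmod_copies X M) N"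
    and eq: "\<And>v x. \<lbrakk>v \<in> X; x \<in> carrier M\<rbrakk> \<Longrightarrow> f (copies_in M v x) = g (copies_in M v x)"
    and z: "z \<in> carrier (lmod_copies X M)"
  shows "f z = g z"
proof -
  interpret left_module R M by fact
  interpret C: left_module R "lmod_copies X M"
    by (rule left_module_copies) fact
  have "\<forall>z \<in> carrier (lmod_copies X M). {v. z v \<noteq> \<zero>\<^bsub>M\<^esub>} \<subseteq> S \<longrightarrow> f z = g z" if "finite S" for S
    using that
  proof (induction S)
    case empty
    have "z = \<zero>\<^bsub>lmod_copies X M\<^esub>" if "{v. z v \<noteq> \<zero>\<^bsub>M\<^esub>} \<subseteq> {}" for z
      using that by (auto simp: lmod_copies_def)
    then show ?case
      using add_hom_zero[OF C.M.abelian_group_axioms N f] add_hom_zero[OF C.M.abelian_group_axioms N g]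
      by metis
  next
    case (insert v S)
    show ?case
    proof (intro ballI impI)
      fix z assume z: "z \<in> carrier (lmod_copies X M)" "{w. z w \<noteq> \<zero>\<^bsub>M\<^esub>} \<subseteq> insert v S"
      show "f z = g z"
      proof (cases "v \<in> X")
        case False
        then have "{w. z w \<noteq> \<zero>\<^bsub>M\<^esub>} \<subseteq> S"
          using z by (auto simp: lmod_copies_def)
        then show ?thesis using insert z by blast
      next
        case True
        have zv: "z v \<in> carrier M"
          using z(1) by (simp add: lmod_copies_def)
        define w where "w = z(v := \<zero>\<^bsub>M\<^esub>)"
        have "finite {i. w i \<noteq> \<zero>\<^bsub>M\<^esub>}"
          by (rule finite_subset[of _ "{i. z i \<noteq> \<zero>\<^bsub>M\<^esub>}"])
            (use z(1) in \<open>auto simp: w_def lmod_copies_def\<close>)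
        then have w: "w \<in> carrier (lmod_copies X M)"
          using z(1) by (auto simp: lmod_copies_def w_def)
        have i: "copies_in M v (z v) \<in> carrier (lmod_copies X M)"
          using lmod_hom_closed[OF copies_in_hom[OF M True]] zv by blast
        have "z = w \<oplus>\<^bsub>lmod_copies X M\<^esub> copies_in M v (z v)"
          using z(1) by (auto simp: lmod_copies_def w_def copies_in_def fun_eq_iff)
        moreover have "f w = g w"
          proof (rule insert.IH[rule_format, OF w])
          show "{v. w v \<noteq> \<zero>\<^bsub>M\<^esub>} \<subseteq> S"
            using z(2) by (auto simp: w_def)
        qed
        ultimately show ?thesis
          using add_hom_add[OF f w i] add_hom_add[OF g w i] eq[OF True zv] by metis
      qed
    qed
  qed
  moreover have "finite {v. z v \<noteq> \<zero>\<^bsub>M\<^esub>}"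
    using z by (simp add: lmod_copies_def)
  ultimately show ?thesis
    using z by blast
qed

context
  fixes R :: "'r ring" and M :: "('r, 'm) module" and N :: "('r, 'n) module"
    and X :: "'x set" and g :: "'x \<Rightarrow> 'm \<Rightarrow> 'n"
  assumes M: "left_module R M" and N: "left_module R N"
    and g: "\<And>v. v \<in> X \<Longrightarrow> g v \<in> lmod_hom R M N"
begin

interpretation M: left_module R M by (fact M)
interpretation N: left_module R N by (fact N)

private lemma supp:
  assumes "z \<in> carrier (lmod_copies X M)"
  shows "finite {v. z v \<noteq> \<zero>\<^bsub>M\<^esub>}" "{v. z v \<noteq> \<zero>\<^bsub>M\<^esub>} \<subseteq> X" "z v \<in> carrier M"
  using assms by (auto simp: lmod_copies_def)

text \<open>Two elements and their sum have different supports; additivity of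
  \<open>copies_out\<close> comes from summing all three over one common finite set. B stays inside
  X because \<open>g v\<close> is known to be a homomorphism only there.\<close>

lemma copies_out_superset:
  assumes z: "z \<in> carrier (lmod_copies X M)" and "finite B" "{v. z v \<noteq> \<zero>\<^bsub>M\<^esub>} \<subseteq> B" "B \<subseteq> X"
  shows "copies_out M N g z = (\<Oplus>\<^bsub>N\<^esub>v\<in>B. g v (z v))"
  unfolding copies_out_def using assms supp[OF z]
  by (intro N.M.add.finprod_mono_neutral_cong_left)
    (auto simp: lmod_hom_zero[OF M N g] intro!: lmod_hom_closed[OF g])

lemma copies_out_hom: "copies_out M N g \<in> lmod_hom R (lmod_copies X M) N"
proof (rule lmod_homI)
  fix z assume z: "z \<in> carrier (lmod_copies X M)"
  then show "copies_out M N g z \<in> carrier N"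
    unfolding copies_out_def using supp[OF z]
    by (intro N.M.finsum_closed) (auto intro!: lmod_hom_closed[OF g])
next
  fix z w assume zw: "z \<in> carrier (lmod_copies X M)" "w \<in> carrier (lmod_copies X M)"
  define B where "B = {v. z v \<noteq> \<zero>\<^bsub>M\<^esub>} \<union> {v. w v \<noteq> \<zero>\<^bsub>M\<^esub>}"
  interpret C: left_module R "lmod_copies X M"
    by (rule left_module_copies[OF M])
  have B: "finite B" "B \<subseteq> X"
    using supp(1,2)[OF zw(1)] supp(1,2)[OF zw(2)] by (auto simp: B_def)
  have plus: "(z \<oplus>\<^bsub>lmod_copies X M\<^esub> w) v = z v \<oplus>\<^bsub>M\<^esub> w v" for v
    by (simp add: lmod_copies_def)
  have [simp]: "g v (z v) \<in> carrier N" "g v (w v) \<in> carrier N" if "v \<in> B" for v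
    using that B zw by (auto intro!: lmod_hom_closed[OF g] supp(3))
  have "copies_out M N g (z \<oplus>\<^bsub>lmod_copies X M\<^esub> w) =
      (\<Oplus>\<^bsub>N\<^esub>v\<in>B. g v ((z \<oplus>\<^bsub>lmod_copies X M\<^esub> w) v))"
    using zw B by (intro copies_out_superset) (auto simp: B_def plus)
  also have "\<dots> = (\<Oplus>\<^bsub>N\<^esub>v\<in>B. g v (z v) \<oplus>\<^bsub>N\<^esub> g v (w v))"
    using B zw by (intro N.M.finsum_cong') (auto simp: plus supp(3) intro!: lmod_hom_add[OF g])
  also have "\<dots> = (\<Oplus>\<^bsub>N\<^esub>v\<in>B. g v (z v)) \<oplus>\<^bsub>N\<^esub> (\<Oplus>\<^bsub>N\<^esub>v\<in>B. g v (w v))"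
    by (intro N.M.finsum_addf) auto
  also have "\<dots> = copies_out M N g z \<oplus>\<^bsub>N\<^esub> copies_out M N g w"
    using copies_out_superset[OF zw(1) B(1) _ B(2)] copies_out_superset[OF zw(2) B(1) _ B(2)]
    by (auto simp: B_def)
  finally show "copies_out M N g (z \<oplus>\<^bsub>lmod_copies X M\<^esub> w) = copies_out M N g z \<oplus>\<^bsub>N\<^esub> copies_out M N g w" .
next
  fix r z assume rz: "r \<in> carrier R" "z \<in> carrier (lmod_copies X M)"
  interpret C: left_module R "lmod_copies X M"
    by (rule left_module_copies[OF M])
  define B where "B = {v. z v \<noteq> \<zero>\<^bsub>M\<^esub>}"
  have B: "finite B" "B \<subseteq> X"
    using supp(1,2)[OF rz(2)] by (auto simp: B_def)
  have gc: "g v (z v) \<in> carrier N" if "v \<in> B" for v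
    using that B rz by (auto intro!: lmod_hom_closed[OF g] supp(3))
  have times: "(r \<odot>\<^bsub>lmod_copies X M\<^esub> z) v = r \<odot>\<^bsub>M\<^esub> z v" for v
    by (simp add: lmod_copies_def)
  have "copies_out M N g (r \<odot>\<^bsub>lmod_copies X M\<^esub> z) =
      (\<Oplus>\<^bsub>N\<^esub>v\<in>B. g v ((r \<odot>\<^bsub>lmod_copies X M\<^esub> z) v))"
    using rz B by (intro copies_out_superset) (auto simp: B_def times M.smult_r_null)
  also have "\<dots> = (\<Oplus>\<^bsub>N\<^esub>v\<in>B. r \<odot>\<^bsub>N\<^esub> g v (z v))"
    using B rz gc by (intro N.M.finsum_cong') (auto simp: times supp(3) intro!: lmod_hom_smult[OF g])
  also have "\<dots> = r \<odot>\<^bsub>N\<^esub> (\<Oplus>\<^bsub>N\<^esub>v\<in>B. g v (z v))"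
    by (rule add_hom_finsum[OF N.M.abelian_group_axioms N.M.abelian_group_axioms, symmetric])
      (use rz gc in \<open>auto intro!: add_homI simp: N.smult_r_distr\<close>)
  finally show "copies_out M N g (r \<odot>\<^bsub>lmod_copies X M\<^esub> z) = r \<odot>\<^bsub>N\<^esub> copies_out M N g z"
    by (simp add: copies_out_def B_def)
qed

lemma copies_out_in:
  assumes "v \<in> X" "x \<in> carrier M"
  shows "copies_out M N g (copies_in M v x) = g v x"
proof -
  have "copies_out M N g (copies_in M v x) = (\<Oplus>\<^bsub>N\<^esub>w\<in>{v}. g w (copies_in M v x w))"
    using assms lmod_hom_closed[OF copies_in_hom[OF M assms(1)]]
    by (intro copies_out_superset) (auto simp: copies_in_def)
  then show ?thesis
    using lmod_hom_closed[OF g] assms by (simp add: copies_in_def)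
qed

end

lemma lmod_hom_copies:
  assumes M: "left_module R M" and N: "left_module R N" and f: "f \<in> lmod_hom R M N"
  shows "(\<lambda>z v. f (z v)) \<in> lmod_hom R (lmod_copies X M) (lmod_copies X N)"
proof -
  have 0: "f \<zero>\<^bsub>M\<^esub> = \<zero>\<^bsub>N\<^esub>" by (rule lmod_hom_zero[OF assms])
  have "finite {v. f (z v) \<noteq> \<zero>\<^bsub>N\<^esub>}" if "finite {v. z v \<noteq> \<zero>\<^bsub>M\<^esub>}" for z
    by (rule finite_subset[OF _ that]) (auto simp: 0)
  then show ?thesis
    by (auto simp: lmod_hom_def lmod_copies_def 0 lmod_hom_closed[OF f] lmod_hom_add[OF f] lmod_hom_smult[OF f])
qed

lemma retract_copies:
  assumes "left_module R M" "left_module R N" "retract R M N"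
  shows "retract R (lmod_copies X M) (lmod_copies X N)"
proof -
  obtain s e where s: "s \<in> lmod_hom R M N" and e: "e \<in> lmod_hom R N M"
    and es: "\<And>x. x \<in> carrier M \<Longrightarrow> e (s x) = x"
    using assms(3) unfolding retract_def by blast
  show ?thesis
    by (rule retractI[OF lmod_hom_copies[OF assms(1,2) s] lmod_hom_copies[OF assms(2,1) e]])
      (auto simp: lmod_copies_def es)
qed

section \<open>Projective modules\<close>

lemma carrier_regular [simp]: "carrier (regular_module R) = carrier R"
  and zero_regular [simp]: "\<zero>\<^bsub>regular_module R\<^esub> = \<zero>\<^bsub>R\<^esub>"
  and add_regular [simp]: "x \<oplus>\<^bsub>regular_module R\<^esub> y = x \<oplus>\<^bsub>R\<^esub> y"
  and smult_regular [simp]: "r \<odot>\<^bsub>regular_module R\<^esub> x = r \<otimes>\<^bsub>R\<^esub> x"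
  by (simp_all add: regular_module_def)

lemma (in left_module) smult_hom: "y \<in> carrier M \<Longrightarrow> (\<lambda>r. r \<odot>\<^bsub>M\<^esub> y) \<in> lmod_hom R (regular_module R) M"
  by (rule lmod_homI) (auto simp: smult_l_distr smult_assoc1)

lemma free_unit:
  assumes "ring R" "v \<in> X"
  shows "copies_in (regular_module R) v \<one>\<^bsub>R\<^esub> \<in> carrier (free_lmod X R)"
  by (rule lmod_hom_closed[OF copies_in_hom[OF left_module_regular[OF assms(1)] assms(2)]])
    (simp add: assms ring.ring_simprules)

lemma free_hom:
  assumes N: "left_module R N" and y: "\<And>v. v \<in> X \<Longrightarrow> y v \<in> carrier N"
  shows "\<exists>f \<in> lmod_hom R (free_lmod X R) N. \<forall>v \<in> X. f (copies_in (regular_module R) v \<one>\<^bsub>R\<^esub>) = y v"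
proof -
  interpret N: left_module R N by fact
  have g: "(\<lambda>r. r \<odot>\<^bsub>N\<^esub> y v) \<in> lmod_hom R (regular_module R) N" if "v \<in> X" for v
    by (rule N.smult_hom) (use y that in auto)
  note R = left_module_regular[OF N.R.ring_axioms]
  show ?thesis
    by (intro bexI[of _ "copies_out (regular_module R) N (\<lambda>v r. r \<odot>\<^bsub>N\<^esub> y v)"] ballI copies_out_hom[OF R N g])
      (simp_all add: copies_out_in[OF R N g] y)
qed

lemma free_hom_eq:
  assumes N: "left_module R N"
    and f: "f \<in> lmod_hom R (free_lmod X R) N" and g: "g \<in> lmod_hom R (free_lmod X R) N"
    and eq: "\<And>v. v \<in> X \<Longrightarrow>
      f (copies_in (regular_module R) v \<one>\<^bsub>R\<^esub>) = g (copies_in (regular_module R) v \<one>\<^bsub>R\<^esub>)"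
    and z: "z \<in> carrier (free_lmod X R)"
  shows "f z = g z"
proof -
  interpret N: left_module R N by fact
  note R = left_module_regular[OF N.R.ring_axioms]
  show ?thesis
  proof (rule copies_hom_eq[OF R N.M.abelian_group_axioms add_hom_of_lmod_hom[OF f] add_hom_of_lmod_hom[OF g] _ z])
    fix v r assume v: "v \<in> X" and "r \<in> carrier (regular_module R)"
    then have r: "r \<in> carrier R" by simp
    have "copies_in (regular_module R) v r = r \<odot>\<^bsub>free_lmod X R\<^esub> copies_in (regular_module R) v \<one>\<^bsub>R\<^esub>"
      using lmod_hom_smult[OF copies_in_hom[OF R v], of r "\<one>\<^bsub>R\<^esub>"] r by simp
    then show "f (copies_in (regular_module R) v r) = g (copies_in (regular_module R) v r)"
      using eq[OF v] lmod_hom_smult[OF f r free_unit[OF N.R.ring_axioms v]]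
        lmod_hom_smult[OF g r free_unit[OF N.R.ring_axioms v]] by simp
  qed
qed

text \<open>Choose preimages for the images of the basis elements, extend freely, and precompose
  with the section of P into the free module. An inclusion of images, rather than surjectivity of g,
  is the form used in the inductive constructions below, where g is a differential whose image is a
  kernel.\<close>

lemma projective_lift:
  assumes P: "left_module R P" and M: "left_module R M" and N: "left_module R N"
    and ret: "retract R P (free_lmod X R)"
    and g: "g \<in> lmod_hom R M N" and f: "f \<in> lmod_hom R P N"
    and sub: "f ` carrier P \<subseteq> g ` carrier M"
  shows "\<exists>h \<in> lmod_hom R P M. \<forall>x \<in> carrier P. g (h x) = f x"
proof -
  interpret N: left_module R N by fact
  let ?\<delta> = "\<lambda>v. copies_in (regular_module R) v \<one>\<^bsub>R\<^esub>"
  obtain s e where s: "s \<in> lmod_hom R P (free_lmod X R)" and e: "e \<in> lmod_hom R (free_lmod X R) P"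
    and es: "\<And>x. x \<in> carrier P \<Longrightarrow> e (s x) = x"
    using ret unfolding retract_def by blast
  have "\<forall>v \<in> X. \<exists>y \<in> carrier M. g y = f (e (?\<delta> v))"
    using sub lmod_hom_closed[OF e free_unit[OF N.R.ring_axioms]] by (fastforce simp: image_subset_iff)
  then obtain y where y: "\<And>v. v \<in> X \<Longrightarrow> y v \<in> carrier M \<and> g (y v) = f (e (?\<delta> v))"
    by metis
  obtain k where k: "k \<in> lmod_hom R (free_lmod X R) M" and ky: "\<forall>v \<in> X. k (?\<delta> v) = y v"
    using free_hom[OF M, of X y] y by blast
  have "g (k z) = f (e z)" if "z \<in> carrier (free_lmod X R)" for z
    by (rule free_hom_eq[OF N lmod_hom_compose[OF k g] lmod_hom_compose[OF e f] _ that])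
      (simp add: ky y)
  then have "\<forall>x \<in> carrier P. g (k (s x)) = f x"
    using lmod_hom_closed[OF s] es by simp
  then show ?thesis
    by (rule bexI[OF _ lmod_hom_compose[OF s k]])
qed

section \<open>Characterizations of projective and of finitely generated projective modules\<close>

lemma projective_lmodD:
  fixes P :: "('r, 'p) module"
  assumes "projective_lmod R P"
  shows "left_module R P" "\<exists>X :: 'p set. retract R P (free_lmod X R)"
proof -
  show P: "left_module R P"
    using assms by (simp add: projective_lmod_def)
  then interpret left_module R P .
  show "\<exists>X :: 'p set. retract R P (free_lmod X R)"
    using assms direct_summand_iff_retract[OF P left_module_copies[OF left_module_regular[OF R.ring_axioms]]]
    by (auto simp: projective_lmod_def)
qed

text \<open>The index set in \<open>projective_lmod\<close> is tied to the type of P, while X may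
  live on any type. The canonical surjection onto P from the free module on its own carrier splits
  by the lifting property.\<close>

lemma projective_lmodI:
  assumes P: "left_module R P" and ret: "retract R P (free_lmod X R)"
  shows "projective_lmod R P"
proof -
  interpret left_module R P by fact
  let ?F = "free_lmod (carrier P) R"
  have F: "left_module R ?F"
    by (intro left_module_copies left_module_regular R.ring_axioms)
  obtain e where e: "e \<in> lmod_hom R ?F P"
    and ev: "\<forall>v \<in> carrier P. e (copies_in (regular_module R) v \<one>\<^bsub>R\<^esub>) = v"
    using free_hom[OF P, of "carrier P" "\<lambda>v. v"] by blast
  have "x \<in> e ` carrier ?F" if "x \<in> carrier P" for x
    using ev that free_unit[OF R.ring_axioms that] by (metis image_eqI)
  then obtain s where "s \<in> lmod_hom R P ?F" "\<forall>x \<in> carrier P. e (s x) = x"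
    using projective_lift[OF P F P ret e lmod_hom_ident] by auto
  then have "retract R P ?F"
    using e by (auto simp: retract_def)
  then show ?thesis
    unfolding projective_lmod_def using direct_summand_iff_retract[OF P F] P by blast
qed

text \<open>Composed with a section of e, this is the dual basis expansion of a finitely generated
  projective module: the coordinates of the section are the functionals, the images of the unit
  vectors the generators.\<close>

lemma free_hom_expansion:
  fixes k :: nat
  assumes P: "left_module R P" and e: "e \<in> lmod_hom R (free_lmod {..<k} R) P"
    and z: "z \<in> carrier (free_lmod {..<k} R)"
  shows "e z = (\<Oplus>\<^bsub>P\<^esub>i\<in>{..<k}. z i \<odot>\<^bsub>P\<^esub> e (copies_in (regular_module R) i \<one>\<^bsub>R\<^esub>))"
proof -
  interpret left_module R P by fact
  let ?x = "\<lambda>i. e (copies_in (regular_module R) i \<one>\<^bsub>R\<^esub>)"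
  note R = left_module_regular[OF R.ring_axioms]
  have x: "?x i \<in> carrier P" if "i \<in> {..<k}" for i
    by (rule lmod_hom_closed[OF e free_unit[OF R.ring_axioms that]])
  note g = smult_hom[OF x]
  have "e z = copies_out (regular_module R) P (\<lambda>i r. r \<odot>\<^bsub>P\<^esub> ?x i) z"
  proof (rule free_hom_eq[OF P e copies_out_hom[OF R P g] _ z])
    fix i assume i: "i \<in> {..<k}"
    have "copies_out (regular_module R) P (\<lambda>i r. r \<odot>\<^bsub>P\<^esub> ?x i) (copies_in (regular_module R) i \<one>\<^bsub>R\<^esub>) =
        \<one>\<^bsub>R\<^esub> \<odot>\<^bsub>P\<^esub> ?x i"
      by (rule copies_out_in[OF R P, where X = "{..<k}"]) (use g i in auto)
    then show "?x i = copies_out (regular_module R) P (\<lambda>i r. r \<odot>\<^bsub>P\<^esub> ?x i) (copies_in (regular_module R) i \<one>\<^bsub>R\<^esub>)"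
      using x[OF i] by simp
  qed
  also have "\<dots> = (\<Oplus>\<^bsub>P\<^esub>i\<in>{..<k}. z i \<odot>\<^bsub>P\<^esub> ?x i)"
    by (rule copies_out_superset[OF R P g z]) (use z in \<open>force simp: lmod_copies_def not_less[symmetric]\<close>)+
  finally show ?thesis .
qed

text \<open>An enumeration of the generators gives a surjection from R^k, and projectivity splits
  it.\<close>

lemma fin_gen_retract_free:
  assumes P: "left_module R P" and fg: "fin_gen_lmod R P" and ret: "retract R P (free_lmod X R)"
  shows "\<exists>k :: nat. retract R P (free_lmod {..<k} R)"
proof -
  interpret left_module R P by fact
  obtain S where S: "finite S" "S \<subseteq> carrier P"
    and gen: "\<forall>x \<in> carrier P. \<exists>c \<in> S \<rightarrow> carrier R. x = (\<Oplus>\<^bsub>P\<^esub>s\<in>S. c s \<odot>\<^bsub>P\<^esub> s)"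
    using fg by (auto simp: fin_gen_lmod_def)
  obtain k :: nat and b where b: "bij_betw b {..<k} S"
    using ex_bij_betw_nat_finite[OF S(1)] by (auto simp: atLeast0LessThan)
  have bS: "b i \<in> S" if "i < k" for i
    using b that by (auto simp: bij_betw_def)
  let ?F = "free_lmod {..<k} R"
  have F: "left_module R ?F"
    by (intro left_module_copies left_module_regular R.ring_axioms)
  obtain e where e: "e \<in> lmod_hom R ?F P"
    and ev: "\<forall>v \<in> {..<k}. e (copies_in (regular_module R) v \<one>\<^bsub>R\<^esub>) = b v"
    using free_hom[OF P, of "{..<k}" b] bS S by blast
  have "x \<in> e ` carrier ?F" if x: "x \<in> carrier P" for x
  proof -
    obtain c where c: "c \<in> S \<rightarrow> carrier R" and xc: "x = (\<Oplus>\<^bsub>P\<^esub>s\<in>S. c s \<odot>\<^bsub>P\<^esub> s)"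
      using gen x by blast
    define z where "z i = (if i < k then c (b i) else \<zero>\<^bsub>R\<^esub>)" for i
    have "finite {i. z i \<noteq> \<zero>\<^bsub>R\<^esub>}"
      by (rule finite_subset[of _ "{..<k}"]) (auto simp: z_def split: if_splits)
    then have z: "z \<in> carrier ?F"
      using c bS by (auto simp: lmod_copies_def z_def Pi_def)
    have "e z = (\<Oplus>\<^bsub>P\<^esub>i\<in>{..<k}. c (b i) \<odot>\<^bsub>P\<^esub> b i)"
      unfolding free_hom_expansion[OF P e z] using c bS S
      by (intro M.finsum_cong') (auto simp: z_def ev Pi_def)
    also have "\<dots> = x"
      unfolding xc bij_betw_imp_surj_on[OF b, symmetric]
      using c bS S b by (intro M.add.finprod_reindex[symmetric]) (auto simp: bij_betw_def Pi_def subset_iff)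
    finally show ?thesis
      using z by blast
  qed
  then obtain s where "s \<in> lmod_hom R P ?F" "\<forall>x \<in> carrier P. e (s x) = x"
    using projective_lift[OF P F P ret e lmod_hom_ident] by auto
  then show ?thesis
    using e by (auto simp: retract_def)
qed

lemma fin_gen_lmodI:
  fixes k :: nat
  assumes P: "left_module R P" and ret: "retract R P (free_lmod {..<k} R)"
  shows "fin_gen_lmod R P"
proof -
  interpret left_module R P by fact
  obtain s e where s: "s \<in> lmod_hom R P (free_lmod {..<k} R)"
    and e: "e \<in> lmod_hom R (free_lmod {..<k} R) P"
    and es: "\<And>x. x \<in> carrier P \<Longrightarrow> e (s x) = x"
    using ret unfolding retract_def by blast
  let ?x = "\<lambda>i. e (copies_in (regular_module R) i \<one>\<^bsub>R\<^esub>)"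
  have x: "?x i \<in> carrier P" if "i \<in> {..<k}" for i
    by (rule lmod_hom_closed[OF e free_unit[OF R.ring_axioms that]])
  define S where "S = ?x ` {..<k}"
  have S: "finite S" "S \<subseteq> carrier P"
    using x by (auto simp: S_def)
  \<comment> \<open>Coefficients are indexed by the set S, but different unit vectors may have the
    same image in S. Closing the span under sums avoids collecting the coefficients of coinciding
    images.\<close>
  define span where "span = {x. \<exists>c \<in> S \<rightarrow> carrier R. x = (\<Oplus>\<^bsub>P\<^esub>s\<in>S. c s \<odot>\<^bsub>P\<^esub> s)}"
  have zero: "\<zero>\<^bsub>P\<^esub> \<in> span"
  proof -
    have "(\<Oplus>\<^bsub>P\<^esub>s\<in>S. \<zero>\<^bsub>R\<^esub> \<odot>\<^bsub>P\<^esub> s) = \<zero>\<^bsub>P\<^esub>"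
      by (rule M.add.finprod_one_eqI) (use S in \<open>auto simp: smult_l_null\<close>)
    then show ?thesis
      unfolding span_def by (intro CollectI bexI[of _ "\<lambda>_. \<zero>\<^bsub>R\<^esub>"]) auto
  qed
  have plus: "y \<oplus>\<^bsub>P\<^esub> z \<in> span" if "y \<in> span" "z \<in> span" for y z
  proof -
    obtain c d where cd: "c \<in> S \<rightarrow> carrier R" "d \<in> S \<rightarrow> carrier R"
      "y = (\<Oplus>\<^bsub>P\<^esub>s\<in>S. c s \<odot>\<^bsub>P\<^esub> s)" "z = (\<Oplus>\<^bsub>P\<^esub>s\<in>S. d s \<odot>\<^bsub>P\<^esub> s)"
      using \<open>y \<in> span\<close> \<open>z \<in> span\<close> unfolding span_def mem_Collect_eq by (elim bexE)
    have "y \<oplus>\<^bsub>P\<^esub> z = (\<Oplus>\<^bsub>P\<^esub>s\<in>S. c s \<odot>\<^bsub>P\<^esub> s \<oplus>\<^bsub>P\<^esub> d s \<odot>\<^bsub>P\<^esub> s)"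
      unfolding cd(3,4) using cd(1,2) S(2)
      by (intro M.finsum_addf[symmetric]) (blast intro: smult_closed dest: funcset_mem)+
    also have "\<dots> = (\<Oplus>\<^bsub>P\<^esub>s\<in>S. (c s \<oplus>\<^bsub>R\<^esub> d s) \<odot>\<^bsub>P\<^esub> s)"
      using cd(1,2) S(2)
      by (intro M.finsum_cong') (simp_all add: Pi_def subset_iff smult_l_distr)
    finally show ?thesis
      unfolding span_def using cd(1,2)
      by (intro CollectI bexI[of _ "\<lambda>s. c s \<oplus>\<^bsub>R\<^esub> d s"]) (assumption, auto simp: Pi_def)
  qed
  have gen: "r \<odot>\<^bsub>P\<^esub> y \<in> span" if "r \<in> carrier R" "y \<in> S" for r y
  proof -
    have "(\<Oplus>\<^bsub>P\<^esub>s\<in>S. (if s = y then r else \<zero>\<^bsub>R\<^esub>) \<odot>\<^bsub>P\<^esub> s) = (\<Oplus>\<^bsub>P\<^esub>s\<in>S. if y = s then r \<odot>\<^bsub>P\<^esub> s else \<zero>\<^bsub>P\<^esub>)"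
      using that S by (intro M.finsum_cong') (auto simp: smult_l_null)
    also have "\<dots> = r \<odot>\<^bsub>P\<^esub> y"
      using that S by (intro M.add.finprod_singleton) auto
    finally show ?thesis
      unfolding span_def using that
      by (intro CollectI bexI[of _ "\<lambda>s. if s = y then r else \<zero>\<^bsub>R\<^esub>"]) auto
  qed
  have sum: "(\<Oplus>\<^bsub>P\<^esub>i\<in>I. z i \<odot>\<^bsub>P\<^esub> ?x i) \<in> span"
    if "I \<subseteq> {..<k}" "\<And>i. z i \<in> carrier R" for I z
    using finite_subset[OF that(1) finite_lessThan] that(1)
  proof (induction I)
    case (insert i I)
    then show ?case
      using x that(2) by (subst M.finsum_insert) (auto simp: S_def intro!: plus gen)
  qed (simp add: zero)
  have "y \<in> span" if "y \<in> carrier P" for y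
  proof -
    have sy: "s y \<in> carrier (free_lmod {..<k} R)"
      by (rule lmod_hom_closed[OF s that])
    show ?thesis
      using free_hom_expansion[OF P e sy] es[OF that] sum[OF subset_refl, of "s y"] sy
      by (simp add: lmod_copies_def)
  qed
  then show ?thesis
    unfolding fin_gen_lmod_def span_def using S by blast
qed

section \<open>The comparison theorem\<close>

text \<open>Exactness of \<open>Hom(P, N)\<close> in degree \<open>i + 1\<close>; degree \<open>0\<close> is never needed.\<close>

definition hom_exact ::
  "'r ring \<Rightarrow> (nat \<Rightarrow> ('r, 'p) module) \<Rightarrow> (nat \<Rightarrow> 'p \<Rightarrow> 'p) \<Rightarrow> ('r, 'n) module \<Rightarrow> nat \<Rightarrow> bool" where
  "hom_exact R P d N i \<longleftrightarrow>
     (\<forall>c \<in> lmod_hom R (P (Suc i)) N. (\<forall>x \<in> carrier (P (Suc (Suc i))). c (d (Suc i) x) = \<zero>\<^bsub>N\<^esub>) \<longrightarrow>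
        (\<exists>b \<in> lmod_hom R (P i) N. \<forall>x \<in> carrier (P (Suc i)). c x = b (d i x)))"

lemma resolutionD:
  assumes "resolution R P d \<epsilon> M"
  shows "left_module R (P j)" "\<epsilon> \<in> lmod_hom R (P 0) M" "d j \<in> lmod_hom R (P (Suc j)) (P j)"
    "\<epsilon> ` carrier (P 0) = carrier M"
    "x \<in> d 0 ` carrier (P (Suc 0)) \<longleftrightarrow> x \<in> carrier (P 0) \<and> \<epsilon> x = \<zero>\<^bsub>M\<^esub>"
    "y \<in> d (Suc j) ` carrier (P (Suc (Suc j))) \<longleftrightarrow> y \<in> carrier (P (Suc j)) \<and> d j y = \<zero>\<^bsub>P j\<^esub>"
  using assms by (simp_all add: resolution_def a_kernel_iff)

text \<open>Each lift exists because P is projective and the map to be lifted lands in the image of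
  the next differential of Q, which exactness identifies with a kernel.\<close>

lemma chain_map_exists:
  assumes M: "left_module R M"
    and P: "resolution R P d \<epsilon> M" and proj: "\<And>j. \<exists>X :: 'x set. retract R (P j) (free_lmod X R)"
    and Q: "resolution R Q d' \<epsilon>' M"
  shows "\<exists>\<phi>. (\<forall>j. \<phi> j \<in> lmod_hom R (P j) (Q j)) \<and>
    (\<forall>x \<in> carrier (P 0). \<epsilon>' (\<phi> 0 x) = \<epsilon> x) \<and>
    (\<forall>j. \<forall>x \<in> carrier (P (Suc j)). d' j (\<phi> (Suc j) x) = \<phi> j (d j x))"
proof -
  note PD = resolutionD[OF P] and QD = resolutionD[OF Q]
  \<comment> \<open>The last clause is what makes the next lift possible, so it belongs to the
    invariant. The augmentation constrains degree 0 alone, hence the guard.\<close>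
  define I where "I j \<phi> \<longleftrightarrow> \<phi> \<in> lmod_hom R (P j) (Q j) \<and> (j = 0 \<longrightarrow> (\<forall>x \<in> carrier (P 0). \<epsilon>' (\<phi> x) = \<epsilon> x)) \<and>
    (\<forall>x \<in> carrier (P (Suc j)). \<phi> (d j x) \<in> d' j ` carrier (Q (Suc j)))" for j \<phi>
  have "\<exists>\<phi>. \<forall>j. I j (\<phi> j) \<and> (\<forall>x \<in> carrier (P (Suc j)). d' j (\<phi> (Suc j) x) = \<phi> j (d j x))"
  proof (rule dependent_nat_choice)
    obtain X :: "'x set" where X: "retract R (P 0) (free_lmod X R)" using proj by blast
    obtain \<phi> where \<phi>: "\<phi> \<in> lmod_hom R (P 0) (Q 0)" "\<forall>x \<in> carrier (P 0). \<epsilon>' (\<phi> x) = \<epsilon> x"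
      using projective_lift[OF PD(1) QD(1) M X QD(2) PD(2)] PD(4) QD(4) by blast
    have "I 0 \<phi>"
      unfolding I_def QD(5) using \<phi> PD(5)[THEN iffD1, OF imageI] by (auto intro: lmod_hom_closed[OF \<phi>(1)])
    then show "\<exists>\<phi>. I 0 \<phi>" by (rule exI[of "I 0"])
  next
    fix \<phi> j assume I: "I j \<phi>"
    obtain X :: "'x set" where X: "retract R (P (Suc j)) (free_lmod X R)" using proj by blast
    have \<phi>: "\<phi> \<in> lmod_hom R (P j) (Q j)" using I by (simp add: I_def)
    obtain \<psi> where \<psi>: "\<psi> \<in> lmod_hom R (P (Suc j)) (Q (Suc j))"
      "\<forall>x \<in> carrier (P (Suc j)). d' j (\<psi> x) = \<phi> (d j x)"
      using projective_lift[OF PD(1) QD(1) QD(1) X QD(3) lmod_hom_compose[OF PD(3) \<phi>]] I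
      by (auto simp: I_def image_subset_iff)
    have "d' j (\<psi> (d (Suc j) x)) = \<zero>\<^bsub>Q j\<^esub>" if "x \<in> carrier (P (Suc (Suc j)))" for x
    proof -
      have "d (Suc j) x \<in> carrier (P (Suc j))" "d j (d (Suc j) x) = \<zero>\<^bsub>P j\<^esub>"
        using PD(6) that by blast+
      then show ?thesis
        using \<psi>(2) lmod_hom_zero[OF PD(1) QD(1) \<phi>] by simp
    qed
    then have "I (Suc j) \<psi>"
      unfolding I_def using \<psi> by (auto simp: QD(6) lmod_hom_closed[OF \<psi>(1)] lmod_hom_closed[OF PD(3)])
    with \<psi>(2) show "\<exists>\<psi>. I (Suc j) \<psi> \<and> (\<forall>x \<in> carrier (P (Suc j)). d' j (\<psi> x) = \<phi> (d j x))"
      by blast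
  qed
  then show ?thesis
    unfolding I_def by metis
qed

text \<open>A homotopy between the identity and a chain map \<psi> over the identity of M. In the
  application \<psi> is the round trip through another resolution.\<close>

lemma chain_homotopy_exists:
  assumes M: "left_module R M"
    and P: "resolution R P d \<epsilon> M" and proj: "\<And>j. \<exists>X :: 'x set. retract R (P j) (free_lmod X R)"
    and \<psi>: "\<And>j. \<psi> j \<in> lmod_hom R (P j) (P j)"
    and \<psi>0: "\<And>x. x \<in> carrier (P 0) \<Longrightarrow> \<epsilon> (\<psi> 0 x) = \<epsilon> x"
    and \<psi>S: "\<And>j x. x \<in> carrier (P (Suc j)) \<Longrightarrow> d j (\<psi> (Suc j) x) = \<psi> j (d j x)"
  shows "\<exists>h. (\<forall>j. h j \<in> lmod_hom R (P j) (P (Suc j))) \<and>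
    (\<forall>j. \<forall>x \<in> carrier (P (Suc j)). d (Suc j) (h (Suc j) x) = x \<ominus>\<^bsub>P (Suc j)\<^esub> \<psi> (Suc j) x \<ominus>\<^bsub>P (Suc j)\<^esub> h j (d j x))"
proof -
  note PD = resolutionD[OF P]
  have dd: "d j x \<in> carrier (P j)" if "x \<in> carrier (P (Suc j))" for j x
    by (rule lmod_hom_closed[OF PD(3) that])
  have pc: "\<psi> j x \<in> carrier (P j)" if "x \<in> carrier (P j)" for j x
    by (rule lmod_hom_closed[OF \<psi> that])
  \<comment> \<open>The second clause says that the map to be lifted next takes its values among
    boundaries, as \<open>projective_lift\<close> demands.\<close>
  define I where "I j h \<longleftrightarrow> h \<in> lmod_hom R (P j) (P (Suc j)) \<and>
    (\<forall>x \<in> carrier (P (Suc j)). x \<ominus>\<^bsub>P (Suc j)\<^esub> \<psi> (Suc j) x \<ominus>\<^bsub>P (Suc j)\<^esub> h (d j x) \<in> d (Suc j) ` carrier (P (Suc (Suc j))))" for j h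
  \<comment> \<open>Applying \<open>d j\<close> to x - \<psi> x - h (d x) gives zero as soon as d h
    = 1 - \<psi> on boundaries. In degree 0 this identity holds on all of \<open>P 0\<close>; later
    the correction term h (d y) vanishes for boundaries y because d d = 0.\<close>
  have I: "I j h" if h: "h \<in> lmod_hom R (P j) (P (Suc j))"
    and eq: "\<And>y. y \<in> d j ` carrier (P (Suc j)) \<Longrightarrow> d j (h y) = y \<ominus>\<^bsub>P j\<^esub> \<psi> j y" for j h
  proof -
    interpret Pj: left_module R "P j" by (rule PD(1))
    interpret Ps: left_module R "P (Suc j)" by (rule PD(1))
    show ?thesis
      unfolding I_def PD(6)
    proof (intro conjI h ballI)
      fix x assume x: "x \<in> carrier (P (Suc j))"
      have hx: "h (d j x) \<in> carrier (P (Suc j))" by (rule lmod_hom_closed[OF h dd[OF x]])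
      show "x \<ominus>\<^bsub>P (Suc j)\<^esub> \<psi> (Suc j) x \<ominus>\<^bsub>P (Suc j)\<^esub> h (d j x) \<in> carrier (P (Suc j))"
        using x hx pc by simp
      show "d j (x \<ominus>\<^bsub>P (Suc j)\<^esub> \<psi> (Suc j) x \<ominus>\<^bsub>P (Suc j)\<^esub> h (d j x)) = \<zero>\<^bsub>P j\<^esub>"
        using x hx pc[of x "Suc j"] pc[of "d j x" j] dd[OF x] eq[of "d j x"]
        by (simp add: lmod_hom_minus[OF PD(1) PD(1) PD(3)] \<psi>S Pj.M.minus_eq_zero_iff)
    qed
  qed
  have "\<exists>h. \<forall>j. I j (h j) \<and>
    (\<forall>x \<in> carrier (P (Suc j)). d (Suc j) (h (Suc j) x) = x \<ominus>\<^bsub>P (Suc j)\<^esub> \<psi> (Suc j) x \<ominus>\<^bsub>P (Suc j)\<^esub> h j (d j x))"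
  proof (rule dependent_nat_choice)
    interpret P0: left_module R "P 0" by (rule PD(1))
    interpret M: left_module R M by fact
    obtain X :: "'x set" where X: "retract R (P 0) (free_lmod X R)" using proj by blast
    have "x \<ominus>\<^bsub>P 0\<^esub> \<psi> 0 x \<in> d 0 ` carrier (P (Suc 0))" if x: "x \<in> carrier (P 0)" for x
      unfolding PD(5) using x pc[OF x] lmod_hom_closed[OF PD(2) x]
      by (simp add: lmod_hom_minus[OF PD(1) M PD(2)] \<psi>0 M.M.minus_eq_zero_iff)
    then obtain h where h: "h \<in> lmod_hom R (P 0) (P (Suc 0))" "\<forall>x \<in> carrier (P 0). d 0 (h x) = x \<ominus>\<^bsub>P 0\<^esub> \<psi> 0 x"
      using projective_lift[OF PD(1) PD(1) PD(1) X PD(3)[of 0] lmod_hom_diff[OF PD(1) lmod_hom_ident \<psi>]]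
      by (auto simp: image_subset_iff)
    have "I 0 h"
      by (rule I) (use h dd in auto)
    then show "\<exists>h. I 0 h" by (rule exI[of "I 0"])
  next
    fix h j assume Ih: "I j h"
    have h: "h \<in> lmod_hom R (P j) (P (Suc j))" using Ih by (simp add: I_def)
    interpret Ps: left_module R "P (Suc j)" by (rule PD(1))
    obtain X :: "'x set" where X: "retract R (P (Suc j)) (free_lmod X R)" using proj by blast
    obtain k where k: "k \<in> lmod_hom R (P (Suc j)) (P (Suc (Suc j)))"
      "\<forall>x \<in> carrier (P (Suc j)). d (Suc j) (k x) = x \<ominus>\<^bsub>P (Suc j)\<^esub> \<psi> (Suc j) x \<ominus>\<^bsub>P (Suc j)\<^esub> h (d j x)"
      using projective_lift[OF PD(1) PD(1) PD(1) X PD(3)[of "Suc j"]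
          lmod_hom_diff[OF PD(1) lmod_hom_diff[OF PD(1) lmod_hom_ident \<psi>] lmod_hom_compose[OF PD(3) h]]] Ih
      by (auto simp: I_def image_subset_iff)
    have "I (Suc j) k"
    proof (rule I[OF k(1)])
      fix y assume "y \<in> d (Suc j) ` carrier (P (Suc (Suc j)))"
      then have y: "y \<in> carrier (P (Suc j))" "d j y = \<zero>\<^bsub>P j\<^esub>"
        by (simp_all add: PD(6))
      then show "d (Suc j) (k y) = y \<ominus>\<^bsub>P (Suc j)\<^esub> \<psi> (Suc j) y"
        using k(2) pc[OF y(1)] lmod_hom_zero[OF PD(1) PD(1) h] by (simp add: Ps.M.minus_eq)
    qed
    with k(2) show "\<exists>k. I (Suc j) k \<and> (\<forall>x \<in> carrier (P (Suc j)).
        d (Suc j) (k x) = x \<ominus>\<^bsub>P (Suc j)\<^esub> \<psi> (Suc j) x \<ominus>\<^bsub>P (Suc j)\<^esub> h (d j x))"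
      by blast
  qed
  then show ?thesis
    unfolding I_def by metis
qed

text \<open>With comparison maps f, g and 1 - g f = d h + h d, a cocycle c satisfies c = c g f + c h
  d. Here c g is a cocycle on Q, hence of the form b d', and so c is the coboundary of b f + c h.
  Exchanging P and Q gives the converse, so \<open>hom_exact\<close> depends neither on the
  resolution nor on its type.\<close>

lemma hom_exact_transfer:
  assumes M: "left_module R M" and N: "left_module R N"
    and P: "resolution R P d \<epsilon> M" and projP: "\<And>j. \<exists>X :: 'x set. retract R (P j) (free_lmod X R)"
    and Q: "resolution R Q d' \<epsilon>' M" and projQ: "\<And>j. \<exists>X :: 'y set. retract R (Q j) (free_lmod X R)"
    and ex: "hom_exact R Q d' N i"
  shows "hom_exact R P d N i"
proof -
  note PD = resolutionD[OF P] and QD = resolutionD[OF Q]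
  interpret N: left_module R N by fact
  obtain f where f: "\<And>j. f j \<in> lmod_hom R (P j) (Q j)"
    "\<And>x. x \<in> carrier (P 0) \<Longrightarrow> \<epsilon>' (f 0 x) = \<epsilon> x"
    "\<And>j x. x \<in> carrier (P (Suc j)) \<Longrightarrow> d' j (f (Suc j) x) = f j (d j x)"
    using chain_map_exists[OF M P projP Q] by blast
  obtain g where g: "\<And>j. g j \<in> lmod_hom R (Q j) (P j)"
    "\<And>x. x \<in> carrier (Q 0) \<Longrightarrow> \<epsilon> (g 0 x) = \<epsilon>' x"
    "\<And>j x. x \<in> carrier (Q (Suc j)) \<Longrightarrow> d j (g (Suc j) x) = g j (d' j x)"
    using chain_map_exists[OF M Q projQ P] by blast
  obtain h where h: "\<And>j. h j \<in> lmod_hom R (P j) (P (Suc j))"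
    "\<And>j x. x \<in> carrier (P (Suc j)) \<Longrightarrow>
      d (Suc j) (h (Suc j) x) = x \<ominus>\<^bsub>P (Suc j)\<^esub> g (Suc j) (f (Suc j) x) \<ominus>\<^bsub>P (Suc j)\<^esub> h j (d j x)"
    using chain_homotopy_exists[OF M P projP lmod_hom_compose[OF f(1) g(1)]]
    by (metis f g lmod_hom_closed)
  show ?thesis
    unfolding hom_exact_def
  proof (intro ballI impI)
    fix c assume c: "c \<in> lmod_hom R (P (Suc i)) N"
      and cz: "\<forall>x \<in> carrier (P (Suc (Suc i))). c (d (Suc i) x) = \<zero>\<^bsub>N\<^esub>"
    have "\<forall>x \<in> carrier (Q (Suc (Suc i))). c (g (Suc i) (d' (Suc i) x)) = \<zero>\<^bsub>N\<^esub>"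
      using cz g(3)[symmetric] lmod_hom_closed[OF g(1)] by simp
    then obtain b where b: "b \<in> lmod_hom R (Q i) N"
      "\<And>x. x \<in> carrier (Q (Suc i)) \<Longrightarrow> c (g (Suc i) x) = b (d' i x)"
      using ex[unfolded hom_exact_def, rule_format, OF lmod_hom_compose[OF g(1) c]] by auto
    let ?b = "\<lambda>x. c (h i x) \<oplus>\<^bsub>N\<^esub> b (f i x)"
    have "?b \<in> lmod_hom R (P i) N"
      by (rule lmod_hom_plus[OF N lmod_hom_compose[OF h(1) c] lmod_hom_compose[OF f(1) b(1)]])
    moreover have "c x = ?b (d i x)" if x: "x \<in> carrier (P (Suc i))" for x
    proof -
      interpret Ps: left_module R "P (Suc i)" by (rule PD(1))
      have dx: "d i x \<in> carrier (P i)" by (rule lmod_hom_closed[OF PD(3) x])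
      have fx: "f (Suc i) x \<in> carrier (Q (Suc i))" by (rule lmod_hom_closed[OF f(1) x])
      have gfx: "g (Suc i) (f (Suc i) x) \<in> carrier (P (Suc i))" by (rule lmod_hom_closed[OF g(1) fx])
      have hdx: "h i (d i x) \<in> carrier (P (Suc i))" by (rule lmod_hom_closed[OF h(1) dx])
      have hx: "h (Suc i) x \<in> carrier (P (Suc (Suc i)))" by (rule lmod_hom_closed[OF h(1) x])
      note cm = lmod_hom_minus[OF PD(1) N c]
      have "c x \<ominus>\<^bsub>N\<^esub> c (g (Suc i) (f (Suc i) x)) \<ominus>\<^bsub>N\<^esub> c (h i (d i x)) = \<zero>\<^bsub>N\<^esub>"
        using bspec[OF cz hx] x gfx hdx by (simp add: h(2) cm)
      then have "c x = c (h i (d i x)) \<oplus>\<^bsub>N\<^esub> c (g (Suc i) (f (Suc i) x))"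
        using lmod_hom_closed[OF c] x gfx hdx
        by (simp add: N.M.minus_eq_zero_iff)
          (metis N.M.add.inv_closed N.M.a_assoc N.M.l_neg N.M.minus_eq N.M.r_zero)
      also have "c (g (Suc i) (f (Suc i) x)) = b (f i (d i x))"
        using b(2)[OF fx] f(3)[OF x] by simp
      finally show ?thesis .
    qed
    ultimately show "\<exists>b \<in> lmod_hom R (P i) N. \<forall>x \<in> carrier (P (Suc i)). c x = b (d i x)"
      by (intro bexI[of _ ?b] ballI)
  qed
qed

section \<open>Vanishing of Ext\<close>

text \<open>\<open>lmod_hom\<close> ignores values off the carrier, while elements of
  \<open>Hom_group\<close> are extensional; restriction passes from one to the other.\<close>

lemma restrict_in_Hom_group:
  assumes "left_module R M" "f \<in> lmod_hom R M N"
  shows "restrict f (carrier M) \<in> carrier (Hom_group R M N)"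
proof -
  interpret left_module R M by fact
  show ?thesis
    using assms(2) by (auto simp: Hom_group_def lmod_hom_def)
qed

text \<open>Closure under differences yields inverses as 0 - f and sums as f - (0 - g). Z will be
  the set of cocycles.\<close>

lemma Hom_subgroup:
  assumes M: "left_module R M" and N: "left_module R N"
    and sub: "Z \<subseteq> carrier (Hom_group R M N)"
    and zero: "(\<lambda>x\<in>carrier M. \<zero>\<^bsub>N\<^esub>) \<in> Z"
    and diff: "\<And>f g. \<lbrakk>f \<in> Z; g \<in> Z\<rbrakk> \<Longrightarrow> (\<lambda>x\<in>carrier M. f x \<ominus>\<^bsub>N\<^esub> g x) \<in> Z"
  shows "comm_group ((Hom_group R M N)\<lparr>carrier := Z\<rparr>)"
    and "f \<in> Z \<Longrightarrow> inv\<^bsub>(Hom_group R M N)\<lparr>carrier := Z\<rparr>\<^esub> f = (\<lambda>x\<in>carrier M. \<ominus>\<^bsub>N\<^esub> f x)"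
proof -
  interpret M: left_module R M by fact
  interpret N: left_module R N by fact
  let ?G = "(Hom_group R M N)\<lparr>carrier := Z\<rparr>"
  have Z: "f x \<in> carrier N" "f \<in> extensional (carrier M)" if "f \<in> Z" "x \<in> carrier M" for f x
    using sub that by (auto simp: Hom_group_def lmod_hom_def)
  have neg: "(\<lambda>x\<in>carrier M. \<ominus>\<^bsub>N\<^esub> f x) \<in> Z" if "f \<in> Z" for f
    using diff[OF zero that] Z[OF that] by (simp add: N.M.minus_eq cong: restrict_cong)
  have plus: "(\<lambda>x\<in>carrier M. f x \<oplus>\<^bsub>N\<^esub> g x) \<in> Z" if "f \<in> Z" "g \<in> Z" for f g
    using diff[OF that(1) neg[OF that(2)]] Z[OF that(1)] Z[OF that(2)]
    by (simp add: N.M.minus_eq cong: restrict_cong)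
  have linv: "(\<lambda>x\<in>carrier M. \<ominus>\<^bsub>N\<^esub> f x) \<otimes>\<^bsub>?G\<^esub> f = \<one>\<^bsub>?G\<^esub>" if "f \<in> Z" for f
    using Z[OF that] by (auto simp: Hom_group_def N.M.l_neg)
  show G: "comm_group ?G"
  proof (rule comm_groupI, goal_cases)
    case (3 f g h)
    then show ?case using Z[of f] Z[of g] Z[of h] by (auto simp: Hom_group_def N.M.a_assoc)
  next
    case (4 f g)
    then show ?case using Z[of f] Z[of g] by (auto simp: Hom_group_def N.M.a_comm)
  next
    case (5 f)
    then have "f \<in> extensional (carrier M)" using Z(2) M.M.zero_closed by auto
    with 5 show ?case
      using Z[of f] by (auto simp: Hom_group_def fun_eq_iff extensional_def)
  next
    case (6 f)
    then show ?case using neg linv by fastforce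
  qed (use zero plus in \<open>auto simp: Hom_group_def\<close>)
  interpret G: comm_group ?G by fact
  show "inv\<^bsub>?G\<^esub> f = (\<lambda>x\<in>carrier M. \<ominus>\<^bsub>N\<^esub> f x)" if "f \<in> Z"
    using G.inv_equality[OF linv[OF that]] that neg by simp
qed

text \<open>The quotient is trivial exactly if every cocycle is a coboundary. What remains is the
  passage between extensional maps and elements of \<open>lmod_hom\<close>. In degree
  \<open>Suc i\<close> the coboundaries come from \<open>P i\<close>, which is why the index is
  shifted.\<close>

lemma trivial_Hom_cohomology_iff:
  assumes P: "\<And>j. left_module R (P j)" and d: "\<And>j. d j \<in> lmod_hom R (P (Suc j)) (P j)"
    and dd: "\<And>j x. x \<in> carrier (P (Suc (Suc j))) \<Longrightarrow> d j (d (Suc j) x) = \<zero>\<^bsub>P j\<^esub>"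
    and N: "left_module R N"
  shows "trivial_group (Hom_cohomology R P d N (Suc i)) \<longleftrightarrow> hom_exact R P d N i"
proof -
  interpret N: left_module R N by fact
  interpret P0: left_module R "P i" by (rule P)
  interpret P1: left_module R "P (Suc i)" by (rule P)
  define Z where "Z = cocycles R P d N (Suc i)"
  define B where "B = coboundaries R P d N (Suc i)"
  define G where "G = (Hom_group R (P (Suc i)) N)\<lparr>carrier := Z\<rparr>"
  note dc = lmod_hom_closed[OF d]
  have Z: "c \<in> Z \<longleftrightarrow> c \<in> lmod_hom R (P (Suc i)) N \<and> c \<in> extensional (carrier (P (Suc i))) \<and>
      (\<forall>x \<in> carrier (P (Suc (Suc i))). c (d (Suc i) x) = \<zero>\<^bsub>N\<^esub>)" for c
    by (auto simp: Z_def cocycles_def Hom_group_def)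
  have restr: "restrict f (carrier (P j)) \<in> lmod_hom R (P j) N" if "f \<in> lmod_hom R (P j) N" for f j
    using restrict_in_Hom_group[OF P that] by (simp add: Hom_group_def)
  \<comment> \<open>Restricting b to its carrier does not change its composite with d, because d
    maps into that carrier; so b may range over all of \<open>lmod_hom\<close>.\<close>
  have B: "c \<in> B \<longleftrightarrow> (\<exists>b \<in> lmod_hom R (P i) N. c = (\<lambda>x\<in>carrier (P (Suc i)). b (d i x)))" for c
  proof
    assume "\<exists>b \<in> lmod_hom R (P i) N. c = (\<lambda>x\<in>carrier (P (Suc i)). b (d i x))"
    then obtain b where b: "b \<in> lmod_hom R (P i) N" "c = (\<lambda>x\<in>carrier (P (Suc i)). b (d i x))" by blast
    then have "c = (\<lambda>x\<in>carrier (P (Suc i)). restrict b (carrier (P i)) (d i x))"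
      using dc by (auto simp: fun_eq_iff)
    then show "c \<in> B"
      unfolding B_def coboundaries.simps using restrict_in_Hom_group[OF P b(1)] by blast
  qed (auto simp: B_def Hom_group_def)
  have BI: "(\<lambda>x\<in>carrier (P (Suc i)). b (d i x)) \<in> B" if "b \<in> lmod_hom R (P i) N" for b
    unfolding B by (rule bexI[OF refl that])
  have Z_Hom: "Z \<subseteq> carrier (Hom_group R (P (Suc i)) N)"
    by (auto simp: Z_def cocycles_def)
  have Z_zero: "(\<lambda>x\<in>carrier (P (Suc i)). \<zero>\<^bsub>N\<^esub>) \<in> Z"
    using restr[OF lmod_hom_zero_map[OF N]] dc by (auto simp: Z)
  have Z_diff: "(\<lambda>x\<in>carrier (P (Suc i)). f x \<ominus>\<^bsub>N\<^esub> g x) \<in> Z" if "f \<in> Z" "g \<in> Z" for f g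
    using that restr[OF lmod_hom_diff[OF N, of f "P (Suc i)" g]] dc by (auto simp: Z N.M.minus_eq)
  have G: "comm_group G" "\<And>f. f \<in> Z \<Longrightarrow> inv\<^bsub>G\<^esub> f = (\<lambda>x\<in>carrier (P (Suc i)). \<ominus>\<^bsub>N\<^esub> f x)"
    unfolding G_def by (rule Hom_subgroup[OF P N Z_Hom Z_zero]; use Z_diff in blast)+
  interpret G: comm_group G by (rule G(1))
  have BZ: "B \<subseteq> Z"
  proof
    fix c assume "c \<in> B"
    then obtain b where b: "b \<in> lmod_hom R (P i) N" "c = (\<lambda>x\<in>carrier (P (Suc i)). b (d i x))"
      using B by blast
    then show "c \<in> Z"
      using restr[OF lmod_hom_compose[OF d b(1)]] dc by (auto simp: Z dd lmod_hom_zero[OF P N b(1)])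
  qed
  have sB: "subgroup B G"
  proof (rule G.subgroupI)
    show "B \<subseteq> carrier G" using BZ by (simp add: G_def)
    show "B \<noteq> {}" using BI[OF lmod_hom_zero_map[OF N]] by blast
  next
    fix c assume c: "c \<in> B"
    then obtain b where b: "b \<in> lmod_hom R (P i) N" "c = (\<lambda>x\<in>carrier (P (Suc i)). b (d i x))"
      using B by blast
    have "inv\<^bsub>G\<^esub> c = (\<lambda>x\<in>carrier (P (Suc i)). \<zero>\<^bsub>N\<^esub> \<ominus>\<^bsub>N\<^esub> b (d i x))"
      using G(2)[OF subsetD[OF BZ c]] b(2) dc lmod_hom_closed[OF b(1)]
      by (simp add: N.M.minus_eq cong: restrict_cong)
    then show "inv\<^bsub>G\<^esub> c \<in> B"
      using BI[OF lmod_hom_diff[OF N lmod_hom_zero_map[OF N] b(1)]] by simp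
  next
    fix c c' assume "c \<in> B" "c' \<in> B"
    then obtain b b' where b: "b \<in> lmod_hom R (P i) N" "c = (\<lambda>x\<in>carrier (P (Suc i)). b (d i x))"
      and b': "b' \<in> lmod_hom R (P i) N" "c' = (\<lambda>x\<in>carrier (P (Suc i)). b' (d i x))"
      using B by meson
    have "c \<otimes>\<^bsub>G\<^esub> c' = (\<lambda>x\<in>carrier (P (Suc i)). b (d i x) \<oplus>\<^bsub>N\<^esub> b' (d i x))"
      by (auto simp: G_def Hom_group_def b b')
    then show "c \<otimes>\<^bsub>G\<^esub> c' \<in> B"
      using BI[OF lmod_hom_plus[OF N b(1) b'(1)]] by simp
  qed
  have cohom: "Hom_cohomology R P d N (Suc i) = G Mod B"
    by (simp add: Hom_cohomology_def G_def Z_def B_def)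
  have "trivial_group (G Mod B) \<longleftrightarrow> Z \<subseteq> B"
  proof
    assume "Z \<subseteq> B"
    then have BG: "B = carrier G" using BZ by (simp add: G_def)
    have "B #>\<^bsub>G\<^esub> c = B" if "c \<in> carrier G" for c
      by (rule G.coset_join2[OF that sB]) (use that BG in simp)
    then have "carrier (G Mod B) = {B}"
      using G.one_closed by (auto simp: FactGroup_def RCOSETS_def)
    then show "trivial_group (G Mod B)"
      using normal.factorgroup_is_group[OF G.subgroup_imp_normal[OF sB]]
      by (simp add: trivial_group_def FactGroup_def)
  next
    assume t: "trivial_group (G Mod B)"
    show "Z \<subseteq> B"
    proof
      fix c assume "c \<in> Z"
      then have c: "c \<in> carrier G" by (simp add: G_def)
      then have "B #>\<^bsub>G\<^esub> c \<in> carrier (G Mod B)"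
        by (auto simp: FactGroup_def RCOSETS_def)
      then have "B #>\<^bsub>G\<^esub> c = B"
        using t by (simp add: trivial_group_def FactGroup_def)
      then show "c \<in> B"
        using G.rcos_self[OF c sB] by simp
    qed
  qed
  also have "\<dots> \<longleftrightarrow> hom_exact R P d N i"
  proof
    assume ZB: "Z \<subseteq> B"
    show "hom_exact R P d N i"
      unfolding hom_exact_def
    proof (intro ballI impI)
      fix c assume c: "c \<in> lmod_hom R (P (Suc i)) N" "\<forall>x \<in> carrier (P (Suc (Suc i))). c (d (Suc i) x) = \<zero>\<^bsub>N\<^esub>"
      have "restrict c (carrier (P (Suc i))) \<in> Z"
        using restr[OF c(1)] c(2) dc by (auto simp: Z)
      then obtain b where b: "b \<in> lmod_hom R (P i) N"
        "restrict c (carrier (P (Suc i))) = (\<lambda>x\<in>carrier (P (Suc i)). b (d i x))"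
        using ZB B by blast
      then show "\<exists>b \<in> lmod_hom R (P i) N. \<forall>x \<in> carrier (P (Suc i)). c x = b (d i x)"
        using fun_cong[OF b(2)] by (intro bexI[OF _ b(1)] ballI) (metis restrict_apply')
    qed
  next
    assume ex: "hom_exact R P d N i"
    show "Z \<subseteq> B"
    proof
      fix c assume c: "c \<in> Z"
      then obtain b where b: "b \<in> lmod_hom R (P i) N" "\<forall>x \<in> carrier (P (Suc i)). c x = b (d i x)"
        using ex unfolding hom_exact_def Z by blast
      have "c = (\<lambda>x\<in>carrier (P (Suc i)). b (d i x))"
        using c b(2) by (auto simp: Z fun_eq_iff extensional_def)
      then show "c \<in> B" using BI[OF b(1)] by simp
    qed
  qed
  finally show ?thesis by (simp add: cohom)
qed

text \<open>This frees \<open>Ext\<close> from its chosen resolution. Any index type is allowed for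
  the free modules, which admits induced resolutions, whose terms do not live on the type of the
  chosen one.\<close>

lemma trivial_Ext_iff:
  assumes M: "left_module R M" and N: "left_module R N"
    and P: "resolution R P d \<epsilon> M" and proj: "\<And>j. \<exists>X :: 'x set. retract R (P j) (free_lmod X R)"
  shows "trivial_group (Ext R (Suc i) M N) \<longleftrightarrow> hom_exact R P d N i"
proof -
  obtain Q d' where c: "chosen_resolution R M = (Q, d')" by (meson surj_pair)
  obtain \<epsilon>' where "projective_resolution R Q d' \<epsilon>' M"
    using chosen_resolution[OF M c] by blast
  then have Q: "resolution R Q d' \<epsilon>' M"
    and "\<And>j. projective_lmod R (Q j)"
    by (auto simp: projective_resolution_def)
  note projQ = projective_lmodD(2)[OF this(2)]
  note QD = resolutionD[OF Q]
  have "d' j (d' (Suc j) x) = \<zero>\<^bsub>Q j\<^esub>" if "x \<in> carrier (Q (Suc (Suc j)))" for j x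
    using QD(6) that by blast
  from trivial_Hom_cohomology_iff[where P = Q and d = d', OF QD(1) QD(3) this N]
  have "trivial_group (Ext R (Suc i) M N) \<longleftrightarrow> hom_exact R Q d' N i"
    by (simp add: Ext_def c)
  also have "\<dots> \<longleftrightarrow> hom_exact R P d N i"
    using hom_exact_transfer[OF M N P proj Q projQ] hom_exact_transfer[OF M N Q projQ P proj] by blast
  finally show ?thesis .
qed

section \<open>Transport of resolutions along isomorphisms\<close>

lemma lmod_inversesD:
  assumes "lmod_inverses R M N h k"
  shows "h \<in> lmod_hom R M N" "k \<in> lmod_hom R N M"
    "x \<in> carrier M \<Longrightarrow> k (h x) = x" "y \<in> carrier N \<Longrightarrow> h (k y) = y"
    "x \<in> carrier M \<Longrightarrow> h x \<in> carrier N" "y \<in> carrier N \<Longrightarrow> k y \<in> carrier M"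
  using assms by (auto simp: lmod_inverses_def lmod_hom_def)

lemma lmod_inverses_image:
  assumes "lmod_inverses R M N h k" shows "k ` carrier N = carrier M" "h ` carrier M = carrier N"
proof -
  note L = lmod_inversesD[OF assms]
  show "k ` carrier N = carrier M"
    using L(3,5,6) by (auto simp: image_iff) (metis L(3) L(5))
  show "h ` carrier M = carrier N"
    using L(4,5,6) by (auto simp: image_iff) (metis L(4) L(6))
qed

lemma lmod_inverses_zero_iff:
  assumes M: "left_module R M" and N: "left_module R N" and hk: "lmod_inverses R M N h k"
    and x: "x \<in> carrier M"
  shows "h x = \<zero>\<^bsub>N\<^esub> \<longleftrightarrow> x = \<zero>\<^bsub>M\<^esub>"
  using lmod_inversesD[OF hk] x lmod_hom_zero[OF M N, of h] lmod_hom_zero[OF N M, of k] by metis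

lemma lmod_inverses_kernel:
  assumes M: "left_module R M" and N: "left_module R N" and L: "left_module R L" and L': "left_module R L'"
    and hk: "lmod_inverses R M N h k" and hk': "lmod_inverses R L L' h' k'" and f: "f \<in> lmod_hom R M L"
  shows "a_kernel N L' (\<lambda>y. h' (f (k y))) = h ` a_kernel M L f"
proof -
  note D = lmod_inversesD[OF hk] and fc = lmod_hom_closed[OF f]
  note z = lmod_inverses_zero_iff[OF L L' hk']
  have "y \<in> h ` a_kernel M L f" if "y \<in> carrier N" "f (k y) = \<zero>\<^bsub>L\<^esub>" for y
    using that D(4,6) by (intro image_eqI[of _ _ "k y"]) (auto simp: a_kernel_iff)
  then show ?thesis
    using lmod_hom_zero[OF L L' lmod_inversesD(1)[OF hk']] by (auto simp: a_kernel_iff D z fc)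
qed

lemma resolution_transport:
  assumes M: "left_module R M" and P: "resolution R P d \<epsilon> M"
    and P': "\<And>j. left_module R (P' j)" and hk: "\<And>j. lmod_inverses R (P j) (P' j) (h j) (k j)"
  shows "resolution R P' (\<lambda>j y. h j (d j (k (Suc j) y))) (\<lambda>y. \<epsilon> (k 0 y)) M"
proof -
  note PD = resolutionD[OF P] and D = lmod_inversesD[OF hk] and im = lmod_inverses_image[OF hk]
  have "lmod_inverses R M M (\<lambda>x. x) (\<lambda>x. x)"
    by (simp add: lmod_inverses_def lmod_hom_ident)
  note ker0 = lmod_inverses_kernel[OF PD(1) P' M M hk this PD(2)]
  note ker = lmod_inverses_kernel[OF PD(1) P' PD(1) P' hk hk PD(3)]
  have d: "d 0 ` carrier (P 1) = a_kernel (P 0) M \<epsilon>"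
    "d (Suc j) ` carrier (P (Suc (Suc j))) = a_kernel (P (Suc j)) (P j) (d j)" for j
    using P by (simp_all add: resolution_def)
  have img: "(\<lambda>y. h j (d j (k (Suc j) y))) ` carrier (P' (Suc j)) = h j ` d j ` carrier (P (Suc j))" for j
    using im(1)[of "Suc j"] by (simp add: image_image flip: im(1))
  show ?thesis
    unfolding resolution_def
  proof (intro conjI allI P')
    show "(\<lambda>y. \<epsilon> (k 0 y)) \<in> lmod_hom R (P' 0) M"
      by (rule lmod_hom_compose[OF D(2) PD(2)])
    show "(\<lambda>y. h j (d j (k (Suc j) y))) \<in> lmod_hom R (P' (Suc j)) (P' j)" for j
      by (rule lmod_hom_compose[OF lmod_hom_compose[OF D(2) PD(3)] D(1)])
    show "(\<lambda>y. \<epsilon> (k 0 y)) ` carrier (P' 0) = carrier M"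
      using im(1)[of 0] PD(4) by (metis image_image)
    show "(\<lambda>y. h 0 (d 0 (k (Suc 0) y))) ` carrier (P' 1) = a_kernel (P' 0) M (\<lambda>y. \<epsilon> (k 0 y))"
      using img[of 0] d(1) ker0 by simp
    show "(\<lambda>y. h (Suc j) (d (Suc j) (k (Suc (Suc j)) y))) ` carrier (P' (Suc (Suc j))) =
        a_kernel (P' (Suc j)) (P' j) (\<lambda>y. h j (d j (k (Suc j) y)))" for j
      unfolding img ker d(2) ..
  qed
qed

lemma coresolutionD:
  assumes "coresolution R M \<eta> Q d"
  shows "left_module R (Q j)" "\<eta> \<in> lmod_hom R M (Q 0)" "d j \<in> lmod_hom R (Q j) (Q (Suc j))"
    "inj_on \<eta> (carrier M)"
    "\<eta> ` carrier M = a_kernel (Q 0) (Q 1) (d 0)"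
    "d j ` carrier (Q j) = a_kernel (Q (Suc j)) (Q (Suc (Suc j))) (d (Suc j))"
  using assms by (simp_all add: coresolution_def)

text \<open>The source is replaced as well, along a and b: induction yields a coresolution of A
  \<otimes> R, whereas \<open>tilting\<close> demands one of the regular module of A.\<close>

lemma coresolution_transport:
  assumes Q: "coresolution R M \<eta> Q d" and ab: "lmod_inverses R M' M a b"
    and Q': "\<And>j. left_module R (Q' j)" and hk: "\<And>j. lmod_inverses R (Q j) (Q' j) (h j) (k j)"
  shows "coresolution R M' (\<lambda>x. h 0 (\<eta> (a x))) Q' (\<lambda>j y. h (Suc j) (d j (k j y)))"
proof -
  note QD = coresolutionD[OF Q] and D = lmod_inversesD[OF hk] and im = lmod_inverses_image[OF hk]
    and aD = lmod_inversesD[OF ab] and aim = lmod_inverses_image[OF ab]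
  note ker = lmod_inverses_kernel[OF QD(1) Q' QD(1) Q' hk hk QD(3)]
  have img: "(\<lambda>y. h (Suc j) (d j (k j y))) ` carrier (Q' j) = h (Suc j) ` d j ` carrier (Q j)" for j
    using im(1)[of j] by (simp add: image_image flip: im(1))
  show ?thesis
    unfolding coresolution_def
  proof (intro conjI allI Q')
    show "(\<lambda>x. h 0 (\<eta> (a x))) \<in> lmod_hom R M' (Q' 0)"
      by (rule lmod_hom_compose[OF lmod_hom_compose[OF aD(1) QD(2)] D(1)])
    show "(\<lambda>y. h (Suc j) (d j (k j y))) \<in> lmod_hom R (Q' j) (Q' (Suc j))" for j
      by (rule lmod_hom_compose[OF lmod_hom_compose[OF D(2) QD(3)] D(1)])
    show "inj_on (\<lambda>x. h 0 (\<eta> (a x))) (carrier M')"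
    proof (rule inj_onI)
      fix x y assume x: "x \<in> carrier M'" and y: "y \<in> carrier M'" and eq: "h 0 (\<eta> (a x)) = h 0 (\<eta> (a y))"
      note ax = aD(5)[OF x] and ay = aD(5)[OF y]
      have "\<eta> (a x) = \<eta> (a y)"
        using arg_cong[OF eq, of "k 0"] D(3)[OF lmod_hom_closed[OF QD(2) ax]] D(3)[OF lmod_hom_closed[OF QD(2) ay]]
        by simp
      then have "a x = a y"
        using inj_onD[OF QD(4) _ ax ay] by blast
      then have "b (a x) = b (a y)" by simp
      then show "x = y"
        unfolding aD(3)[OF x] aD(3)[OF y] .
    qed
    show "(\<lambda>x. h 0 (\<eta> (a x))) ` carrier M' = a_kernel (Q' 0) (Q' 1) (\<lambda>y. h (Suc 0) (d 0 (k 0 y)))"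
    proof -
      have "(\<lambda>x. h 0 (\<eta> (a x))) ` carrier M' = h 0 ` \<eta> ` a ` carrier M'"
        by (simp only: image_image)
      then show ?thesis
        unfolding aim(2) QD(5) using ker[of 0] by simp
    qed
    show "(\<lambda>y. h (Suc j) (d j (k j y))) ` carrier (Q' j) =
        a_kernel (Q' (Suc j)) (Q' (Suc (Suc j))) (\<lambda>y. h (Suc (Suc j)) (d (Suc j) (k (Suc j) y)))" for j
      unfolding img ker QD(6) ..
  qed
qed

section \<open>Induced modules\<close>

lemma carrier_restrict_scalars [simp]: "carrier (restrict_scalars \<iota> M) = carrier M"
  and zero_restrict_scalars [simp]: "\<zero>\<^bsub>restrict_scalars \<iota> M\<^esub> = \<zero>\<^bsub>M\<^esub>"
  and add_restrict_scalars [simp]: "x \<oplus>\<^bsub>restrict_scalars \<iota> M\<^esub> y = x \<oplus>\<^bsub>M\<^esub> y"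
  and smult_restrict_scalars [simp]: "r \<odot>\<^bsub>restrict_scalars \<iota> M\<^esub> x = \<iota> r \<odot>\<^bsub>M\<^esub> x"
  by (simp_all add: restrict_scalars_def)

locale ring_extension = R: ring R + A: ring A
  for R :: "'r ring" and A :: "'a ring" +
  fixes \<iota> :: "'r \<Rightarrow> 'a"
  assumes \<iota>: "\<iota> \<in> ring_hom R A"
begin

lemma \<iota>_closed [simp]: "r \<in> carrier R \<Longrightarrow> \<iota> r \<in> carrier A"
  by (rule ring_hom_closed[OF \<iota>])

lemma left_module_restrict_scalars:
  assumes "left_module A M" shows "left_module R (restrict_scalars \<iota> M)"
proof -
  interpret M: left_module A M by fact
  have "abelian_group (restrict_scalars \<iota> M)"
    by (rule abelian_groupI) (auto simp: M.M.a_ac intro: bexI[of _ "\<ominus>\<^bsub>M\<^esub> x" for x] M.M.l_neg)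
  then show ?thesis
    by (intro left_module.intro left_module_axioms.intro R.ring_axioms)
      (auto simp: ring_hom_add[OF \<iota>] ring_hom_mult[OF \<iota>] ring_hom_one[OF \<iota>]
        M.smult_l_distr M.smult_r_distr M.smult_assoc1)
qed

section \<open>The coset construction of A \<otimes> M, its universal property and its module
  structure\<close>

abbreviation Ind :: "('r, 'm) module \<Rightarrow> ('a, (('a \<times> 'm) \<Rightarrow>\<^sub>0 int) set) module" where
  "Ind M \<equiv> induced_module R A \<iota> M"

abbreviation frags :: "('r, 'm) module \<Rightarrow> (('a \<times> 'm) \<Rightarrow>\<^sub>0 int) monoid" where
  "frags M \<equiv> free_Abelian_group (carrier A \<times> carrier M)"

abbreviation relations :: "('r, 'm) module \<Rightarrow> (('a \<times> 'm) \<Rightarrow>\<^sub>0 int) set" where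
  "relations M \<equiv> generate (frags M) (tensor_relators R A \<iota> M)"

abbreviation scale_frag :: "'a \<Rightarrow> (('a \<times> 'm) \<Rightarrow>\<^sub>0 int) \<Rightarrow> (('a \<times> 'm) \<Rightarrow>\<^sub>0 int)" where
  "scale_frag a \<equiv> frag_extend (\<lambda>(b, t). frag_of (a \<otimes>\<^bsub>A\<^esub> b, t))"

text \<open>The pure tensor a \<otimes> x. Once the module structure is set up, cosets are no longer
  touched and all arguments go through these elements.\<close>

definition tensor :: "('r, 'm) module \<Rightarrow> 'a \<Rightarrow> 'm \<Rightarrow> (('a \<times> 'm) \<Rightarrow>\<^sub>0 int) set" where
  "tensor M a x = relations M #>\<^bsub>frags M\<^esub> frag_of (a, x)"

lemma diff_frag:
  assumes "Poly_Mapping.keys u \<subseteq> S" "Poly_Mapping.keys v \<subseteq> S"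
  shows "Poly_Mapping.keys (u - v) \<subseteq> S"
  using keys_diff[of u v] assms by blast

lemma tensor_relators_cases [consumes 1, case_names left right balanced]:
  assumes "u \<in> tensor_relators R A \<iota> M"
  obtains a b x where "u = frag_of (a \<oplus>\<^bsub>A\<^esub> b, x) - frag_of (a, x) - frag_of (b, x)"
      "a \<in> carrier A" "b \<in> carrier A" "x \<in> carrier M"
    | a x y where "u = frag_of (a, x \<oplus>\<^bsub>M\<^esub> y) - frag_of (a, x) - frag_of (a, y)"
      "a \<in> carrier A" "x \<in> carrier M" "y \<in> carrier M"
    | a r x where "u = frag_of (a \<otimes>\<^bsub>A\<^esub> \<iota> r, x) - frag_of (a, r \<odot>\<^bsub>M\<^esub> x)"
      "a \<in> carrier A" "r \<in> carrier R" "x \<in> carrier M"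
  using assms unfolding tensor_relators_def by blast

lemma tensor_relators_subset:
  assumes M: "left_module R M" shows "tensor_relators R A \<iota> M \<subseteq> carrier (frags M)"
proof
  interpret M: left_module R M by fact
  fix u assume "u \<in> tensor_relators R A \<iota> M"
  then have "Poly_Mapping.keys u \<subseteq> carrier A \<times> carrier M"
    by (cases rule: tensor_relators_cases) (simp_all add: diff_frag)
  then show "u \<in> carrier (frags M)" by simp
qed

lemma normal_relations:
  assumes M: "left_module R M" shows "relations M \<lhd> frags M"
proof -
  interpret F: comm_group "frags M" by (rule abelian_free_Abelian_group)
  show ?thesis
    by (rule F.subgroup_imp_normal[OF F.generate_is_subgroup[OF tensor_relators_subset[OF M]]])
qed

lemma Ind_Mod:
  "carrier (Ind M) = carrier (frags M Mod relations M)"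
  "z \<oplus>\<^bsub>Ind M\<^esub> w = z \<otimes>\<^bsub>frags M Mod relations M\<^esub> w"
  "\<zero>\<^bsub>Ind M\<^esub> = \<one>\<^bsub>frags M Mod relations M\<^esub>"
  by (simp_all add: induced_module_def Let_def)

lemma abelian_group_Ind:
  assumes M: "left_module R M" shows "abelian_group (Ind M)"
proof -
  interpret F: comm_group "frags M" by (rule abelian_free_Abelian_group)
  interpret N: normal "relations M" "frags M" by (rule normal_relations[OF M])
  interpret Q: comm_group "frags M Mod relations M"
    by (rule F.abelian_FactGroup[OF N.subgroup_axioms])
  show ?thesis
    by (rule abelian_groupI) (auto simp: Ind_Mod Q.m_ac simp del: mult_FactGroup one_FactGroup
        intro: bexI[of _ "inv\<^bsub>frags M Mod relations M\<^esub> x" for x])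
qed

lemma coset_hom:
  assumes M: "left_module R M"
  shows "(\<lambda>u. relations M #>\<^bsub>frags M\<^esub> u) \<in> hom (frags M) (add_monoid (Ind M))"
  using normal.r_coset_hom_Mod[OF normal_relations[OF M]] by (simp add: hom_def Ind_Mod)

lemma Ind_cases:
  assumes "z \<in> carrier (Ind M)"
  obtains u where "Poly_Mapping.keys u \<subseteq> carrier A \<times> carrier M" "z = relations M #>\<^bsub>frags M\<^esub> u"
  using assms unfolding induced_module_def Let_def FactGroup_def RCOSETS_def by auto

lemma tensor_closed [simp]:
  assumes M: "left_module R M" and "a \<in> carrier A" "x \<in> carrier M"
  shows "tensor M a x \<in> carrier (Ind M)"
  using hom_in_carrier[OF coset_hom[OF M], of "frag_of (a, x)"] assms by (simp add: tensor_def)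

lemma coset_eqI:
  assumes M: "left_module R M" and uv: "u - v \<in> relations M" and v: "Poly_Mapping.keys v \<subseteq> carrier A \<times> carrier M"
  shows "relations M #>\<^bsub>frags M\<^esub> u = relations M #>\<^bsub>frags M\<^esub> v"
proof -
  interpret N: normal "relations M" "frags M" by (rule normal_relations[OF M])
  have "u \<in> relations M #>\<^bsub>frags M\<^esub> v"
    unfolding r_coset_def using uv by (auto intro!: bexI[of _ "u - v"])
  then show ?thesis
    using N.repr_independence[OF _ _ N.subgroup_axioms] v by simp
qed

lemma
  assumes M: "left_module R M"
  shows tensor_add_left: "\<lbrakk>a \<in> carrier A; b \<in> carrier A; x \<in> carrier M\<rbrakk> \<Longrightarrow>
      tensor M (a \<oplus>\<^bsub>A\<^esub> b) x = tensor M a x \<oplus>\<^bsub>Ind M\<^esub> tensor M b x"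
    and tensor_add_right: "\<lbrakk>a \<in> carrier A; x \<in> carrier M; y \<in> carrier M\<rbrakk> \<Longrightarrow>
      tensor M a (x \<oplus>\<^bsub>M\<^esub> y) = tensor M a x \<oplus>\<^bsub>Ind M\<^esub> tensor M a y"
    and tensor_balanced: "\<lbrakk>a \<in> carrier A; r \<in> carrier R; x \<in> carrier M\<rbrakk> \<Longrightarrow>
      tensor M (a \<otimes>\<^bsub>A\<^esub> \<iota> r) x = tensor M a (r \<odot>\<^bsub>M\<^esub> x)"
proof -
  interpret M: left_module R M by fact
  have sum: "relations M #>\<^bsub>frags M\<^esub> (frag_of p + frag_of q) =
      (relations M #>\<^bsub>frags M\<^esub> frag_of p) \<oplus>\<^bsub>Ind M\<^esub> (relations M #>\<^bsub>frags M\<^esub> frag_of q)"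
    if "p \<in> carrier A \<times> carrier M" "q \<in> carrier A \<times> carrier M" for p q
    using hom_mult[OF coset_hom[OF M], of "frag_of p" "frag_of q"] that by simp
  have keys: "Poly_Mapping.keys (frag_of p + frag_of q) \<subseteq> carrier A \<times> carrier M"
    if "p \<in> carrier A \<times> carrier M" "q \<in> carrier A \<times> carrier M" for p q
    using keys_add[of "frag_of p" "frag_of q"] that by auto
  note rel = generate.incl[of _ "tensor_relators R A \<iota> M" "frags M"]
  show "tensor M (a \<oplus>\<^bsub>A\<^esub> b) x = tensor M a x \<oplus>\<^bsub>Ind M\<^esub> tensor M b x"
    if "a \<in> carrier A" "b \<in> carrier A" "x \<in> carrier M"
  proof -
    have "frag_of (a \<oplus>\<^bsub>A\<^esub> b, x) - (frag_of (a, x) + frag_of (b, x)) \<in> relations M"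
      using that by (intro rel) (auto simp: tensor_relators_def diff_diff_add[symmetric])
    from coset_eqI[OF M this keys] show ?thesis
      using that by (simp add: tensor_def sum)
  qed
  show "tensor M a (x \<oplus>\<^bsub>M\<^esub> y) = tensor M a x \<oplus>\<^bsub>Ind M\<^esub> tensor M a y"
    if "a \<in> carrier A" "x \<in> carrier M" "y \<in> carrier M"
  proof -
    have "frag_of (a, x \<oplus>\<^bsub>M\<^esub> y) - (frag_of (a, x) + frag_of (a, y)) \<in> relations M"
      using that by (intro rel) (auto simp: tensor_relators_def diff_diff_add[symmetric])
    from coset_eqI[OF M this keys] show ?thesis
      using that by (simp add: tensor_def sum)
  qed
  show "tensor M (a \<otimes>\<^bsub>A\<^esub> \<iota> r) x = tensor M a (r \<odot>\<^bsub>M\<^esub> x)"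
    if "a \<in> carrier A" "r \<in> carrier R" "x \<in> carrier M"
  proof -
    have "frag_of (a \<otimes>\<^bsub>A\<^esub> \<iota> r, x) - frag_of (a, r \<odot>\<^bsub>M\<^esub> x) \<in> relations M"
      using that by (intro rel) (auto simp: tensor_relators_def)
    from coset_eqI[OF M this] show ?thesis
      using that by (simp add: tensor_def)
  qed
qed

text \<open>Pure tensors generate the additive group. Additive maps are the right generality:
  multiplications by scalars are compared before \<open>Ind M\<close> is known to be a module, and
  coordinate maps of a dual basis end in R-modules.\<close>

lemma Ind_add_hom_eq:
  fixes N :: "('n, 'k) ring_scheme"
  assumes M: "left_module R M" and N: "abelian_group N"
    and f: "f \<in> add_hom (Ind M) N" and g: "g \<in> add_hom (Ind M) N"
    and eq: "\<And>a x. \<lbrakk>a \<in> carrier A; x \<in> carrier M\<rbrakk> \<Longrightarrow> f (tensor M a x) = g (tensor M a x)"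
    and z: "z \<in> carrier (Ind M)"
  shows "f z = g z"
proof -
  interpret N: abelian_group N by fact
  let ?q = "\<lambda>u. relations M #>\<^bsub>frags M\<^esub> u"
  have hom: "(\<lambda>u. h (?q u)) \<in> hom (frags M) (add_monoid N)" if "h \<in> add_hom (Ind M) N" for h
    using hom_compose[OF coset_hom[OF M] that[unfolded add_hom_def]] by (simp add: comp_def)
  interpret f: group_hom "frags M" "add_monoid N" "\<lambda>u. f (?q u)"
    by (intro group_hom.intro group_hom_axioms.intro hom[OF f] N.add.is_group group_free_Abelian_group)
  interpret g: group_hom "frags M" "add_monoid N" "\<lambda>u. g (?q u)"
    by (intro group_hom.intro group_hom_axioms.intro hom[OF g] N.add.is_group group_free_Abelian_group)
  from z obtain u where u: "Poly_Mapping.keys u \<subseteq> carrier A \<times> carrier M" "z = ?q u"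
    by (rule Ind_cases)
  from u(1) have "f (?q u) = g (?q u)"
  proof (induction u rule: free_Abelian_group_induct [consumes 1, case_names zero diff of])
    case zero
    then show ?case using f.hom_one g.hom_one by simp
  next
    case (diff x y)
    then have "f (?q (x - y)) = f (?q x) \<ominus>\<^bsub>N\<^esub> f (?q y)" "g (?q (x - y)) = g (?q x) \<ominus>\<^bsub>N\<^esub> g (?q y)"
      using f.hom_mult[of x "inv\<^bsub>frags M\<^esub> y"] f.hom_inv[of y]
        g.hom_mult[of x "inv\<^bsub>frags M\<^esub> y"] g.hom_inv[of y] by (simp_all add: N.minus_eq a_inv_def)
    with diff show ?case by simp
  next
    case (of p)
    then show ?case using eq by (auto simp: tensor_def)
  qed
  with u(2) show ?thesis by simp
qed

text \<open>\<beta> extends to the free abelian group on pairs; the three equations on \<beta> say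
  that the three kinds of relators go to zero, so the extension factors through the
  quotient.\<close>

lemma Ind_lift:
  fixes N :: "('n, 'k) ring_scheme"
  assumes M: "left_module R M" and N: "abelian_group N"
    and cl: "\<And>a x. \<lbrakk>a \<in> carrier A; x \<in> carrier M\<rbrakk> \<Longrightarrow> \<beta> a x \<in> carrier N"
    and addl: "\<And>a b x. \<lbrakk>a \<in> carrier A; b \<in> carrier A; x \<in> carrier M\<rbrakk> \<Longrightarrow> \<beta> (a \<oplus>\<^bsub>A\<^esub> b) x = \<beta> a x \<oplus>\<^bsub>N\<^esub> \<beta> b x"
    and addr: "\<And>a x y. \<lbrakk>a \<in> carrier A; x \<in> carrier M; y \<in> carrier M\<rbrakk> \<Longrightarrow> \<beta> a (x \<oplus>\<^bsub>M\<^esub> y) = \<beta> a x \<oplus>\<^bsub>N\<^esub> \<beta> a y"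
    and bal: "\<And>a r x. \<lbrakk>a \<in> carrier A; r \<in> carrier R; x \<in> carrier M\<rbrakk> \<Longrightarrow> \<beta> (a \<otimes>\<^bsub>A\<^esub> \<iota> r) x = \<beta> a (r \<odot>\<^bsub>M\<^esub> x)"
  shows "\<exists>h \<in> add_hom (Ind M) N. \<forall>a \<in> carrier A. \<forall>x \<in> carrier M. h (tensor M a x) = \<beta> a x"
proof -
  interpret M: left_module R M by fact
  interpret N: abelian_group N by fact
  interpret FN: normal "relations M" "frags M" by (rule normal_relations[OF M])
  have "(\<lambda>(a, x). \<beta> a x) ` (carrier A \<times> carrier M) \<subseteq> carrier (add_monoid N)"
    using cl by auto
  then obtain k where k: "k \<in> hom (frags M) (add_monoid N)"
    and kf: "\<And>p. p \<in> carrier A \<times> carrier M \<Longrightarrow> k (frag_of p) = (case p of (a, x) \<Rightarrow> \<beta> a x)"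
    using N.a_comm_group comm_group.free_Abelian_group_universal by metis
  interpret k: group_hom "frags M" "add_monoid N" k
    by (intro group_hom.intro group_hom_axioms.intro k N.add.is_group group_free_Abelian_group)
  have kdiff: "k (u - v) = k u \<ominus>\<^bsub>N\<^esub> k v"
    if "Poly_Mapping.keys u \<subseteq> carrier A \<times> carrier M" "Poly_Mapping.keys v \<subseteq> carrier A \<times> carrier M" for u v
    using k.hom_mult[of u "inv\<^bsub>frags M\<^esub> v"] k.hom_inv[of v] that by (simp add: N.minus_eq a_inv_def)
  have "tensor_relators R A \<iota> M \<subseteq> kernel (frags M) (add_monoid N) k"
  proof
    fix u assume u: "u \<in> tensor_relators R A \<iota> M"
    then have "u \<in> carrier (frags M)"
      using tensor_relators_subset[OF M] by blast
    moreover have cancel: "y \<oplus>\<^bsub>N\<^esub> z \<ominus>\<^bsub>N\<^esub> y \<ominus>\<^bsub>N\<^esub> z = \<zero>\<^bsub>N\<^esub>" if "y \<in> carrier N" "z \<in> carrier N" for y z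
      using that by (simp add: N.minus_eq N.a_comm[of y z] N.a_assoc N.r_neg)
    have "k u = \<zero>\<^bsub>N\<^esub>"
      using u by (cases rule: tensor_relators_cases)
        (simp_all add: kdiff kf cl addl addr bal diff_frag cancel N.minus_eq_zero_iff)
    ultimately show "u \<in> kernel (frags M) (add_monoid N) k"
      by (simp add: kernel_def)
  qed
  then have "relations M \<subseteq> kernel (frags M) (add_monoid N) k"
    using FN.generate_subgroup_incl k.subgroup_kernel by blast
  then obtain h where h: "h \<in> hom (frags M Mod relations M) (add_monoid N)"
      "\<And>u. u \<in> carrier (frags M) \<Longrightarrow> h (relations M #>\<^bsub>frags M\<^esub> u) = k u"
    using k.FactGroup_universal_kernel[OF normal_relations[OF M]] by metis
  have "h (tensor M a x) = \<beta> a x" if "a \<in> carrier A" "x \<in> carrier M" for a x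
    using h(2)[of "frag_of (a, x)"] kf[of "(a, x)"] that by (simp add: tensor_def)
  moreover have "h \<in> add_hom (Ind M) N"
    using h(1) by (simp add: add_hom_def hom_def Ind_Mod)
  ultimately show ?thesis
    by (intro bexI[of _ h] ballI)
qed

text \<open>The definition multiplies a coset as a set. Scaling sends each relator to a relator of
  the same kind and so maps the subgroup of relations into itself; therefore the set product
  collapses to one coset, that of the scaled representative.\<close>

lemma smult_Ind_coset:
  assumes M: "left_module R M" and a: "a \<in> carrier A" and u: "Poly_Mapping.keys u \<subseteq> carrier A \<times> carrier M"
  shows "a \<odot>\<^bsub>Ind M\<^esub> (relations M #>\<^bsub>frags M\<^esub> u) = relations M #>\<^bsub>frags M\<^esub> scale_frag a u"
    and "Poly_Mapping.keys (scale_frag a u) \<subseteq> carrier A \<times> carrier M"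
proof -
  interpret M: left_module R M by fact
  interpret FN: normal "relations M" "frags M" by (rule normal_relations[OF M])
  have keys: "Poly_Mapping.keys (scale_frag a v) \<subseteq> carrier A \<times> carrier M"
    if "Poly_Mapping.keys v \<subseteq> carrier A \<times> carrier M" for v :: "('a \<times> 'b) \<Rightarrow>\<^sub>0 int"
    using keys_frag_extend[of "\<lambda>(b, t). frag_of (a \<otimes>\<^bsub>A\<^esub> b, t)" v] that a by fastforce
  then show "Poly_Mapping.keys (scale_frag a u) \<subseteq> carrier A \<times> carrier M"
    using u .
  have hom: "scale_frag a \<in> hom (frags M) (frags M)"
    by (auto simp: hom_def frag_extend_add keys del: subsetI)
  interpret s: group_hom "frags M" "frags M" "scale_frag a"
    by (intro group_hom.intro group_hom_axioms.intro hom group_free_Abelian_group)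
  have "scale_frag a ` tensor_relators R A \<iota> M \<subseteq> tensor_relators R A \<iota> M"
  proof (rule image_subsetI)
    fix u assume "u \<in> tensor_relators R A \<iota> M"
    then show "scale_frag a u \<in> tensor_relators R A \<iota> M"
    proof (cases rule: tensor_relators_cases)
      case (left b c x)
      then have "scale_frag a u = frag_of (a \<otimes>\<^bsub>A\<^esub> b \<oplus>\<^bsub>A\<^esub> a \<otimes>\<^bsub>A\<^esub> c, x) -
          frag_of (a \<otimes>\<^bsub>A\<^esub> b, x) - frag_of (a \<otimes>\<^bsub>A\<^esub> c, x)"
        using a by (simp add: frag_extend_diff A.r_distr)
      then show ?thesis
        unfolding tensor_relators_def using left(2-) A.m_closed[OF a] by blast
    next
      case (right b x y)
      then have "scale_frag a u = frag_of (a \<otimes>\<^bsub>A\<^esub> b, x \<oplus>\<^bsub>M\<^esub> y) -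
          frag_of (a \<otimes>\<^bsub>A\<^esub> b, x) - frag_of (a \<otimes>\<^bsub>A\<^esub> b, y)"
        by (simp add: frag_extend_diff)
      then show ?thesis
        unfolding tensor_relators_def using right(2-) A.m_closed[OF a] by blast
    next
      case (balanced b r x)
      then have "scale_frag a u = frag_of (a \<otimes>\<^bsub>A\<^esub> b \<otimes>\<^bsub>A\<^esub> \<iota> r, x) - frag_of (a \<otimes>\<^bsub>A\<^esub> b, r \<odot>\<^bsub>M\<^esub> x)"
        using a by (simp add: frag_extend_diff A.m_assoc)
      then show ?thesis
        unfolding tensor_relators_def using balanced(2-) A.m_closed[OF a] by blast
    qed
  qed
  then have "generate (frags M) (scale_frag a ` tensor_relators R A \<iota> M) \<subseteq> relations M"
    by (rule FN.mono_generate)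
  then have rel: "scale_frag a ` relations M \<subseteq> relations M"
    using s.generate_img[OF tensor_relators_subset[OF M]] by simp
  have "relations M <#>\<^bsub>frags M\<^esub> scale_frag a ` (relations M #>\<^bsub>frags M\<^esub> u) =
      relations M #>\<^bsub>frags M\<^esub> scale_frag a u"
  proof (intro equalityI subsetI)
    fix w assume "w \<in> relations M <#>\<^bsub>frags M\<^esub> scale_frag a ` (relations M #>\<^bsub>frags M\<^esub> u)"
    then obtain k l where kl: "k \<in> relations M" "l \<in> relations M" "w = k + scale_frag a (l + u)"
      by (auto simp: set_mult_def r_coset_def)
    have "k \<otimes>\<^bsub>frags M\<^esub> scale_frag a l \<in> relations M"
      using kl rel by (intro subgroup.m_closed[OF FN.subgroup_axioms]) auto
    then show "w \<in> relations M #>\<^bsub>frags M\<^esub> scale_frag a u"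
      using kl(3) by (auto simp: r_coset_def frag_extend_add add.assoc)
  next
    fix w assume "w \<in> relations M #>\<^bsub>frags M\<^esub> scale_frag a u"
    then obtain k where k: "k \<in> relations M" "w = k + scale_frag a u"
      by (auto simp: r_coset_def)
    have "u \<in> relations M #>\<^bsub>frags M\<^esub> u"
      using subgroup.one_closed[OF FN.subgroup_axioms] by (force simp: r_coset_def)
    then show "w \<in> relations M <#>\<^bsub>frags M\<^esub> scale_frag a ` (relations M #>\<^bsub>frags M\<^esub> u)"
      using k by (auto simp: set_mult_def)
  qed
  then show "a \<odot>\<^bsub>Ind M\<^esub> (relations M #>\<^bsub>frags M\<^esub> u) = relations M #>\<^bsub>frags M\<^esub> scale_frag a u"
    by (simp add: induced_module_def Let_def)
qed

lemma smult_tensor: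
  assumes M: "left_module R M" and "a \<in> carrier A" "b \<in> carrier A" "x \<in> carrier M"
  shows "a \<odot>\<^bsub>Ind M\<^esub> tensor M b x = tensor M (a \<otimes>\<^bsub>A\<^esub> b) x"
  using smult_Ind_coset(1)[OF M assms(2), of "frag_of (b, x)"] assms by (simp add: tensor_def)

lemma smult_add_hom:
  assumes M: "left_module R M" and a: "a \<in> carrier A"
  shows "(\<lambda>z. a \<odot>\<^bsub>Ind M\<^esub> z) \<in> add_hom (Ind M) (Ind M)"
proof (rule add_homI)
  note q = coset_hom[OF M]
  fix z assume "z \<in> carrier (Ind M)"
  then show "a \<odot>\<^bsub>Ind M\<^esub> z \<in> carrier (Ind M)"
    using smult_Ind_coset[OF M a] hom_in_carrier[OF q] by (elim Ind_cases) simp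
next
  note q = coset_hom[OF M]
  fix z w assume "z \<in> carrier (Ind M)" "w \<in> carrier (Ind M)"
  from \<open>z \<in> _\<close> obtain u where u: "Poly_Mapping.keys u \<subseteq> carrier A \<times> carrier M" "z = relations M #>\<^bsub>frags M\<^esub> u"
    by (rule Ind_cases)
  from \<open>w \<in> _\<close> obtain v where v: "Poly_Mapping.keys v \<subseteq> carrier A \<times> carrier M" "w = relations M #>\<^bsub>frags M\<^esub> v"
    by (rule Ind_cases)
  have uv: "Poly_Mapping.keys (u + v) \<subseteq> carrier A \<times> carrier M"
    using keys_add[of u v] u v by blast
  show "a \<odot>\<^bsub>Ind M\<^esub> (z \<oplus>\<^bsub>Ind M\<^esub> w) = a \<odot>\<^bsub>Ind M\<^esub> z \<oplus>\<^bsub>Ind M\<^esub> a \<odot>\<^bsub>Ind M\<^esub> w"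
    using hom_mult[OF q, of u v] hom_mult[OF q, of "scale_frag a u" "scale_frag a v"] u v
      smult_Ind_coset[OF M a u(1)] smult_Ind_coset[OF M a v(1)] smult_Ind_coset[OF M a uv]
    by (simp add: frag_extend_add)
qed

text \<open>Distributivity over sums in the module is additivity of scaling. The other equations
  compare additive maps of z, so pure tensors suffice, and there they follow from the ring laws of A
  and additivity of a \<otimes> x in a.\<close>

lemma left_module_Ind:
  assumes M: "left_module R M" shows "left_module A (Ind M)"
proof -
  interpret U: abelian_group "Ind M" by (rule abelian_group_Ind[OF M])
  note s = smult_add_hom[OF M] and sc [simp] = add_hom_closed[OF s] and t = smult_tensor[OF M]
  show ?thesis
  proof (intro left_module.intro left_module_axioms.intro A.ring_axioms U.abelian_group_axioms)
    fix a z w assume "a \<in> carrier A" "z \<in> carrier (Ind M)" "w \<in> carrier (Ind M)"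
    then show "a \<odot>\<^bsub>Ind M\<^esub> (z \<oplus>\<^bsub>Ind M\<^esub> w) = a \<odot>\<^bsub>Ind M\<^esub> z \<oplus>\<^bsub>Ind M\<^esub> a \<odot>\<^bsub>Ind M\<^esub> w"
      by (intro add_hom_add[OF s])
  next
    fix a b z assume ab: "a \<in> carrier A" "b \<in> carrier A" and z: "z \<in> carrier (Ind M)"
    have "(\<lambda>z. a \<odot>\<^bsub>Ind M\<^esub> z \<oplus>\<^bsub>Ind M\<^esub> b \<odot>\<^bsub>Ind M\<^esub> z) \<in> add_hom (Ind M) (Ind M)"
      using ab by (intro add_homI) (simp_all add: add_hom_add[OF s] U.a_ac)
    from Ind_add_hom_eq[OF M U.abelian_group_axioms s[of "a \<oplus>\<^bsub>A\<^esub> b"] this _ z]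
    show "(a \<oplus>\<^bsub>A\<^esub> b) \<odot>\<^bsub>Ind M\<^esub> z = a \<odot>\<^bsub>Ind M\<^esub> z \<oplus>\<^bsub>Ind M\<^esub> b \<odot>\<^bsub>Ind M\<^esub> z"
      using ab by (simp add: t A.l_distr tensor_add_left[OF M])
    from Ind_add_hom_eq[OF M U.abelian_group_axioms s[of "a \<otimes>\<^bsub>A\<^esub> b"] add_hom_compose[OF s[of b] s[of a]] _ z]
    show "(a \<otimes>\<^bsub>A\<^esub> b) \<odot>\<^bsub>Ind M\<^esub> z = a \<odot>\<^bsub>Ind M\<^esub> (b \<odot>\<^bsub>Ind M\<^esub> z)"
      using ab by (simp add: t A.m_assoc)
  next
    fix z assume z: "z \<in> carrier (Ind M)"
    have "(\<lambda>z. z) \<in> add_hom (Ind M) (Ind M)"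
      by (rule add_homI) auto
    from Ind_add_hom_eq[OF M U.abelian_group_axioms s[of "\<one>\<^bsub>A\<^esub>"] this _ z]
    show "\<one>\<^bsub>A\<^esub> \<odot>\<^bsub>Ind M\<^esub> z = z"
      by (simp add: t)
  qed simp
qed

section \<open>Adjunction with restriction of scalars, and functoriality of induction\<close>

lemma tensor_hom_right:
  "\<lbrakk>left_module R M; a \<in> carrier A\<rbrakk> \<Longrightarrow> (\<lambda>x. tensor M a x) \<in> add_hom M (Ind M)"
  by (rule add_homI) (simp_all add: tensor_add_right)

lemma tensor_hom_left:
  "\<lbrakk>left_module R M; x \<in> carrier M\<rbrakk> \<Longrightarrow> (\<lambda>a. tensor M a x) \<in> add_hom A (Ind M)"
  by (rule add_homI) (simp_all add: tensor_add_left)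

lemma smult_tensor_one:
  "\<lbrakk>left_module R M; a \<in> carrier A; x \<in> carrier M\<rbrakk> \<Longrightarrow> a \<odot>\<^bsub>Ind M\<^esub> tensor M \<one>\<^bsub>A\<^esub> x = tensor M a x"
  by (simp add: smult_tensor)

text \<open>The unit of the adjunction; it is linear because \<iota> r \<otimes> x = 1 \<otimes> r
  x.\<close>

lemma unit_hom:
  assumes M: "left_module R M"
  shows "(\<lambda>x. tensor M \<one>\<^bsub>A\<^esub> x) \<in> lmod_hom R M (restrict_scalars \<iota> (Ind M))"
proof (rule lmod_homI)
  fix r x assume "r \<in> carrier R" "x \<in> carrier M"
  then show "tensor M \<one>\<^bsub>A\<^esub> (r \<odot>\<^bsub>M\<^esub> x) = r \<odot>\<^bsub>restrict_scalars \<iota> (Ind M)\<^esub> tensor M \<one>\<^bsub>A\<^esub> x"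
    using tensor_balanced[OF M, of "\<one>\<^bsub>A\<^esub>" r x] by (simp add: smult_tensor[OF M])
qed (simp_all add: M tensor_add_right[OF M])

text \<open>The rule a \<otimes> x \<mapsto> a (f x) is balanced because f is linear along \<iota>.
  Together with the uniqueness in \<open>Ind_hom_eq\<close>, composition with the unit identifies
  the A-linear maps out of \<open>Ind M\<close> with the R-linear maps out of M.\<close>

lemma Ind_adjoint:
  assumes M: "left_module R M" and L: "left_module A L"
    and f: "f \<in> lmod_hom R M (restrict_scalars \<iota> L)"
  shows "\<exists>h \<in> lmod_hom A (Ind M) L. \<forall>a \<in> carrier A. \<forall>x \<in> carrier M. h (tensor M a x) = a \<odot>\<^bsub>L\<^esub> f x"
proof -
  interpret M: left_module R M by fact
  interpret L: left_module A L by fact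
  interpret U: left_module A "Ind M" by (rule left_module_Ind[OF M])
  have fc: "f x \<in> carrier L" if "x \<in> carrier M" for x
    using lmod_hom_closed[OF f that] by simp
  have fr: "f (r \<odot>\<^bsub>M\<^esub> x) = \<iota> r \<odot>\<^bsub>L\<^esub> f x" if "r \<in> carrier R" "x \<in> carrier M" for r x
    using lmod_hom_smult[OF f that] by simp
  obtain h where h: "h \<in> add_hom (Ind M) L"
    and ht: "\<forall>a \<in> carrier A. \<forall>x \<in> carrier M. h (tensor M a x) = a \<odot>\<^bsub>L\<^esub> f x"
    using Ind_lift[OF M L.M.abelian_group_axioms, of "\<lambda>a x. a \<odot>\<^bsub>L\<^esub> f x"] fc
    by (auto simp: L.smult_l_distr L.smult_r_distr L.smult_assoc1 fr lmod_hom_add[OF f])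
  have "h (a \<odot>\<^bsub>Ind M\<^esub> z) = a \<odot>\<^bsub>L\<^esub> h z" if a: "a \<in> carrier A" and z: "z \<in> carrier (Ind M)" for a z
  proof -
    have "(\<lambda>z. a \<odot>\<^bsub>L\<^esub> h z) \<in> add_hom (Ind M) L"
      by (rule add_homI) (simp_all add: a add_hom_closed[OF h] add_hom_add[OF h] L.smult_r_distr)
    from Ind_add_hom_eq[OF M L.M.abelian_group_axioms add_hom_compose[OF smult_add_hom[OF M a] h] this _ z]
    show ?thesis
      using a by (simp add: smult_tensor[OF M] ht L.smult_assoc1 fc)
  qed
  then have "h \<in> lmod_hom A (Ind M) L"
    by (intro lmod_homI) (simp_all add: add_hom_closed[OF h] add_hom_add[OF h])
  with ht show ?thesis by blast
qed

lemma Ind_hom_eq: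
  assumes M: "left_module R M" and L: "left_module A L"
    and f: "f \<in> lmod_hom A (Ind M) L" and g: "g \<in> lmod_hom A (Ind M) L"
    and eq: "\<And>x. x \<in> carrier M \<Longrightarrow> f (tensor M \<one>\<^bsub>A\<^esub> x) = g (tensor M \<one>\<^bsub>A\<^esub> x)"
    and z: "z \<in> carrier (Ind M)"
  shows "f z = g z"
proof (rule Ind_add_hom_eq[OF M left_module.axioms(2)[OF L] add_hom_of_lmod_hom[OF f] add_hom_of_lmod_hom[OF g] _ z])
  fix a x assume ax: "a \<in> carrier A" "x \<in> carrier M"
  then have t: "tensor M \<one>\<^bsub>A\<^esub> x \<in> carrier (Ind M)" using M by simp
  show "f (tensor M a x) = g (tensor M a x)"
    using lmod_hom_smult[OF f ax(1) t] lmod_hom_smult[OF g ax(1) t] eq[OF ax(2)] ax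
    by (simp add: smult_tensor_one[OF M])
qed

text \<open>The map 1 \<otimes> f. \<open>Ind_adjoint\<close> gives existence without a formula,
  hence the choice; on the carrier of \<open>Ind M\<close> the values on pure tensors determine it,
  elsewhere it is arbitrary.\<close>

definition Ind_map ::
  "('r, 'm) module \<Rightarrow> ('r, 'n) module \<Rightarrow> ('m \<Rightarrow> 'n) \<Rightarrow>
    (('a \<times> 'm) \<Rightarrow>\<^sub>0 int) set \<Rightarrow> (('a \<times> 'n) \<Rightarrow>\<^sub>0 int) set" where
  "Ind_map M N f = (SOME h. h \<in> lmod_hom A (Ind M) (Ind N) \<and>
     (\<forall>a \<in> carrier A. \<forall>x \<in> carrier M. h (tensor M a x) = tensor N a (f x)))"

lemma
  assumes M: "left_module R M" and N: "left_module R N" and f: "f \<in> lmod_hom R M N"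
  shows Ind_map_hom: "Ind_map M N f \<in> lmod_hom A (Ind M) (Ind N)"
    and Ind_map_tensor:
      "\<lbrakk>a \<in> carrier A; x \<in> carrier M\<rbrakk> \<Longrightarrow> Ind_map M N f (tensor M a x) = tensor N a (f x)"
proof -
  have "\<exists>h \<in> lmod_hom A (Ind M) (Ind N). \<forall>a \<in> carrier A. \<forall>x \<in> carrier M.
      h (tensor M a x) = a \<odot>\<^bsub>Ind N\<^esub> tensor N \<one>\<^bsub>A\<^esub> (f x)"
    by (rule Ind_adjoint[OF M left_module_Ind[OF N] lmod_hom_compose[OF f unit_hom[OF N]]])
  then have "\<exists>h. h \<in> lmod_hom A (Ind M) (Ind N) \<and>
      (\<forall>a \<in> carrier A. \<forall>x \<in> carrier M. h (tensor M a x) = tensor N a (f x))"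
    by (auto simp: smult_tensor_one[OF N] lmod_hom_closed[OF f])
  from someI_ex[OF this]
  show "Ind_map M N f \<in> lmod_hom A (Ind M) (Ind N)"
    "\<lbrakk>a \<in> carrier A; x \<in> carrier M\<rbrakk> \<Longrightarrow> Ind_map M N f (tensor M a x) = tensor N a (f x)"
    by (simp_all add: Ind_map_def)
qed

lemma retract_Ind:
  assumes M: "left_module R M" and N: "left_module R N" and ret: "retract R M N"
  shows "retract A (Ind M) (Ind N)"
proof -
  obtain s e where s: "s \<in> lmod_hom R M N" and e: "e \<in> lmod_hom R N M"
    and es: "\<And>x. x \<in> carrier M \<Longrightarrow> e (s x) = x"
    using ret unfolding retract_def by blast
  note S = Ind_map_hom[OF M N s] and E = Ind_map_hom[OF N M e]
  show ?thesis
  proof (rule retractI[OF S E])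
    fix z assume z: "z \<in> carrier (Ind M)"
    show "Ind_map N M e (Ind_map M N s z) = z"
      by (rule Ind_hom_eq[OF M left_module_Ind[OF M] lmod_hom_compose[OF S E] lmod_hom_ident _ z])
        (simp add: Ind_map_tensor[OF M N s] Ind_map_tensor[OF N M e] es lmod_hom_closed[OF s])
  qed
qed

section \<open>Zero, direct sums, free and projective modules under induction\<close>

lemma Ind_zero:
  assumes M: "left_module R M" and zero: "carrier M = {\<zero>\<^bsub>M\<^esub>}"
  shows "carrier (Ind M) = {\<zero>\<^bsub>Ind M\<^esub>}"
proof -
  interpret M: left_module R M by fact
  interpret U: left_module A "Ind M" by (rule left_module_Ind[OF M])
  have "z = \<zero>\<^bsub>Ind M\<^esub>" if "z \<in> carrier (Ind M)" for z
  proof (rule Ind_hom_eq[OF M U.left_module_axioms lmod_hom_ident lmod_hom_zero_map[OF U.left_module_axioms] _ that])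
    fix x assume "x \<in> carrier M"
    then show "tensor M \<one>\<^bsub>A\<^esub> x = \<zero>\<^bsub>Ind M\<^esub>"
      using zero add_hom_zero[OF M.M.abelian_group_axioms U.M.abelian_group_axioms tensor_hom_right[OF M]]
      by simp
  qed
  then show ?thesis by auto
qed

text \<open>Tensoring commutes with direct sums, including infinite ones. One map sends a \<otimes>
  f to the family of all a \<otimes> f v, the other assembles the maps induced by the injections.
  That they compose to the identity on the induced module is checked on 1 \<otimes> f and then, by
  additivity in f, on a single coordinate.\<close>

lemma Ind_copies:
  assumes M: "left_module R M"
  shows "retract A (Ind (lmod_copies X M)) (lmod_copies X (Ind M))"
proof -
  interpret M: left_module R M by fact
  let ?C = "lmod_copies X M" and ?D = "lmod_copies X (Ind M)"
  have C: "left_module R ?C" by (rule left_module_copies[OF M])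
  have U: "left_module A (Ind M)" by (rule left_module_Ind[OF M])
  have D: "left_module A ?D" by (rule left_module_copies[OF U])
  have V: "left_module A (Ind ?C)" by (rule left_module_Ind[OF C])
  interpret U: left_module A "Ind M" by (rule U)
  interpret D: left_module A ?D by (rule D)
  interpret V: left_module A "Ind ?C" by (rule V)
  have tz: "tensor M a \<zero>\<^bsub>M\<^esub> = \<zero>\<^bsub>Ind M\<^esub>" if "a \<in> carrier A" for a
    by (rule add_hom_zero[OF M.M.abelian_group_axioms U.M.abelian_group_axioms tensor_hom_right[OF M that]])
  have tf: "(\<lambda>v. tensor M a (f v)) \<in> carrier ?D" if "a \<in> carrier A" "f \<in> carrier ?C" for a f
  proof -
    have "finite {v. tensor M a (f v) \<noteq> \<zero>\<^bsub>Ind M\<^esub>}"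
      by (rule finite_subset[of _ "{v. f v \<noteq> \<zero>\<^bsub>M\<^esub>}"])
        (use that in \<open>auto simp: lmod_copies_def tz\<close>)
    then show ?thesis
      using that M by (auto simp: lmod_copies_def tz)
  qed
  have "(\<lambda>f v. tensor M \<one>\<^bsub>A\<^esub> (f v)) \<in> lmod_hom R ?C (restrict_scalars \<iota> ?D)"
  proof (rule lmod_homI)
    fix f g assume fg: "f \<in> carrier ?C" "g \<in> carrier ?C"
    show "(\<lambda>v. tensor M \<one>\<^bsub>A\<^esub> ((f \<oplus>\<^bsub>?C\<^esub> g) v)) =
        (\<lambda>v. tensor M \<one>\<^bsub>A\<^esub> (f v)) \<oplus>\<^bsub>restrict_scalars \<iota> ?D\<^esub> (\<lambda>v. tensor M \<one>\<^bsub>A\<^esub> (g v))"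
      using fg by (simp add: lmod_copies_def tensor_add_right[OF M])
  next
    fix r f assume rf: "r \<in> carrier R" "f \<in> carrier ?C"
    show "(\<lambda>v. tensor M \<one>\<^bsub>A\<^esub> ((r \<odot>\<^bsub>?C\<^esub> f) v)) = r \<odot>\<^bsub>restrict_scalars \<iota> ?D\<^esub> (\<lambda>v. tensor M \<one>\<^bsub>A\<^esub> (f v))"
      using rf lmod_hom_smult[OF unit_hom[OF M], of r] by (simp add: lmod_copies_def)
  qed (simp add: tf)
  from Ind_adjoint[OF C D this] obtain s where s: "s \<in> lmod_hom A (Ind ?C) ?D"
    and st: "\<forall>a \<in> carrier A. \<forall>f \<in> carrier ?C. s (tensor ?C a f) = a \<odot>\<^bsub>?D\<^esub> (\<lambda>v. tensor M \<one>\<^bsub>A\<^esub> (f v))"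
    by blast
  have st1: "s (tensor ?C \<one>\<^bsub>A\<^esub> f) = (\<lambda>v. tensor M \<one>\<^bsub>A\<^esub> (f v))" if "f \<in> carrier ?C" for f
    using st that tf[OF A.one_closed that] by simp
  let ?g = "\<lambda>v. Ind_map M ?C (copies_in M v)"
  have g: "?g v \<in> lmod_hom A (Ind M) (Ind ?C)" if "v \<in> X" for v
    by (rule Ind_map_hom[OF M C copies_in_hom[OF M that]])
  have e: "copies_out (Ind M) (Ind ?C) ?g \<in> lmod_hom A ?D (Ind ?C)"
    by (rule copies_out_hom[OF U V g])
  have eq: "copies_out (Ind M) (Ind ?C) ?g (\<lambda>v. tensor M \<one>\<^bsub>A\<^esub> (f v)) = tensor ?C \<one>\<^bsub>A\<^esub> f"
    if f: "f \<in> carrier ?C" for f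
  proof (rule copies_hom_eq[OF M V.M.abelian_group_axioms _ tensor_hom_right[OF C A.one_closed] _ f])
    have "(\<lambda>f v. tensor M \<one>\<^bsub>A\<^esub> (f v)) \<in> add_hom ?C ?D"
    proof (rule add_homI)
      fix f g assume "f \<in> carrier ?C" "g \<in> carrier ?C"
      then show "(\<lambda>v. tensor M \<one>\<^bsub>A\<^esub> ((f \<oplus>\<^bsub>?C\<^esub> g) v)) =
          (\<lambda>v. tensor M \<one>\<^bsub>A\<^esub> (f v)) \<oplus>\<^bsub>?D\<^esub> (\<lambda>v. tensor M \<one>\<^bsub>A\<^esub> (g v))"
        by (simp add: lmod_copies_def tensor_add_right[OF M])
    qed (simp add: tf)
    from add_hom_compose[OF this add_hom_of_lmod_hom[OF e]]
    show "(\<lambda>f. copies_out (Ind M) (Ind ?C) ?g (\<lambda>v. tensor M \<one>\<^bsub>A\<^esub> (f v))) \<in> add_hom ?C (Ind ?C)" .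
  next
    fix v x assume v: "v \<in> X" and x: "x \<in> carrier M"
    have "(\<lambda>w. tensor M \<one>\<^bsub>A\<^esub> (copies_in M v x w)) = copies_in (Ind M) v (tensor M \<one>\<^bsub>A\<^esub> x)"
      by (rule ext) (simp add: copies_in_def tz)
    moreover have "copies_out (Ind M) (Ind ?C) ?g (copies_in (Ind M) v (tensor M \<one>\<^bsub>A\<^esub> x)) =
        ?g v (tensor M \<one>\<^bsub>A\<^esub> x)"
      by (rule copies_out_in[OF U V g v]) (use x M in simp_all)
    ultimately show "copies_out (Ind M) (Ind ?C) ?g (\<lambda>w. tensor M \<one>\<^bsub>A\<^esub> (copies_in M v x w)) =
        tensor ?C \<one>\<^bsub>A\<^esub> (copies_in M v x)"
      using x by (simp add: Ind_map_tensor[OF M C copies_in_hom[OF M v]])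
  qed
  show ?thesis
  proof (rule retractI[OF s e])
    fix z assume z: "z \<in> carrier (Ind ?C)"
    show "copies_out (Ind M) (Ind ?C) ?g (s z) = z"
      by (rule Ind_hom_eq[OF C V lmod_hom_compose[OF s e] lmod_hom_ident _ z]) (simp add: st1 eq)
  qed
qed

text \<open>The inverse is a \<otimes> r \<mapsto> a \<iota>(r). Both composites are recorded
  because, besides handling free modules, this isomorphism replaces the source of the induced
  coresolution.\<close>

lemma Ind_regular:
  "\<exists>k. lmod_inverses A (regular_module A) (Ind (regular_module R)) (\<lambda>a. tensor (regular_module R) a \<one>\<^bsub>R\<^esub>) k"
proof -
  let ?R = "regular_module R" and ?A = "regular_module A"
  have R: "left_module R ?R" by (rule left_module_regular[OF R.ring_axioms])
  have A: "left_module A ?A" by (rule left_module_regular[OF A.ring_axioms])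
  have h: "(\<lambda>a. tensor ?R a \<one>\<^bsub>R\<^esub>) \<in> lmod_hom A ?A (Ind ?R)"
    by (rule lmod_homI) (simp_all add: R tensor_add_left[OF R] smult_tensor[OF R])
  have "\<iota> \<in> lmod_hom R ?R (restrict_scalars \<iota> ?A)"
    by (rule lmod_homI) (simp_all add: ring_hom_add[OF \<iota>] ring_hom_mult[OF \<iota>])
  from Ind_adjoint[OF R A this] obtain k where k: "k \<in> lmod_hom A (Ind ?R) ?A"
    and kt: "\<forall>a \<in> carrier A. \<forall>r \<in> carrier R. k (tensor ?R a r) = a \<otimes>\<^bsub>A\<^esub> \<iota> r"
    by auto
  have "tensor ?R (k z) \<one>\<^bsub>R\<^esub> = z" if z: "z \<in> carrier (Ind ?R)" for z
  proof (rule Ind_hom_eq[OF R left_module_Ind[OF R] lmod_hom_compose[OF k h] lmod_hom_ident _ z])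
    fix r assume "r \<in> carrier ?R"
    then show "tensor ?R (k (tensor ?R \<one>\<^bsub>A\<^esub> r)) \<one>\<^bsub>R\<^esub> = tensor ?R \<one>\<^bsub>A\<^esub> r"
      using tensor_balanced[OF R, of "\<one>\<^bsub>A\<^esub>" r "\<one>\<^bsub>R\<^esub>"] kt by simp
  qed
  moreover have "k (tensor ?R a \<one>\<^bsub>R\<^esub>) = a" if "a \<in> carrier A" for a
    using kt that ring_hom_one[OF \<iota>] by simp
  ultimately have "lmod_inverses A ?A (Ind ?R) (\<lambda>a. tensor ?R a \<one>\<^bsub>R\<^esub>) k"
    using h k by (auto simp: lmod_inverses_def)
  then show ?thesis by (intro exI)
qed

lemma Ind_free: "retract A (Ind (free_lmod X R)) (free_lmod X A)"
proof -
  have R: "left_module R (regular_module R)" by (rule left_module_regular[OF R.ring_axioms])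
  have A: "left_module A (regular_module A)" by (rule left_module_regular[OF A.ring_axioms])
  obtain k where "lmod_inverses A (regular_module A) (Ind (regular_module R)) (\<lambda>a. tensor (regular_module R) a \<one>\<^bsub>R\<^esub>) k"
    using Ind_regular by blast
  from retract_copies[OF left_module_Ind[OF R] A lmod_inverses_retract[OF this]]
  show ?thesis
    by (rule retract_trans[OF Ind_copies[OF R]])
qed

text \<open>The index set X is kept, so a finite rank over R remains finite over A and finite
  generation is inherited.\<close>

lemma Ind_projective:
  assumes P: "left_module R P" and "retract R P (free_lmod X R)"
  shows "retract A (Ind P) (free_lmod X A)"
  by (rule retract_trans[OF retract_Ind[OF P left_module_copies[OF left_module_regular[OF R.ring_axioms]] assms(2)] Ind_free])

text \<open>A cochain on \<open>Ind (P j)\<close> corresponds to its composite with the unit, and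
  this respects the differentials because 1 \<otimes> d sends 1 \<otimes> x to 1 \<otimes> d x.
  Cocycles and coboundaries therefore correspond in both directions.\<close>

lemma hom_exact_Ind:
  assumes P: "\<And>j. left_module R (P j)" and d: "\<And>j. d j \<in> lmod_hom R (P (Suc j)) (P j)"
    and L: "left_module A L"
  shows "hom_exact A (\<lambda>j. Ind (P j)) (\<lambda>j. Ind_map (P (Suc j)) (P j) (d j)) L i \<longleftrightarrow>
    hom_exact R P d (restrict_scalars \<iota> L) i"
proof
  interpret L: left_module A L by fact
  let ?L = "restrict_scalars \<iota> L"
  note D = Ind_map_hom[OF P P d] and Dt = Ind_map_tensor[OF P P d] and dc = lmod_hom_closed[OF d]
  note I = left_module_Ind[OF P]
  have restr: "c \<in> lmod_hom R (restrict_scalars \<iota> (Ind (P j))) ?L" if "c \<in> lmod_hom A (Ind (P j)) L" for c j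
    by (rule lmod_homI) (simp_all add: lmod_hom_closed[OF that] lmod_hom_add[OF that] lmod_hom_smult[OF that])
  assume ex: "hom_exact A (\<lambda>j. Ind (P j)) (\<lambda>j. Ind_map (P (Suc j)) (P j) (d j)) L i"
  show "hom_exact R P d ?L i"
    unfolding hom_exact_def
  proof (intro ballI impI)
    fix c assume c: "c \<in> lmod_hom R (P (Suc i)) ?L"
      and z: "\<forall>x \<in> carrier (P (Suc (Suc i))). c (d (Suc i) x) = \<zero>\<^bsub>?L\<^esub>"
    obtain c' where c': "c' \<in> lmod_hom A (Ind (P (Suc i))) L"
      and ct: "\<forall>a \<in> carrier A. \<forall>x \<in> carrier (P (Suc i)). c' (tensor (P (Suc i)) a x) = a \<odot>\<^bsub>L\<^esub> c x"
      using Ind_adjoint[OF P L c] by blast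
    have cc: "c x \<in> carrier L" if "x \<in> carrier (P (Suc i))" for x
      using lmod_hom_closed[OF c that] by simp
    have "c' (Ind_map (P (Suc (Suc i))) (P (Suc i)) (d (Suc i)) y) = \<zero>\<^bsub>L\<^esub>"
      if "y \<in> carrier (Ind (P (Suc (Suc i))))" for y
      by (rule Ind_hom_eq[OF P L lmod_hom_compose[OF D c'] lmod_hom_zero_map[OF L] _ that])
        (use z in \<open>simp add: Dt ct dc L.smult_r_null\<close>)
    then obtain b' where b': "b' \<in> lmod_hom A (Ind (P i)) L"
      "\<forall>y \<in> carrier (Ind (P (Suc i))). c' y = b' (Ind_map (P (Suc i)) (P i) (d i) y)"
      using ex[unfolded hom_exact_def, rule_format, OF c'] by blast
    have "c x = b' (tensor (P i) \<one>\<^bsub>A\<^esub> (d i x))" if x: "x \<in> carrier (P (Suc i))" for x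
      using bspec[OF b'(2) tensor_closed[OF P A.one_closed x]] x cc[OF x] by (simp add: ct Dt)
    then show "\<exists>b \<in> lmod_hom R (P i) ?L. \<forall>x \<in> carrier (P (Suc i)). c x = b (d i x)"
      by (intro bexI[OF _ lmod_hom_compose[OF unit_hom[OF P] restr[OF b'(1)]]] ballI)
  qed
next
  interpret L: left_module A L by fact
  let ?L = "restrict_scalars \<iota> L"
  note D = Ind_map_hom[OF P P d] and Dt = Ind_map_tensor[OF P P d] and dc = lmod_hom_closed[OF d]
  have restr: "c \<in> lmod_hom R (restrict_scalars \<iota> (Ind (P j))) ?L" if "c \<in> lmod_hom A (Ind (P j)) L" for c j
    by (rule lmod_homI) (simp_all add: lmod_hom_closed[OF that] lmod_hom_add[OF that] lmod_hom_smult[OF that])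
  assume ex: "hom_exact R P d ?L i"
  show "hom_exact A (\<lambda>j. Ind (P j)) (\<lambda>j. Ind_map (P (Suc j)) (P j) (d j)) L i"
    unfolding hom_exact_def
  proof (intro ballI impI)
    fix c assume c: "c \<in> lmod_hom A (Ind (P (Suc i))) L"
      and z: "\<forall>y \<in> carrier (Ind (P (Suc (Suc i)))). c (Ind_map (P (Suc (Suc i))) (P (Suc i)) (d (Suc i)) y) = \<zero>\<^bsub>L\<^esub>"
    have "c (tensor (P (Suc i)) \<one>\<^bsub>A\<^esub> (d (Suc i) x)) = \<zero>\<^bsub>?L\<^esub>" if x: "x \<in> carrier (P (Suc (Suc i)))" for x
      using bspec[OF z tensor_closed[OF P A.one_closed x]] x by (simp add: Dt)
    then obtain b where b: "b \<in> lmod_hom R (P i) ?L"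
      "\<forall>x \<in> carrier (P (Suc i)). c (tensor (P (Suc i)) \<one>\<^bsub>A\<^esub> x) = b (d i x)"
      using ex[unfolded hom_exact_def, rule_format, OF lmod_hom_compose[OF unit_hom[OF P] restr[OF c]]] by blast
    obtain b' where b': "b' \<in> lmod_hom A (Ind (P i)) L"
      and bt: "\<forall>a \<in> carrier A. \<forall>x \<in> carrier (P i). b' (tensor (P i) a x) = a \<odot>\<^bsub>L\<^esub> b x"
      using Ind_adjoint[OF P L b(1)] by blast
    have bc: "b x \<in> carrier L" if "x \<in> carrier (P i)" for x
      using lmod_hom_closed[OF b(1) that] by simp
    have "c y = b' (Ind_map (P (Suc i)) (P i) (d i) y)" if "y \<in> carrier (Ind (P (Suc i)))" for y
      by (rule Ind_hom_eq[OF P L c lmod_hom_compose[OF D b'] _ that])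
        (use b(2) in \<open>simp add: Dt bt dc bc\<close>)
    then show "\<exists>b \<in> lmod_hom A (Ind (P i)) L. \<forall>y \<in> carrier (Ind (P (Suc i))). c y = b (Ind_map (P (Suc i)) (P i) (d i) y)"
      by (intro bexI[OF _ b'] ballI)
  qed
qed

end

section \<open>Induction along a Frobenius extension is exact\<close>

text \<open>A as a finitely generated projective right R-module, spelled out by elements since the
  modules of this development are left modules: \<open>\<phi> i\<close> are right linear functionals
  and \<open>e i\<close> the generators dual to them.\<close>

locale right_dual_basis = ring_extension R A \<iota>
  for R :: "'r ring" and A :: "'a ring" and \<iota> +
  fixes k :: nat and e :: "nat \<Rightarrow> 'a" and \<phi> :: "nat \<Rightarrow> 'a \<Rightarrow> 'r"
  assumes e: "\<And>i. i < k \<Longrightarrow> e i \<in> carrier A"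
    and \<phi>: "\<And>i. i < k \<Longrightarrow> \<phi> i \<in> add_hom A R"
    and \<phi>_mult: "\<And>i b r. \<lbrakk>i < k; b \<in> carrier A; r \<in> carrier R\<rbrakk> \<Longrightarrow> \<phi> i (b \<otimes>\<^bsub>A\<^esub> \<iota> r) = \<phi> i b \<otimes>\<^bsub>R\<^esub> r"
    and expansion: "\<And>b. b \<in> carrier A \<Longrightarrow> b = (\<Oplus>\<^bsub>A\<^esub>i\<in>{..<k}. e i \<otimes>\<^bsub>A\<^esub> \<iota> (\<phi> i b))"
begin

text \<open>\<sigma> i is \<phi> i \<otimes> 1 from A \<otimes> M to R \<otimes> M = M. The last
  clause says that z \<mapsto> (\<sigma> i z) exhibits the additive group A \<otimes> M as a retract
  of M^k; the retraction sends (x i) to the sum of the e i \<otimes> x i.\<close>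

definition coordinates :: "('r, 'm) module \<Rightarrow> (nat \<Rightarrow> (('a \<times> 'm) \<Rightarrow>\<^sub>0 int) set \<Rightarrow> 'm) \<Rightarrow> bool" where
  "coordinates M \<sigma> \<longleftrightarrow> (\<forall>i<k. \<sigma> i \<in> add_hom (Ind M) M \<and>
       (\<forall>b \<in> carrier A. \<forall>x \<in> carrier M. \<sigma> i (tensor M b x) = \<phi> i b \<odot>\<^bsub>M\<^esub> x)) \<and>
     (\<forall>z \<in> carrier (Ind M). z = (\<Oplus>\<^bsub>Ind M\<^esub>i\<in>{..<k}. tensor M (e i) (\<sigma> i z)))"

lemma coordinatesD:
  assumes "coordinates M \<sigma>"
  shows "i < k \<Longrightarrow> \<sigma> i \<in> add_hom (Ind M) M"
    and "\<lbrakk>i < k; b \<in> carrier A; x \<in> carrier M\<rbrakk> \<Longrightarrow> \<sigma> i (tensor M b x) = \<phi> i b \<odot>\<^bsub>M\<^esub> x"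
    and "z \<in> carrier (Ind M) \<Longrightarrow> (\<Oplus>\<^bsub>Ind M\<^esub>i\<in>{..<k}. tensor M (e i) (\<sigma> i z)) = z"
  using assms unfolding coordinates_def by simp_all

text \<open>Right linearity of \<phi> i makes the pairing of b and x into (\<phi> i b) x balanced.
  In the expansion both sides are additive in z; on b \<otimes> x, expand b and move the scalars
  \<phi> i b across the tensor sign.\<close>

lemma coordinates_exist:
  assumes M: "left_module R M"
  shows "\<exists>\<sigma>. coordinates M \<sigma>"
proof -
  interpret M: left_module R M by fact
  interpret U: left_module A "Ind M" by (rule left_module_Ind[OF M])
  note \<phi>c = add_hom_closed[OF \<phi>]
  have "\<exists>h \<in> add_hom (Ind M) M. \<forall>b \<in> carrier A. \<forall>x \<in> carrier M. h (tensor M b x) = \<phi> i b \<odot>\<^bsub>M\<^esub> x"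
    if i: "i < k" for i
    by (rule Ind_lift[OF M M.M.abelian_group_axioms])
      (simp_all add: i \<phi>c add_hom_add[OF \<phi>] \<phi>_mult M.smult_l_distr M.smult_r_distr M.smult_assoc1)
  then obtain \<sigma> where \<sigma>: "\<And>i. i < k \<Longrightarrow> \<sigma> i \<in> add_hom (Ind M) M"
    "\<And>i b x. \<lbrakk>i < k; b \<in> carrier A; x \<in> carrier M\<rbrakk> \<Longrightarrow> \<sigma> i (tensor M b x) = \<phi> i b \<odot>\<^bsub>M\<^esub> x"
    by metis
  note \<sigma>c = add_hom_closed[OF \<sigma>(1)]
  have sum: "(\<lambda>z. \<Oplus>\<^bsub>Ind M\<^esub>i\<in>{..<k}. tensor M (e i) (\<sigma> i z)) \<in> add_hom (Ind M) (Ind M)"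
  proof (rule add_homI)
    fix z assume "z \<in> carrier (Ind M)"
    then show "(\<Oplus>\<^bsub>Ind M\<^esub>i\<in>{..<k}. tensor M (e i) (\<sigma> i z)) \<in> carrier (Ind M)"
      by (intro U.M.finsum_closed) (auto simp: M e \<sigma>c)
  next
    fix z w assume zw: "z \<in> carrier (Ind M)" "w \<in> carrier (Ind M)"
    have "(\<Oplus>\<^bsub>Ind M\<^esub>i\<in>{..<k}. tensor M (e i) (\<sigma> i (z \<oplus>\<^bsub>Ind M\<^esub> w))) =
        (\<Oplus>\<^bsub>Ind M\<^esub>i\<in>{..<k}. tensor M (e i) (\<sigma> i z) \<oplus>\<^bsub>Ind M\<^esub> tensor M (e i) (\<sigma> i w))"
      using zw by (intro U.M.finsum_cong') (auto simp: M e \<sigma>c add_hom_add[OF \<sigma>(1)] tensor_add_right[OF M])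
    also have "\<dots> = (\<Oplus>\<^bsub>Ind M\<^esub>i\<in>{..<k}. tensor M (e i) (\<sigma> i z)) \<oplus>\<^bsub>Ind M\<^esub> (\<Oplus>\<^bsub>Ind M\<^esub>i\<in>{..<k}. tensor M (e i) (\<sigma> i w))"
      using zw by (intro U.M.finsum_addf) (auto simp: M e \<sigma>c)
    finally show "(\<Oplus>\<^bsub>Ind M\<^esub>i\<in>{..<k}. tensor M (e i) (\<sigma> i (z \<oplus>\<^bsub>Ind M\<^esub> w))) =
        (\<Oplus>\<^bsub>Ind M\<^esub>i\<in>{..<k}. tensor M (e i) (\<sigma> i z)) \<oplus>\<^bsub>Ind M\<^esub> (\<Oplus>\<^bsub>Ind M\<^esub>i\<in>{..<k}. tensor M (e i) (\<sigma> i w))" .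
  qed
  have "z = (\<Oplus>\<^bsub>Ind M\<^esub>i\<in>{..<k}. tensor M (e i) (\<sigma> i z))" if z: "z \<in> carrier (Ind M)" for z
  proof (rule Ind_add_hom_eq[OF M U.M.abelian_group_axioms _ sum _ z])
    show "(\<lambda>z. z) \<in> add_hom (Ind M) (Ind M)"
      by (rule add_homI) simp_all
    fix b x assume b: "b \<in> carrier A" and x: "x \<in> carrier M"
    have "tensor M b x = tensor M (\<Oplus>\<^bsub>A\<^esub>i\<in>{..<k}. e i \<otimes>\<^bsub>A\<^esub> \<iota> (\<phi> i b)) x"
      using expansion[OF b] by simp
    also have "\<dots> = (\<Oplus>\<^bsub>Ind M\<^esub>i\<in>{..<k}. tensor M (e i \<otimes>\<^bsub>A\<^esub> \<iota> (\<phi> i b)) x)"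
      by (rule add_hom_finsum[OF A.abelian_group_axioms U.M.abelian_group_axioms tensor_hom_left[OF M x]])
        (auto simp: e \<phi>c b)
    also have "\<dots> = (\<Oplus>\<^bsub>Ind M\<^esub>i\<in>{..<k}. tensor M (e i) (\<sigma> i (tensor M b x)))"
      using b x by (intro U.M.finsum_cong') (auto simp: M e \<phi>c \<sigma>(2) tensor_balanced[OF M])
    finally show "tensor M b x = (\<Oplus>\<^bsub>Ind M\<^esub>i\<in>{..<k}. tensor M (e i) (\<sigma> i (tensor M b x)))" .
  qed
  with \<sigma> show ?thesis
    unfolding coordinates_def by (intro exI[of _ \<sigma>]) simp
qed

text \<open>One inclusion is g f = 0. For the other, coordinates are natural, so those of an element
  of the kernel lie in the kernel of g, hence in the image of f; preimages x i assemble to the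
  preimage given by the sum of the e i \<otimes> x i.\<close>

lemma Ind_exact:
  assumes M: "left_module R M" and N: "left_module R N" and L: "left_module R L"
    and f: "f \<in> lmod_hom R M N" and g: "g \<in> lmod_hom R N L"
    and exact: "f ` carrier M = a_kernel N L g"
  shows "Ind_map M N f ` carrier (Ind M) = a_kernel (Ind N) (Ind L) (Ind_map N L g)"
proof (intro equalityI subsetI)
  interpret L: left_module R L by fact
  interpret UL: left_module A "Ind L" by (rule left_module_Ind[OF L])
  note F = Ind_map_hom[OF M N f] and G = Ind_map_hom[OF N L g]
  have fg: "f x \<in> carrier N" "g (f x) = \<zero>\<^bsub>L\<^esub>" if "x \<in> carrier M" for x
    using exact that by (auto simp: a_kernel_iff set_eq_iff image_iff)
  fix z assume "z \<in> Ind_map M N f ` carrier (Ind M)"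
  then obtain w where w: "w \<in> carrier (Ind M)" "z = Ind_map M N f w" by blast
  have "Ind_map N L g (Ind_map M N f w) = \<zero>\<^bsub>Ind L\<^esub>"
  proof (rule Ind_hom_eq[OF M UL.left_module_axioms lmod_hom_compose[OF F G] lmod_hom_zero_map[OF UL.left_module_axioms] _ w(1)])
    fix x assume "x \<in> carrier M"
    then show "Ind_map N L g (Ind_map M N f (tensor M \<one>\<^bsub>A\<^esub> x)) = \<zero>\<^bsub>Ind L\<^esub>"
      using fg add_hom_zero[OF L.M.abelian_group_axioms UL.M.abelian_group_axioms tensor_hom_right[OF L]]
      by (simp add: Ind_map_tensor[OF M N f] Ind_map_tensor[OF N L g])
  qed
  then show "z \<in> a_kernel (Ind N) (Ind L) (Ind_map N L g)"
    using w lmod_hom_closed[OF F] by (simp add: a_kernel_iff)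
next
  interpret M: left_module R M by fact
  interpret N: left_module R N by fact
  interpret L: left_module R L by fact
  interpret UM: left_module A "Ind M" by (rule left_module_Ind[OF M])
  interpret UN: left_module A "Ind N" by (rule left_module_Ind[OF N])
  interpret UL: left_module A "Ind L" by (rule left_module_Ind[OF L])
  note F = Ind_map_hom[OF M N f] and G = Ind_map_hom[OF N L g]
  obtain \<sigma> where "coordinates N \<sigma>"
    using coordinates_exist[OF N] by blast
  note \<sigma> = coordinatesD[OF this]
  obtain \<tau> where "coordinates L \<tau>"
    using coordinates_exist[OF L] by blast
  note \<tau> = coordinatesD[OF this]
  fix z assume "z \<in> a_kernel (Ind N) (Ind L) (Ind_map N L g)"
  then have z: "z \<in> carrier (Ind N)" and gz: "Ind_map N L g z = \<zero>\<^bsub>Ind L\<^esub>"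
    by (simp_all add: a_kernel_iff)
  have "\<exists>x \<in> carrier M. f x = \<sigma> i z" if i: "i < k" for i
  proof -
    \<comment> \<open>Naturality of the coordinates: on b \<otimes> y both sides equal \<phi> i b
      times g y.\<close>
    have "g (\<sigma> i z) = \<tau> i (Ind_map N L g z)"
      by (rule Ind_add_hom_eq[OF N L.M.abelian_group_axioms add_hom_compose[OF \<sigma>(1)[OF i] add_hom_of_lmod_hom[OF g]]
            add_hom_compose[OF add_hom_of_lmod_hom[OF G] \<tau>(1)[OF i]] _ z])
        (simp add: i \<sigma>(2) \<tau>(2) Ind_map_tensor[OF N L g] lmod_hom_closed[OF g] lmod_hom_smult[OF g] add_hom_closed[OF \<phi>])
    also have "\<dots> = \<zero>\<^bsub>L\<^esub>"
      unfolding gz by (rule add_hom_zero[OF UL.M.abelian_group_axioms L.M.abelian_group_axioms \<tau>(1)[OF i]])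
    finally have "\<sigma> i z \<in> f ` carrier M"
      unfolding exact by (simp add: a_kernel_iff add_hom_closed[OF \<sigma>(1)[OF i] z])
    then show ?thesis by force
  qed
  then obtain x where x: "\<And>i. i < k \<Longrightarrow> x i \<in> carrier M" "\<And>i. i < k \<Longrightarrow> f (x i) = \<sigma> i z"
    by metis
  let ?w = "\<Oplus>\<^bsub>Ind M\<^esub>i\<in>{..<k}. tensor M (e i) (x i)"
  have "Ind_map M N f ?w = (\<Oplus>\<^bsub>Ind N\<^esub>i\<in>{..<k}. Ind_map M N f (tensor M (e i) (x i)))"
    by (rule lmod_hom_finsum[OF UM.left_module_axioms UN.left_module_axioms F]) (auto simp: M e x)
  also have "\<dots> = (\<Oplus>\<^bsub>Ind N\<^esub>i\<in>{..<k}. tensor N (e i) (\<sigma> i z))"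
    using z by (intro UN.M.finsum_cong')
      (auto simp: N e x Ind_map_tensor[OF M N f] add_hom_closed[OF \<sigma>(1)])
  also have "\<dots> = z"
    using \<sigma>(3)[OF z] by simp
  finally show "z \<in> Ind_map M N f ` carrier (Ind M)"
    by (intro image_eqI[of _ _ ?w] UM.M.finsum_closed) (auto simp: M e x)
qed

text \<open>Surjectivity is exactness of M \<rightarrow> N \<rightarrow> N with the zero
  endomorphism second, so \<open>Ind_exact\<close> applies without a separate zero module.\<close>

lemma Ind_surj:
  assumes M: "left_module R M" and N: "left_module R N" and f: "f \<in> lmod_hom R M N"
    and surj: "f ` carrier M = carrier N"
  shows "Ind_map M N f ` carrier (Ind M) = carrier (Ind N)"
proof -
  interpret N: left_module R N by fact
  interpret UN: left_module A "Ind N" by (rule left_module_Ind[OF N])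
  have zero: "(\<lambda>x. \<zero>\<^bsub>N\<^esub>) \<in> lmod_hom R N N" by (rule lmod_hom_zero_map[OF N])
  have "Ind_map N N (\<lambda>x. \<zero>\<^bsub>N\<^esub>) z = \<zero>\<^bsub>Ind N\<^esub>" if "z \<in> carrier (Ind N)" for z
    by (rule Ind_hom_eq[OF N UN.left_module_axioms Ind_map_hom[OF N N zero] lmod_hom_zero_map[OF UN.left_module_axioms] _ that])
      (simp add: Ind_map_tensor[OF N N zero]
        add_hom_zero[OF N.M.abelian_group_axioms UN.M.abelian_group_axioms tensor_hom_right[OF N]])
  moreover have "f ` carrier M = a_kernel N N (\<lambda>x. \<zero>\<^bsub>N\<^esub>)"
    using surj by (auto simp: a_kernel_iff)
  from Ind_exact[OF M N N f zero this]
  have "Ind_map M N f ` carrier (Ind M) = a_kernel (Ind N) (Ind N) (Ind_map N N (\<lambda>x. \<zero>\<^bsub>N\<^esub>))" .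
  ultimately show ?thesis
    by (auto simp: a_kernel_iff)
qed

text \<open>Injectivity is exactness of M \<rightarrow> M \<rightarrow> N with the zero endomorphism
  first.\<close>

lemma Ind_inj:
  assumes M: "left_module R M" and N: "left_module R N" and f: "f \<in> lmod_hom R M N"
    and inj: "inj_on f (carrier M)"
  shows "inj_on (Ind_map M N f) (carrier (Ind M))"
proof -
  interpret M: left_module R M by fact
  interpret UM: left_module A "Ind M" by (rule left_module_Ind[OF M])
  interpret UN: left_module A "Ind N" by (rule left_module_Ind[OF N])
  have zero: "(\<lambda>x. \<zero>\<^bsub>M\<^esub>) \<in> lmod_hom R M M" by (rule lmod_hom_zero_map[OF M])
  have Z: "Ind_map M M (\<lambda>x. \<zero>\<^bsub>M\<^esub>) z = \<zero>\<^bsub>Ind M\<^esub>" if "z \<in> carrier (Ind M)" for z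
    by (rule Ind_hom_eq[OF M UM.left_module_axioms Ind_map_hom[OF M M zero] lmod_hom_zero_map[OF UM.left_module_axioms] _ that])
      (simp add: Ind_map_tensor[OF M M zero]
        add_hom_zero[OF M.M.abelian_group_axioms UM.M.abelian_group_axioms tensor_hom_right[OF M]])
  have "x = \<zero>\<^bsub>M\<^esub>" if "x \<in> carrier M" "f x = \<zero>\<^bsub>N\<^esub>" for x
    using inj_onD[OF inj, of x "\<zero>\<^bsub>M\<^esub>"] that lmod_hom_zero[OF M N f] by simp
  then have "(\<lambda>x. \<zero>\<^bsub>M\<^esub>) ` carrier M = a_kernel M N f"
    using lmod_hom_zero[OF M N f] M.M.zero_closed by (auto simp: a_kernel_iff)
  note ker = Ind_exact[OF M M N zero f this]
  note F = Ind_map_hom[OF M N f]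
  show ?thesis
  proof (rule inj_onI)
    fix z w assume zw: "z \<in> carrier (Ind M)" "w \<in> carrier (Ind M)" "Ind_map M N f z = Ind_map M N f w"
    then have "z \<ominus>\<^bsub>Ind M\<^esub> w \<in> a_kernel (Ind M) (Ind N) (Ind_map M N f)"
      using lmod_hom_closed[OF F]
      by (simp add: a_kernel_iff lmod_hom_minus[OF UM.left_module_axioms UN.left_module_axioms F] UN.M.minus_eq_zero_iff)
    then have "z \<ominus>\<^bsub>Ind M\<^esub> w = \<zero>\<^bsub>Ind M\<^esub>"
      unfolding ker[symmetric] using Z by auto
    then show "z = w"
      using zw by (simp add: UM.M.minus_eq_zero_iff)
  qed
qed

section \<open>Induced resolutions and coresolutions\<close>

lemma Ind_resolution:
  assumes M: "left_module R M" and P: "resolution R P d \<epsilon> M"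
  shows "resolution A (\<lambda>j. Ind (P j)) (\<lambda>j. Ind_map (P (Suc j)) (P j) (d j)) (Ind_map (P 0) M \<epsilon>) (Ind M)"
proof -
  note PD = resolutionD[OF P]
  have d: "d 0 ` carrier (P (Suc 0)) = a_kernel (P 0) M \<epsilon>"
    "d (Suc j) ` carrier (P (Suc (Suc j))) = a_kernel (P (Suc j)) (P j) (d j)" for j
    using P by (simp_all add: resolution_def)
  show ?thesis
    unfolding resolution_def
    using left_module_Ind[OF PD(1)] Ind_map_hom[OF PD(1) M PD(2)] Ind_map_hom[OF PD(1) PD(1) PD(3)]
      Ind_surj[OF PD(1) M PD(2) PD(4)] Ind_exact[OF PD(1) PD(1) M PD(3) PD(2) d(1)]
      Ind_exact[OF PD(1) PD(1) PD(1) PD(3) PD(3) d(2)]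
    by simp
qed

lemma Ind_coresolution:
  assumes M: "left_module R M" and Q: "coresolution R M \<eta> Q d"
  shows "coresolution A (Ind M) (Ind_map M (Q 0) \<eta>) (\<lambda>j. Ind (Q j)) (\<lambda>j. Ind_map (Q j) (Q (Suc j)) (d j))"
proof -
  note QD = coresolutionD[OF Q]
  show ?thesis
    unfolding coresolution_def
    using left_module_Ind[OF QD(1)] Ind_map_hom[OF M QD(1) QD(2)] Ind_map_hom[OF QD(1) QD(1) QD(3)]
      Ind_inj[OF M QD(1) QD(2) QD(4)] Ind_exact[OF M QD(1) QD(1) QD(2) _ QD(5)] QD(3)[of 0]
      Ind_exact[OF QD(1) QD(1) QD(1) QD(3) QD(3) QD(6)]
    by simp
qed

end

text \<open>
  A dual basis \<open>(x i, f i)\<close> of \<open>A\<close> as a left module yields the dual basis \<open>f i, (g \<mapsto> g (x i))\<close> of the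
  right module \<open>Hom\<^sub>R(A, R)\<close>, which \<open>\<Phi>\<close> identifies with \<open>A\<close>.
\<close>

lemma frobenius_right_dual_basis:
  assumes "frobenius_extension R A \<iota>"
  shows "\<exists>k e \<phi>. right_dual_basis R A \<iota> k e \<phi>"
proof -
  let ?A = "restrict_scalars \<iota> (regular_module A)"
  from assms have R: "ring R" and A: "ring A" and \<iota>: "\<iota> \<in> ring_hom R A"
    and fg: "fin_gen_lmod R ?A" and proj: "projective_lmod R ?A"
    by (simp_all add: frobenius_extension_def)
  obtain \<Phi> where iso: "\<Phi> \<in> iso (add_monoid A) (Hom_group R ?A (regular_module R))"
    and \<Phi>: "\<forall>b \<in> carrier A. \<forall>r \<in> carrier R. \<Phi> (b \<otimes>\<^bsub>A\<^esub> \<iota> r) = (\<lambda>x\<in>carrier A. \<Phi> b x \<otimes>\<^bsub>R\<^esub> r)"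
    using assms unfolding frobenius_extension_def by blast
  interpret ring_extension R A \<iota>
    by (intro ring_extension.intro ring_extension_axioms.intro R A \<iota>)
  have LR: "left_module R (regular_module R)" by (rule left_module_regular[OF R])
  have LA: "left_module R ?A" by (rule projective_lmodD(1)[OF proj])
  interpret LA: left_module R ?A by (rule LA)
  obtain k :: nat where "retract R ?A (free_lmod {..<k} R)"
    using fin_gen_retract_free[OF LA fg] projective_lmodD(2)[OF proj] by blast
  then obtain s p where s: "s \<in> lmod_hom R ?A (free_lmod {..<k} R)"
    and p: "p \<in> lmod_hom R (free_lmod {..<k} R) ?A"
    and ps: "\<And>x. x \<in> carrier ?A \<Longrightarrow> p (s x) = x"
    unfolding retract_def by blast
  \<comment> \<open>The left dual basis: \<open>x i\<close> are the images of the unit vectors and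
    \<open>f i\<close> the coordinates of the section, made extensional so that they lie in the
    target of \<Phi>.\<close>
  define x where "x i = p (copies_in (regular_module R) i \<one>\<^bsub>R\<^esub>)" for i
  define f where "f i = (\<lambda>b\<in>carrier A. s b i)" for i
  have x: "x i \<in> carrier A" if "i < k" for i
    using lmod_hom_closed[OF p free_unit[OF R, of i "{..<k}"]] that by (simp add: x_def)
  have sc: "s b i \<in> carrier R" if "b \<in> carrier A" for b i
    using lmod_hom_closed[OF s, of b] that by (simp add: lmod_copies_def)
  have f: "f i \<in> carrier (Hom_group R ?A (regular_module R))" for i
  proof -
    have "(\<lambda>b. s b i) \<in> lmod_hom R ?A (regular_module R)"
    proof (rule lmod_homI)
      fix b c assume "b \<in> carrier ?A" "c \<in> carrier ?A"
      then show "s (b \<oplus>\<^bsub>?A\<^esub> c) i = s b i \<oplus>\<^bsub>regular_module R\<^esub> s c i"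
        by (subst lmod_hom_add[OF s]) (simp_all add: lmod_copies_def)
    next
      fix r b assume "r \<in> carrier R" "b \<in> carrier ?A"
      then show "s (r \<odot>\<^bsub>?A\<^esub> b) i = r \<odot>\<^bsub>regular_module R\<^esub> s b i"
        by (subst lmod_hom_smult[OF s]) (simp_all add: lmod_copies_def)
    qed (simp add: sc)
    from restrict_in_Hom_group[OF LA this] show ?thesis by (simp add: f_def)
  qed
  have expand: "b = (\<Oplus>\<^bsub>?A\<^esub>i\<in>{..<k}. s b i \<odot>\<^bsub>?A\<^esub> x i)" if "b \<in> carrier A" for b
    using free_hom_expansion[OF LA p lmod_hom_closed[OF s]] ps that by (simp add: x_def)
  have bij: "bij_betw \<Phi> (carrier A) (carrier (Hom_group R ?A (regular_module R)))"
    using iso by (simp add: iso_def)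
  \<comment> \<open>The f i generate Hom(A, R) as a right R-module, as each g is the sum of the f i
    times g (x i). Their preimages under \<Phi> become the new generators, and b \<mapsto> \<Phi> b
    (x i) the new functionals.\<close>
  define e where "e i = inv_into (carrier A) \<Phi> (f i)" for i
  have e: "e i \<in> carrier A" "\<Phi> (e i) = f i" for i
    using f[of i] bij by (auto simp: e_def bij_betw_def intro: inv_into_into f_inv_into_f)
  have \<Phi>_hom: "\<Phi> b \<in> lmod_hom R ?A (regular_module R)" "\<Phi> b \<in> extensional (carrier A)" if "b \<in> carrier A" for b
    using bij_betwE[OF bij] that by (auto simp: Hom_group_def)
  have eval: "(\<lambda>b. \<Phi> b y) \<in> add_hom A R" if y: "y \<in> carrier A" for y
  proof (rule add_homI)
    fix b c assume bc: "b \<in> carrier A" "c \<in> carrier A"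
    have "\<Phi> (b \<oplus>\<^bsub>A\<^esub> c) = \<Phi> b \<otimes>\<^bsub>Hom_group R ?A (regular_module R)\<^esub> \<Phi> c"
      using iso bc by (auto simp: iso_def hom_def)
    then show "\<Phi> (b \<oplus>\<^bsub>A\<^esub> c) y = \<Phi> b y \<oplus>\<^bsub>R\<^esub> \<Phi> c y"
      using y by (simp add: Hom_group_def)
  qed (use lmod_hom_closed[OF \<Phi>_hom(1)] y in simp)
  note ec = add_hom_closed[OF eval]
  show ?thesis
  proof (intro exI right_dual_basis.intro right_dual_basis_axioms.intro ring_extension_axioms)
    show "e i \<in> carrier A" for i by (rule e)
    show "(\<lambda>b. \<Phi> b (x i)) \<in> add_hom A R" if "i < k" for i
      by (rule eval[OF x[OF that]])
    show "\<Phi> (b \<otimes>\<^bsub>A\<^esub> \<iota> r) (x i) = \<Phi> b (x i) \<otimes>\<^bsub>R\<^esub> r"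
      if "i < k" "b \<in> carrier A" "r \<in> carrier R" for i b r
      using \<Phi> that x by simp
    show "b = (\<Oplus>\<^bsub>A\<^esub>i\<in>{..<k}. e i \<otimes>\<^bsub>A\<^esub> \<iota> (\<Phi> b (x i)))" if b: "b \<in> carrier A" for b
    proof -
      let ?c = "\<Oplus>\<^bsub>A\<^esub>i\<in>{..<k}. e i \<otimes>\<^bsub>A\<^esub> \<iota> (\<Phi> b (x i))"
      have c: "?c \<in> carrier A"
        by (intro A.finsum_closed) (auto simp: e ec x b)
      \<comment> \<open>Since \<Phi> is injective, it suffices to compare values at y, and y is
        expanded in the left dual basis.\<close>
      have "\<Phi> b y = \<Phi> ?c y" if y: "y \<in> carrier A" for y
      proof -
        have "\<Phi> b y = \<Phi> b (\<Oplus>\<^bsub>?A\<^esub>i\<in>{..<k}. s y i \<odot>\<^bsub>?A\<^esub> x i)"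
          using expand[OF y] by simp
        also have "\<dots> = (\<Oplus>\<^bsub>regular_module R\<^esub>i\<in>{..<k}. \<Phi> b (s y i \<odot>\<^bsub>?A\<^esub> x i))"
          by (rule lmod_hom_finsum[OF LA LR \<Phi>_hom(1)[OF b]]) (auto simp: sc y x)
        \<comment> \<open>\<open>finsum\<close> reads only carrier, zero and addition, where the
          regular module agrees with R.\<close>
        also have "\<dots> = (\<Oplus>\<^bsub>R\<^esub>i\<in>{..<k}. \<Phi> b (s y i \<odot>\<^bsub>?A\<^esub> x i))"
          by (simp add: finsum_def finprod_def regular_module_def)
        also have "\<dots> = (\<Oplus>\<^bsub>R\<^esub>i\<in>{..<k}. \<Phi> (e i \<otimes>\<^bsub>A\<^esub> \<iota> (\<Phi> b (x i))) y)"
        proof (rule R.finsum_cong')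
          fix i assume "i \<in> {..<k}"
          then have i: "i < k" by simp
          have "\<Phi> b (s y i \<odot>\<^bsub>?A\<^esub> x i) = s y i \<otimes>\<^bsub>R\<^esub> \<Phi> b (x i)"
            using lmod_hom_smult[OF \<Phi>_hom(1)[OF b], of "s y i" "x i"] sc y x[OF i] by simp
          \<comment> \<open>Here s y i is f i y = \<Phi> (e i) y, and right linearity of \<Phi>
            absorbs the factor \<Phi> b (x i) into the argument.\<close>
          also have "\<dots> = \<Phi> (e i \<otimes>\<^bsub>A\<^esub> \<iota> (\<Phi> b (x i))) y"
            using \<Phi> e[of i] ec[OF x[OF i] b] y by (simp add: f_def)
          finally show "\<Phi> b (s y i \<odot>\<^bsub>?A\<^esub> x i) = \<Phi> (e i \<otimes>\<^bsub>A\<^esub> \<iota> (\<Phi> b (x i))) y" .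
        qed (auto intro!: ec y A.m_closed e \<iota>_closed x b)
        also have "\<dots> = \<Phi> ?c y"
          by (rule add_hom_finsum[OF A.abelian_group_axioms R.abelian_group_axioms eval[OF y], symmetric])
            (auto simp: e ec x b)
        finally show ?thesis .
      qed
      then have "\<Phi> b = \<Phi> ?c"
        using \<Phi>_hom(2)[OF b] \<Phi>_hom(2)[OF c] by (auto intro: extensionalityI)
      then show ?thesis
        using bij b c by (auto simp: bij_betw_def dest: inj_onD)
    qed
  qed
qed

section \<open>The three tilting conditions for the induced module\<close>

theorem proposition2p6:
  fixes R :: "'r ring" and A :: "'a ring" and \<iota> :: "'r \<Rightarrow> 'a" and T :: "('r, 't) module"
  assumes "frobenius_extension R A \<iota>"
    and "tilting R T"
  shows "tilting A (induced_module R A \<iota> T) \<longleftrightarrow>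
    (\<forall>i > 0. trivial_group (Ext R i T (restrict_scalars \<iota> (induced_module R A \<iota> T))))"
proof -
  obtain k e \<phi> where "right_dual_basis R A \<iota> k e \<phi>"
    using frobenius_right_dual_basis[OF assms(1)] by blast
  then interpret right_dual_basis R A \<iota> k e \<phi> .
  have T: "left_module R T" using assms(2) by (simp add: tilting_def)
  let ?U = "Ind T"
  have U: "left_module A ?U" by (rule left_module_Ind[OF T])
  have RR: "left_module R (regular_module R)" and AA: "left_module A (regular_module A)"
    by (rule left_module_regular R.ring_axioms A.ring_axioms)+

  have fin_res: "\<exists>(m :: nat) (P :: nat \<Rightarrow> ('a, nat \<Rightarrow> 'a) module) d \<epsilon>. resolution A P d \<epsilon> ?U \<and>
      (\<forall>j \<le> m. fin_gen_lmod A (P j) \<and> projective_lmod A (P j)) \<and> (\<forall>j > m. carrier (P j) = {\<zero>\<^bsub>P j\<^esub>})"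
  proof -
    obtain m and P :: "nat \<Rightarrow> ('r, nat \<Rightarrow> 'r) module" and d \<epsilon>
      where P: "resolution R P d \<epsilon> T"
        and proj: "\<forall>j \<le> m. fin_gen_lmod R (P j) \<and> projective_lmod R (P j)"
        and zero: "\<forall>j > m. carrier (P j) = {\<zero>\<^bsub>P j\<^esub>}"
      using assms(2) unfolding tilting_def by blast
    note PD = resolutionD[OF P]
    \<comment> \<open>Zero terms beyond m are retracts of any R^k, so one choice of ranks and of
      transported terms serves all degrees.\<close>
    have "\<exists>k :: nat. retract R (P j) (free_lmod {..<k} R)" for j
    proof (cases "j \<le> m")
      case True
      then show ?thesis
        using fin_gen_retract_free[OF PD(1)] proj projective_lmodD(2) by blast
    next
      case False
      then show ?thesis
        using zero by (intro exI retract_zero[OF PD(1) left_module_copies[OF RR]]) simp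
    qed
    then obtain k :: "nat \<Rightarrow> nat" where k: "\<And>j. retract R (P j) (free_lmod {..<k j} R)"
      by metis
    note ret = Ind_projective[OF PD(1) k]
    \<comment> \<open>The isomorphic copy is cut out of A^k, whose elements are functions from the
      naturals to A, as \<open>tilting\<close> prescribes.\<close>
    have "\<exists>(P' :: ('a, nat \<Rightarrow> 'a) module) h h'. left_module A P' \<and> lmod_inverses A (Ind (P j)) P' h h'" for j
      by (rule retract_image[OF left_module_Ind[OF PD(1)] left_module_copies[OF AA] ret])
    then obtain P' :: "nat \<Rightarrow> ('a, nat \<Rightarrow> 'a) module" and h h'
      where P': "\<And>j. left_module A (P' j)" and hh': "\<And>j. lmod_inverses A (Ind (P j)) (P' j) (h j) (h' j)"
      by metis
    have ret': "retract A (P' j) (free_lmod {..<k j} A)" for j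
      by (rule retract_trans[OF lmod_inverses_retract[OF hh'] ret])
    have "carrier (P' j) = {\<zero>\<^bsub>P' j\<^esub>}" if "j > m" for j
      using lmod_inverses_image(2)[OF hh', of j] Ind_zero[OF PD(1)] zero that
        lmod_hom_zero[OF left_module_Ind[OF PD(1)] P' lmod_inversesD(1)[OF hh']] by simp
    then show ?thesis
      using resolution_transport[OF U Ind_resolution[OF T P] P' hh']
        fin_gen_lmodI[OF P' ret'] projective_lmodI[OF P' ret'] by blast
  qed

  have fin_cores: "\<exists>(n :: nat) (Q :: nat \<Rightarrow> ('a, nat \<Rightarrow> (('a \<times> 't) \<Rightarrow>\<^sub>0 int) set) module) d \<eta>.
      coresolution A (regular_module A) \<eta> Q d \<and>
      (\<forall>j \<le> n. add_class A ?U (Q j)) \<and> (\<forall>j > n. carrier (Q j) = {\<zero>\<^bsub>Q j\<^esub>})"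
  proof -
    obtain n and Q :: "nat \<Rightarrow> ('r, nat \<Rightarrow> 't) module" and d \<eta>
      where Q: "coresolution R (regular_module R) \<eta> Q d"
        and add: "\<forall>j \<le> n. add_class R T (Q j)"
        and zero: "\<forall>j > n. carrier (Q j) = {\<zero>\<^bsub>Q j\<^esub>}"
      using assms(2) unfolding tilting_def by blast
    note QD = coresolutionD[OF Q]
    have "\<exists>k :: nat. retract R (Q j) (lmod_copies {..<k} T)" for j
    proof (cases "j \<le> n")
      case True
      then show ?thesis
        using add direct_summand_iff_retract[OF QD(1) left_module_copies[OF T]]
        unfolding add_class_def by blast
    next
      case False
      then show ?thesis
        using zero by (intro exI retract_zero[OF QD(1) left_module_copies[OF T]]) simp
    qed
    then obtain k :: "nat \<Rightarrow> nat" where k: "\<And>j. retract R (Q j) (lmod_copies {..<k j} T)"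
      by metis
    \<comment> \<open>A summand of T^k induces a summand of A \<otimes> T^k, which in turn is a
      summand of U^k.\<close>
    have ret: "retract A (Ind (Q j)) (lmod_copies {..<k j} ?U)" for j
      by (rule retract_trans[OF retract_Ind[OF QD(1) left_module_copies[OF T] k] Ind_copies[OF T]])
    have "\<exists>(Q' :: ('a, nat \<Rightarrow> (('a \<times> 't) \<Rightarrow>\<^sub>0 int) set) module) h h'.
        left_module A Q' \<and> lmod_inverses A (Ind (Q j)) Q' h h'" for j
      by (rule retract_image[OF left_module_Ind[OF QD(1)] left_module_copies[OF U] ret])
    then obtain Q' :: "nat \<Rightarrow> ('a, nat \<Rightarrow> (('a \<times> 't) \<Rightarrow>\<^sub>0 int) set) module" and h h'
      where Q': "\<And>j. left_module A (Q' j)" and hh': "\<And>j. lmod_inverses A (Ind (Q j)) (Q' j) (h j) (h' j)"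
      by metis
    have "add_class A ?U (Q' j)" for j
      unfolding add_class_def direct_summand_iff_retract[OF Q' left_module_copies[OF U]]
      using Q' retract_trans[OF lmod_inverses_retract[OF hh'] ret] by blast
    moreover have "carrier (Q' j) = {\<zero>\<^bsub>Q' j\<^esub>}" if "j > n" for j
      using lmod_inverses_image(2)[OF hh', of j] Ind_zero[OF QD(1)] zero that
        lmod_hom_zero[OF left_module_Ind[OF QD(1)] Q' lmod_inversesD(1)[OF hh']] by simp
    \<comment> \<open>The induced coresolution starts at A \<otimes> R; this isomorphism lets it
      start at A.\<close>
    moreover obtain b where "lmod_inverses A (regular_module A) (Ind (regular_module R))
        (\<lambda>a. tensor (regular_module R) a \<one>\<^bsub>R\<^esub>) b"
      using Ind_regular by blast
    ultimately show ?thesis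
      using coresolution_transport[OF Ind_coresolution[OF RR Q] _ Q' hh'] by blast
  qed

  have ext: "trivial_group (Ext A (Suc i) ?U ?U) \<longleftrightarrow> trivial_group (Ext R (Suc i) T (restrict_scalars \<iota> ?U))" for i
  proof -
    obtain P :: "nat \<Rightarrow> ('r, ('r + 't) list \<Rightarrow> 'r) module" and d \<epsilon>
      where "projective_resolution R P d \<epsilon> T"
      using projective_resolution_exists[OF T] by blast
    then have P: "resolution R P d \<epsilon> T" and "\<And>j. projective_lmod R (P j)"
      by (auto simp: projective_resolution_def)
    note proj = projective_lmodD(2)[OF this(2)] and PD = resolutionD[OF P]
    \<comment> \<open>The index sets keep the type belonging to R and T, which is not that of the
      resolution chosen for U; \<open>trivial_Ext_iff\<close> accepts any index type.\<close>
    have "\<exists>X :: (('r + 't) list \<Rightarrow> 'r) set. retract A (Ind (P j)) (free_lmod X A)" for j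
      using proj[of j] Ind_projective[OF PD(1)] by blast
    from trivial_Ext_iff[OF U U Ind_resolution[OF T P] this]
    have "trivial_group (Ext A (Suc i) ?U ?U) \<longleftrightarrow>
        hom_exact A (\<lambda>j. Ind (P j)) (\<lambda>j. Ind_map (P (Suc j)) (P j) (d j)) ?U i" .
    also have "\<dots> \<longleftrightarrow> hom_exact R P d (restrict_scalars \<iota> ?U) i"
      by (rule hom_exact_Ind[where P = P and d = d, OF PD(1) PD(3) U])
    also have "\<dots> \<longleftrightarrow> trivial_group (Ext R (Suc i) T (restrict_scalars \<iota> ?U))"
      by (rule trivial_Ext_iff[OF T left_module_restrict_scalars[OF U] P proj, symmetric])
    finally show ?thesis .
  qed
  have "(\<forall>i > 0. trivial_group (Ext A i ?U ?U)) \<longleftrightarrow>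
      (\<forall>i > 0. trivial_group (Ext R i T (restrict_scalars \<iota> ?U)))"
    using ext by (metis gr0_implies_Suc)
  then show ?thesis
    unfolding tilting_def using U fin_res fin_cores by blast
qed

end
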